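(* Let $n\ge1$ and let $f,g\in H^{\odot n}$ be symmetric tensors. Then the random vector $(F,G)=(I_n(f),I_n(g))$ does not admit a density with respect to Lebesgue measure on $\mathbb R^2$ if and only if $\det C=0$, where $C$ denotes the covariance matrix of $(F,G)$. In other words, $(F,G)$ does not admit a density if and only if its components are proportional (i.e. there is $(a,b)\in\mathbb R^2\setminus\{(0,0)\}$ with $aF+bG=0$ almost surely).
   Context: $H$ is a real separable Hilbert space and $W=(W(h),h\in H)$ is an isonormal Gaussian process over $H$ on a probability space $(\Omega,\mathcal F,P)$ with $\mathcal F$ generated by $W$: a centered Gaussian family with $E[W(h)W(g)]=\langle h,g\rangle_H$. $H^{\odot n}$ is the $n$th symmetric tensor product of $H$. $I_n(f)$, for $f\in H^{\odot n}$, is the multiple Wiener–Itô integral of order $n$ with respect to $W$, normalized so that $I_n(h^{\otimes n})=H_n(W(h))$ for $\|h\|_H=1$ (with $H_n$ the monic Hermite polynomial) and $E[I_n(f)^2]=n!\,\|f\|^2_{H^{\otimes n}}$. "Admits a density" means that the law of $(F,G)$ is absolutely continuous with respect to Lebesgue measure on $\mathbb R^2$. *)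

theory Defs
  imports "HOL-Probability.Probability"
begin

fun hermite :: "nat \<Rightarrow> real \<Rightarrow> real" where
  "hermite 0 x = 1"
| "hermite (Suc 0) x = x"
| "hermite (Suc (Suc n)) x = x * hermite (Suc n) x - real (Suc n) * hermite n x"

text \<open>The first disjunct is the degenerate Gaussian law of variance zero.\<close>

definition centered_gaussian :: "'w measure \<Rightarrow> ('w \<Rightarrow> real) \<Rightarrow> bool" where
  "centered_gaussian M X \<longleftrightarrow>
     (AE \<omega> in M. X \<omega> = 0) \<or> (\<exists>\<sigma>>0. distributed M lborel X (normal_density 0 \<sigma>))"

locale isonormal_process = prob_space M
  for M :: "'w measure" and W :: "'a::real_inner \<Rightarrow> 'w \<Rightarrow> real" +
  assumes measurable_W: "\<And>h. W h \<in> borel_measurable M"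
    and gaussian_family:
      "\<And>(A :: 'a set) c. finite A \<Longrightarrow> centered_gaussian M (\<lambda>\<omega>. \<Sum>h\<in>A. c h * W h \<omega>)"
    and covariance_W: "\<And>h g. expectation (\<lambda>\<omega>. W h \<omega> * W g \<omega>) = h \<bullet> g"
    and generated:
      "sets M = sigma_sets (space M) {W h -` B \<inter> space M | h B. B \<in> sets borel}"

text \<open>The \<open>n\<close>-th Hilbert space tensor power of \<open>'a\<close>, in the usual sense of a completion of
  the algebraic tensor power: a Hilbert space \<open>'b\<close> together with an \<open>n\<close>-linear map
  \<open>[h\<^sub>1, \<dots>, h\<^sub>n] \<mapsto> h\<^sub>1 \<otimes> \<dots> \<otimes> h\<^sub>n\<close> whose values are total and have the product inner products.
  These properties determine the pair up to a unique isometric isomorphism. Only lists of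
  length \<open>n\<close> matter.\<close>

locale hilbert_tensor_power =
  fixes n :: nat and tensor :: "'a::real_inner list \<Rightarrow> 'b::{real_inner, complete_space}"
  assumes multilinear:
      "\<And>xs i. length xs = n \<Longrightarrow> i < n \<Longrightarrow> linear (\<lambda>x. tensor (xs[i := x]))"
    and inner_tensor:
      "\<And>xs ys. length xs = n \<Longrightarrow> length ys = n \<Longrightarrow> tensor xs \<bullet> tensor ys = (\<Prod>i<n. xs ! i \<bullet> ys ! i)"
    and total: "closure (span (tensor ` {xs. length xs = n})) = UNIV"

text \<open>A permutation \<open>\<pi>\<close> acts on the tensor power by a unitary operator that permutes the factors
  of elementary tensors. As these are total, \<open>f\<close> is fixed by all these operators if and only if
  its inner products with elementary tensors are invariant.\<close>

definition symmetric_tensors ::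
  "nat \<Rightarrow> ('a::real_inner list \<Rightarrow> 'b::{real_inner, complete_space}) \<Rightarrow> 'b set" where
  "symmetric_tensors n tensor =
     {f. \<forall>\<pi> xs. \<pi> permutes {..<n} \<longrightarrow> length xs = n \<longrightarrow>
           f \<bullet> tensor (permute_list \<pi> xs) = f \<bullet> tensor xs}"

text \<open>The multiple integral of order \<open>n\<close> is the extension by linearity and \<open>L\<^sup>2\<close>-continuity of
  the assignment of \<open>H\<^sub>n (W h)\<close> to the \<open>n\<close>-th tensor power of a unit vector \<open>h\<close>. So \<open>X\<close> represents
  the integral of \<open>f\<close> if \<open>(f, X)\<close> lies in the closure of the graph of the map on the linear
  combinations of such powers.\<close>

definition represents_multiple_integral ::
  "'w measure \<Rightarrow> ('a::real_inner \<Rightarrow> 'w \<Rightarrow> real) \<Rightarrow> nat \<Rightarrow>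
    ('a list \<Rightarrow> 'b::{real_inner, complete_space}) \<Rightarrow> 'b \<Rightarrow> ('w \<Rightarrow> real) \<Rightarrow> bool" where
  "represents_multiple_integral M W n tensor f X \<longleftrightarrow>
     X \<in> borel_measurable M \<and> integrable M (\<lambda>\<omega>. (X \<omega>)\<^sup>2) \<and>
     (\<forall>\<epsilon>>0. \<exists>A c. finite A \<and> (\<forall>h\<in>A. norm h = 1) \<and>
        norm (f - (\<Sum>h\<in>A. c h *\<^sub>R tensor (replicate n h))) < \<epsilon> \<and>
        (\<integral>\<omega>. (X \<omega> - (\<Sum>h\<in>A. c h * hermite n (W h \<omega>)))\<^sup>2 \<partial>M) < \<epsilon>)"

text \<open>The representing random variable is unique up to almost sure equality; the choice operator
  selects a version.\<close>

definition multiple_integral ::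
  "'w measure \<Rightarrow> ('a::real_inner \<Rightarrow> 'w \<Rightarrow> real) \<Rightarrow> nat \<Rightarrow>
    ('a list \<Rightarrow> 'b::{real_inner, complete_space}) \<Rightarrow> 'b \<Rightarrow> 'w \<Rightarrow> real" where
  "multiple_integral M W n tensor f = (SOME X. represents_multiple_integral M W n tensor f X)"

definition covariance :: "'w measure \<Rightarrow> ('w \<Rightarrow> real) \<Rightarrow> ('w \<Rightarrow> real) \<Rightarrow> real" where
  "covariance M X Y = (\<integral>\<omega>. (X \<omega> - (\<integral>\<omega>'. X \<omega>' \<partial>M)) * (Y \<omega> - (\<integral>\<omega>'. Y \<omega>' \<partial>M)) \<partial>M)"

definition covariance_matrix :: "'w measure \<Rightarrow> ('w \<Rightarrow> real) \<Rightarrow> ('w \<Rightarrow> real) \<Rightarrow> real^2^2" where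
  "covariance_matrix M X Y =
     vector [vector [covariance M X X, covariance M X Y],
             vector [covariance M Y X, covariance M Y Y]]"

definition admits_density :: "'w measure \<Rightarrow> ('w \<Rightarrow> real \<times> real) \<Rightarrow> bool" where
  "admits_density M Z \<longleftrightarrow> absolutely_continuous lborel (distr M borel Z)"

end

theory Submission
  imports Defs "HOL-Computational_Algebra.Polynomial" "HOL-Combinatorics.Permutations"
begin

text \<open>
  If \<open>f\<close> and \<open>g\<close> are linearly independent, then there are orthonormal vectors \<open>e1\<close>, \<open>e2\<close> such that
  the polynomials \<open>p(s) = \<langle>f, (e1 + s e2)\<^sup>\<otimes>\<^sup>n\<rangle>\<close> and \<open>q(s) = \<langle>g, (e1 + s e2)\<^sup>\<otimes>\<^sup>n\<rangle>\<close> are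
  linearly independent. Replacing \<open>(W(e1), W(e2))\<close> by \<open>(r, r s)\<close>, where \<open>(r, s)\<close> is independent of
  \<open>W\<close> and has a suitable density, preserves the law of \<open>W\<close>. For fixed \<open>W\<close>, the integrals become
  polynomials in \<open>r\<close> and \<open>s\<close> of degree \<open>n\<close> in \<open>r\<close>. Their coefficients of \<open>r\<^sup>n\<close> are the
  deterministic polynomials \<open>p\<close> and \<open>q\<close>, and so their Jacobian has the leading coefficient
  \<open>n (p q' - p' q) \<noteq> 0\<close> in \<open>r\<close>. Hence the preimage of a null set is null for every fixed \<open>W\<close>,
  and Fubini's theorem shows that \<open>(F, G)\<close> has a density.
\<close>

section \<open>Laws of families of random variables\<close>

text \<open>The coordinates \<open>(r, r s)\<close> serve to push the randomness of the remaining
  field below the top power of \<open>r\<close>: \<open>hermite n\<close> is monic, so the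
  coefficient of \<open>r^n\<close> depends on the tensor alone, and non-degeneracy becomes a
  Wronskian condition in the single variable \<open>s\<close>. Two obstacles shape the proof. A
  multiple integral is only an \<open>L^2\<close> limit of Hermite sums, so its being a polynomial
  for fixed \<open>W\<close> needs an argument: almost sure convergence along a subsequence, the
  bounded degree of the approximants and the almost everywhere positive density of
  \<open>(r, s)\<close> force the coefficients to converge. Moreover, the replacement is made inside
  functionals of infinitely many coordinates of \<open>W\<close>, so equality in law is needed for
  the whole family at once. The directions come from two unit vectors \<open>u\<close>,
  \<open>v\<close> at whose tensor powers \<open>f\<close> and \<open>g\<close> have a nonzero 2 by
  2 determinant of values; \<open>e1\<close> and \<open>e2\<close> are the normalized
  \<open>u + v\<close> and \<open>u - v\<close>.\<close>

lemma cis_measurable [measurable]: "cis \<in> borel_measurable borel"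
  by (intro borel_measurable_continuous_onI continuous_intros)

lemma integrable_mult_cis:
  fixes Z X :: "'w \<Rightarrow> real"
  assumes "prob_space M" and [measurable]: "Z \<in> borel_measurable M" "X \<in> borel_measurable M"
    and "\<And>\<omega>. \<bar>Z \<omega>\<bar> \<le> C"
  shows "integrable M (\<lambda>\<omega>. of_real (Z \<omega>) * cis (X \<omega>))"
proof -
  interpret prob_space M by fact
  show ?thesis
    by (rule integrable_const_bound[where B = C]) (use assms in \<open>auto simp: norm_mult\<close>)
qed

text \<open>The bounds 1 and 3 are those of \<open>Z + 2\<close> for a signed weight with values in
  [-1, 1].\<close>

lemma (in prob_space) prob_space_weighted:
  fixes Z :: "'a \<Rightarrow> real"
  assumes Z [measurable]: "Z \<in> borel_measurable M" and b: "\<And>\<omega>. 1 \<le> Z \<omega>" "\<And>\<omega>. Z \<omega> \<le> 3"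
  shows "expectation Z \<ge> 1" "prob_space (density M (\<lambda>\<omega>. ennreal (Z \<omega> / expectation Z)))"
proof -
  have int: "integrable M Z"
  proof (rule integrable_const_bound[where B = 3])
    show "AE \<omega> in M. norm (Z \<omega>) \<le> 3"
      using b by (intro AE_I2) (smt (verit) real_norm_def)
  qed simp
  then show ge: "expectation Z \<ge> 1"
    using integral_mono[of M "\<lambda>_. 1" Z] b by (simp add: prob_space)
  have "(\<integral>\<^sup>+\<omega>. ennreal (Z \<omega> / expectation Z) \<partial>M) = ennreal (\<integral>\<omega>. Z \<omega> / expectation Z \<partial>M)"
    using int ge b by (intro nn_integral_eq_integral) (auto intro!: AE_I2 divide_nonneg_nonneg intro: order_trans[of 0 1])
  also have "\<dots> = 1"
    using ge by simp
  finally have "emeasure (density M (\<lambda>\<omega>. ennreal (Z \<omega> / expectation Z))) (space M) = 1"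
    by (simp add: emeasure_density nn_integral_set_ennreal cong: nn_integral_cong)
  then show "prob_space (density M (\<lambda>\<omega>. ennreal (Z \<omega> / expectation Z)))"
    by (intro prob_spaceI) simp
qed

text \<open>Adding a constant to the weights makes them positive, so that Levy's theorem applies.\<close>

lemma weighted_Levy_uniqueness:
  fixes Z X :: "'w \<Rightarrow> real" and V Y :: "'v \<Rightarrow> real"
  assumes M: "prob_space M" and N: "prob_space N"
    and [measurable]: "Z \<in> borel_measurable M" "X \<in> borel_measurable M"
    and [measurable]: "V \<in> borel_measurable N" "Y \<in> borel_measurable N"
    and Z: "\<And>\<omega>. \<bar>Z \<omega>\<bar> \<le> 1" and V: "\<And>\<omega>. \<bar>V \<omega>\<bar> \<le> 1"
    and eq: "\<And>t. (\<integral>\<omega>. of_real (Z \<omega>) * cis (t * X \<omega>) \<partial>M) = (\<integral>\<omega>. of_real (V \<omega>) * cis (t * Y \<omega>) \<partial>N)"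
    and eq1: "\<And>t. (\<integral>\<omega>. cis (t * X \<omega>) \<partial>M) = (\<integral>\<omega>. cis (t * Y \<omega>) \<partial>N)"
    and B [measurable]: "B \<in> sets borel"
  shows "(\<integral>\<omega>. Z \<omega> * indicator B (X \<omega>) \<partial>M) = (\<integral>\<omega>. V \<omega> * indicator B (Y \<omega>) \<partial>N)"
proof -
  interpret M: prob_space M by fact
  interpret N: prob_space N by fact
  define c where "c = (\<integral>\<omega>. Z \<omega> + 2 \<partial>M)"
  define d where "d = (\<integral>\<omega>. V \<omega> + 2 \<partial>N)"
  define \<mu> where "\<mu> = distr (density M (\<lambda>\<omega>. ennreal ((Z \<omega> + 2) / c))) borel X"
  define \<nu> where "\<nu> = distr (density N (\<lambda>\<omega>. ennreal ((V \<omega> + 2) / d))) borel Y"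
  have bZ: "1 \<le> Z \<omega> + 2" "Z \<omega> + 2 \<le> 3" for \<omega> using Z[of \<omega>] by auto
  have bV: "1 \<le> V \<omega> + 2" "V \<omega> + 2 \<le> 3" for \<omega> using V[of \<omega>] by auto
  have c: "c \<ge> 1" "prob_space (density M (\<lambda>\<omega>. ennreal ((Z \<omega> + 2) / c)))"
    unfolding c_def by (intro M.prob_space_weighted bZ; simp)+
  have d: "d \<ge> 1" "prob_space (density N (\<lambda>\<omega>. ennreal ((V \<omega> + 2) / d)))"
    unfolding d_def by (intro N.prob_space_weighted bV; simp)+
  have nZ: "0 \<le> (Z \<omega> + 2) / c" for \<omega> using bZ[of \<omega>] c by simp
  have nV: "0 \<le> (V \<omega> + 2) / d" for \<omega> using bV[of \<omega>] d by simp
  have iZ: "integrable M (\<lambda>\<omega>. of_real (Z \<omega>) * cis (t * X \<omega>))" for t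
    by (rule integrable_mult_cis[where C = 1]) (use M Z in auto)
  have iV: "integrable N (\<lambda>\<omega>. of_real (V \<omega>) * cis (t * Y \<omega>))" for t
    by (rule integrable_mult_cis[where C = 1]) (use N V in auto)
  have iZ1: "integrable M (\<lambda>\<omega>. cis (t * X \<omega>))" for t
    using integrable_mult_cis[OF M, of "\<lambda>_. 1" "\<lambda>\<omega>. t * X \<omega>" 1] by simp
  have iV1: "integrable N (\<lambda>\<omega>. cis (t * Y \<omega>))" for t
    using integrable_mult_cis[OF N, of "\<lambda>_. 1" "\<lambda>\<omega>. t * Y \<omega>" 1] by simp
  have "integrable M Z" "integrable N V"
    using Z V by (auto intro!: M.integrable_const_bound[where B=1] N.integrable_const_bound[where B=1])
  \<comment> \<open>At \<open>t = 0\<close> the hypothesis compares the total weights; hence the two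
    normalizing constants agree.\<close>
  moreover have "(\<integral>\<omega>. Z \<omega> \<partial>M) = (\<integral>\<omega>. V \<omega> \<partial>N)"
    using eq[of 0] by simp
  ultimately have "c = d"
    by (simp add: c_def d_def M.prob_space N.prob_space)
  have "real_distribution \<mu>" "real_distribution \<nu>"
    unfolding \<mu>_def \<nu>_def using c(2) d(2)
    by (auto intro!: real_distribution.intro prob_space.prob_space_distr simp: real_distribution_axioms_def)
  moreover have "char \<mu> = char \<nu>"
  proof
    fix t
    have "char \<mu> t = (\<integral>\<omega>. ((Z \<omega> + 2) / c) *\<^sub>R cis (t * X \<omega>) \<partial>M)"
      unfolding \<mu>_def char_def
      by (subst integral_distr; (subst integral_density)?) (auto simp: cis_conv_exp nZ)
    also have "\<dots> = ((\<integral>\<omega>. of_real (Z \<omega>) * cis (t * X \<omega>) \<partial>M) + 2 * (\<integral>\<omega>. cis (t * X \<omega>) \<partial>M)) / c"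
      using iZ[of t] iZ1[of t] by (simp add: scaleR_conv_of_real distrib_right)
    also have "\<dots> = ((\<integral>\<omega>. of_real (V \<omega>) * cis (t * Y \<omega>) \<partial>N) + 2 * (\<integral>\<omega>. cis (t * Y \<omega>) \<partial>N)) / d"
      by (simp add: eq eq1 \<open>c = d\<close>)
    also have "\<dots> = (\<integral>\<omega>. ((V \<omega> + 2) / d) *\<^sub>R cis (t * Y \<omega>) \<partial>N)"
      using iV[of t] iV1[of t] by (simp add: scaleR_conv_of_real distrib_right)
    also have "\<dots> = char \<nu> t"
      unfolding \<nu>_def char_def
      by (subst integral_distr; (subst integral_density)?) (auto simp: cis_conv_exp nV)
    finally show "char \<mu> t = char \<nu> t" .
  qed
  ultimately have \<mu>\<nu>: "\<mu> = \<nu>"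
    by (rule Levy_uniqueness)
  \<comment> \<open>To remove the contribution of the added constant 2 at the end, the unweighted
    laws must agree as well.\<close>
  have "distr M borel X = distr N borel Y"
  proof (rule Levy_uniqueness)
    show "real_distribution (distr M borel X)" "real_distribution (distr N borel Y)"
      using M.real_distribution_distr N.real_distribution_distr by auto
    show "char (distr M borel X) = char (distr N borel Y)"
      using eq1 by (auto simp: char_def integral_distr fun_eq_iff cis_conv_exp)
  qed
  moreover have "(\<integral>x. indicator B x \<partial>distr M borel X) = (\<integral>\<omega>. indicator B (X \<omega>) \<partial>M :: real)"
    "(\<integral>x. indicator B x \<partial>distr N borel Y) = (\<integral>\<omega>. indicator B (Y \<omega>) \<partial>N :: real)"
    by (intro integral_distr; simp)+
  ultimately have e1: "(\<integral>\<omega>. indicator B (X \<omega>) \<partial>M) = (\<integral>\<omega>. indicator B (Y \<omega>) \<partial>N :: real)"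
    by metis
  have "(\<integral>x. indicator B x \<partial>\<mu>) = (\<integral>x. indicator B x \<partial>\<nu> :: real)"
    using \<mu>\<nu> by simp
  then have "(\<integral>\<omega>. ((Z \<omega> + 2) / c) * indicator B (X \<omega>) \<partial>M) = (\<integral>\<omega>. ((V \<omega> + 2) / d) * indicator B (Y \<omega>) \<partial>N)"
    unfolding \<mu>_def \<nu>_def
    by (subst (asm) (1 2) integral_distr; (subst (asm) (1 2) integral_density)?) (auto simp: nZ nV)
  then have e2: "(\<integral>\<omega>. (Z \<omega> + 2) * indicator B (X \<omega>) \<partial>M) = (\<integral>\<omega>. (V \<omega> + 2) * indicator B (Y \<omega>) \<partial>N)"
    using \<open>c = d\<close> c(1) by simp
  have "integrable M (\<lambda>\<omega>. Z \<omega> * indicator B (X \<omega>))" "integrable N (\<lambda>\<omega>. V \<omega> * indicator B (Y \<omega>))"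
    "integrable M (\<lambda>\<omega>. indicator B (X \<omega>) :: real)" "integrable N (\<lambda>\<omega>. indicator B (Y \<omega>) :: real)"
    using Z V by (auto intro!: M.integrable_const_bound[where B=1] N.integrable_const_bound[where B=1]
        simp: indicator_def)
  with e1 e2 show ?thesis
    by (simp add: distrib_right)
qed

text \<open>A one-dimensional uniqueness theorem suffices: the coordinates are moved one at a time
  out of the exponential and into an indicator, while all other factors form a bounded weight. When
  the exponential is empty, the probabilities of cylinder sets are left, and these determine the
  law.\<close>

lemma law_eqI:
  fixes X :: "'i \<Rightarrow> 'w \<Rightarrow> real" and Y :: "'i \<Rightarrow> 'v \<Rightarrow> real"
  assumes M: "prob_space M" and N: "prob_space N"
    and X [measurable]: "\<And>i. X i \<in> borel_measurable M"
    and Y [measurable]: "\<And>i. Y i \<in> borel_measurable N"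
    and eq: "\<And>J t. finite J \<Longrightarrow> (\<integral>\<omega>. cis (\<Sum>i\<in>J. t i * X i \<omega>) \<partial>M) = (\<integral>\<omega>. cis (\<Sum>i\<in>J. t i * Y i \<omega>) \<partial>N)"
  shows "distr M (Pi\<^sub>M UNIV (\<lambda>_. borel)) (\<lambda>\<omega> i. X i \<omega>) = distr N (Pi\<^sub>M UNIV (\<lambda>_. borel)) (\<lambda>\<omega> i. Y i \<omega>)"
proof -
  interpret M: prob_space M by fact
  interpret N: prob_space N by fact
  \<comment> \<open>\<open>K\<close> holds the coordinates already tested by indicators,
    \<open>J\<close> those still in the exponential. The hypothesis is the case of empty
    \<open>K\<close>, the goal that of empty \<open>J\<close>.\<close>
  have main: "(\<integral>\<omega>. of_real (\<Prod>i\<in>K. indicator (A i) (X i \<omega>)) * cis (\<Sum>i\<in>J. t i * X i \<omega>) \<partial>M)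
     = (\<integral>\<omega>. of_real (\<Prod>i\<in>K. indicator (A i) (Y i \<omega>)) * cis (\<Sum>i\<in>J. t i * Y i \<omega>) \<partial>N)"
    if "finite K" "finite J" "J \<inter> K = {}" "\<And>i. i \<in> K \<Longrightarrow> A i \<in> sets borel"
    for K J A t
    using that
  proof (induction K arbitrary: J t rule: finite_induct)
    case empty
    then show ?case using eq by simp
  next
    case (insert k K)
    have [measurable]: "A i \<in> sets borel" if "i \<in> insert k K" for i using insert.prems that by auto
    have [measurable]: "A k \<in> sets borel" by simp
    have J: "finite J" "k \<notin> J" "J \<inter> K = {}" using insert by auto
    let ?PX = "\<lambda>\<omega>. \<Prod>i\<in>K. indicator (A i) (X i \<omega>) :: real"
    let ?PY = "\<lambda>\<omega>. \<Prod>i\<in>K. indicator (A i) (Y i \<omega>) :: real"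
    have [measurable]: "?PX \<in> borel_measurable M" "?PY \<in> borel_measurable N"
      by (auto intro!: borel_measurable_prod)
    have PX: "\<bar>?PX \<omega>\<bar> \<le> 1" for \<omega> by (auto simp: abs_prod intro!: prod_le_1 simp: indicator_def)
    have PY: "\<bar>?PY \<omega>\<bar> \<le> 1" for \<omega> by (auto simp: abs_prod intro!: prod_le_1 simp: indicator_def)
    let ?SX = "\<lambda>t \<omega>. \<Sum>i\<in>J. t i * X i \<omega>"
    let ?SY = "\<lambda>t \<omega>. \<Sum>i\<in>J. t i * Y i \<omega>"
    \<comment> \<open>Weights must be real, so the exponential of the coordinates in
      \<open>J\<close> is split into cosine and sine; both are combinations of \<open>E\<close> at
      \<sigma> = 1 and \<sigma> = -1.\<close>
    define E where "E = (\<lambda>\<sigma> s. \<integral>\<omega>. of_real (?PX \<omega>) * cis (\<sigma> * ?SX t \<omega> + s * X k \<omega>) \<partial>M)"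
    have E: "E \<sigma> s = (\<integral>\<omega>. of_real (?PY \<omega>) * cis (\<sigma> * ?SY t \<omega> + s * Y k \<omega>) \<partial>N)" for \<sigma> s
    proof -
      have *: "(\<Sum>i\<in>insert k J. ((\<lambda>i. \<sigma> * t i)(k := s)) i * x i) = \<sigma> * (\<Sum>i\<in>J. t i * x i) + s * x k" for x :: "'i \<Rightarrow> real"
      proof -
        have "(\<Sum>i\<in>J. ((\<lambda>i. \<sigma> * t i)(k := s)) i * x i) = (\<Sum>i\<in>J. \<sigma> * t i * x i)"
          using J by (intro sum.cong) auto
        then show ?thesis using J by (simp add: sum_distrib_left mult.assoc)
      qed
      show ?thesis
        unfolding E_def
        using insert.IH[of "insert k J" "(\<lambda>i. \<sigma> * t i)(k := s)"] J insert.hyps insert.prems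
        by (simp only: *) auto
    qed
    have iX: "integrable M (\<lambda>\<omega>. of_real (?PX \<omega>) * cis (\<sigma> * ?SX t \<omega> + s * X k \<omega>))" for \<sigma> s
      by (rule integrable_mult_cis[where C = 1]) (use M PX in auto)
    have iY: "integrable N (\<lambda>\<omega>. of_real (?PY \<omega>) * cis (\<sigma> * ?SY t \<omega> + s * Y k \<omega>))" for \<sigma> s
      by (rule integrable_mult_cis[where C = 1]) (use N PY in auto)
    have eqX: "(\<integral>\<omega>. cis (s * X k \<omega>) \<partial>M) = (\<integral>\<omega>. cis (s * Y k \<omega>) \<partial>N)" for s
      using eq[of "{k}" "\<lambda>_. s"] by simp
    have cosplit: "of_real (p * cos a) * cis b = (of_real p * cis (1 * a + b) + of_real p * cis (-1 * a + b)) / 2" for p a b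
      by (simp add: complex_eq_iff cos_add sin_add cos_diff sin_diff algebra_simps)
    have sinsplit: "of_real (p * sin a) * cis b = (of_real p * cis (1 * a + b) - of_real p * cis (-1 * a + b)) / (2 * \<i>)" for p a b
      by (simp add: complex_eq_iff Re_divide Im_divide power2_eq_square cos_add sin_add cos_diff sin_diff algebra_simps)
    have bnd: "\<bar>p * cos a\<bar> \<le> 1" "\<bar>p * sin a\<bar> \<le> 1" if "\<bar>p\<bar> \<le> 1" for p a :: real
      using that by (auto simp: abs_mult intro!: mult_le_one)
    have c: "(\<integral>\<omega>. ?PX \<omega> * cos (?SX t \<omega>) * indicator (A k) (X k \<omega>) \<partial>M) = (\<integral>\<omega>. ?PY \<omega> * cos (?SY t \<omega>) * indicator (A k) (Y k \<omega>) \<partial>N)"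
    proof (rule weighted_Levy_uniqueness[OF M N])
      fix s
      have "(\<integral>\<omega>. of_real (?PX \<omega> * cos (?SX t \<omega>)) * cis (s * X k \<omega>) \<partial>M) = (E 1 s + E (-1) s) / 2"
        unfolding cosplit E_def using iX[of 1 s] iX[of "-1" s] by simp
      also have "\<dots> = (\<integral>\<omega>. of_real (?PY \<omega> * cos (?SY t \<omega>)) * cis (s * Y k \<omega>) \<partial>N)"
        unfolding cosplit E using iY[of 1 s] iY[of "-1" s] by simp
      finally show "(\<integral>\<omega>. of_real (?PX \<omega> * cos (?SX t \<omega>)) * cis (s * X k \<omega>) \<partial>M) = (\<integral>\<omega>. of_real (?PY \<omega> * cos (?SY t \<omega>)) * cis (s * Y k \<omega>) \<partial>N)" .
    qed (use eqX PX PY bnd in auto)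
    have s: "(\<integral>\<omega>. ?PX \<omega> * sin (?SX t \<omega>) * indicator (A k) (X k \<omega>) \<partial>M) = (\<integral>\<omega>. ?PY \<omega> * sin (?SY t \<omega>) * indicator (A k) (Y k \<omega>) \<partial>N)"
    proof (rule weighted_Levy_uniqueness[OF M N])
      fix s
      have "(\<integral>\<omega>. of_real (?PX \<omega> * sin (?SX t \<omega>)) * cis (s * X k \<omega>) \<partial>M) = (E 1 s - E (-1) s) / (2 * \<i>)"
        unfolding sinsplit E_def using iX[of 1 s] iX[of "-1" s] by simp
      also have "\<dots> = (\<integral>\<omega>. of_real (?PY \<omega> * sin (?SY t \<omega>)) * cis (s * Y k \<omega>) \<partial>N)"
        unfolding sinsplit E using iY[of 1 s] iY[of "-1" s] by simp
      finally show "(\<integral>\<omega>. of_real (?PX \<omega> * sin (?SX t \<omega>)) * cis (s * X k \<omega>) \<partial>M) = (\<integral>\<omega>. of_real (?PY \<omega> * sin (?SY t \<omega>)) * cis (s * Y k \<omega>) \<partial>N)" .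
    qed (use eqX PX PY bnd in auto)
    have sp: "of_real (i * p) * cis a = of_real (p * cos a * i) + \<i> * of_real (p * sin a * i)" for p a i
      by (simp add: complex_eq_iff algebra_simps)
    have i1: "integrable M (\<lambda>\<omega>. ?PX \<omega> * cos (?SX t \<omega>) * indicator (A k) (X k \<omega>))" "integrable M (\<lambda>\<omega>. ?PX \<omega> * sin (?SX t \<omega>) * indicator (A k) (X k \<omega>))"
      using bnd[OF PX] by (auto intro!: M.integrable_const_bound[where B=1] simp: indicator_def)
    have i2: "integrable N (\<lambda>\<omega>. ?PY \<omega> * cos (?SY t \<omega>) * indicator (A k) (Y k \<omega>))" "integrable N (\<lambda>\<omega>. ?PY \<omega> * sin (?SY t \<omega>) * indicator (A k) (Y k \<omega>))"
      using bnd[OF PY] by (auto intro!: N.integrable_const_bound[where B=1] simp: indicator_def)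
    show ?case
      unfolding prod.insert[OF insert.hyps] sp
      by (subst (1 2) Bochner_Integration.integral_add)
        (use i1 i2 c s in \<open>auto simp del: of_real_mult simp: integrable_of_real\<close>)
  qed
  have [measurable]: "(\<lambda>\<omega> i. X i \<omega>) \<in> M \<rightarrow>\<^sub>M Pi\<^sub>M UNIV (\<lambda>_. borel)"
    by (intro measurable_PiM_single') auto
  have [measurable]: "(\<lambda>\<omega> i. Y i \<omega>) \<in> N \<rightarrow>\<^sub>M Pi\<^sub>M UNIV (\<lambda>_. borel)"
    by (intro measurable_PiM_single') auto
  show ?thesis
  proof (rule measure_eqI_PiM_infinite)
    show "finite_measure (distr M (Pi\<^sub>M UNIV (\<lambda>_. borel)) (\<lambda>\<omega> i. X i \<omega>))"
      by (intro finite_measure.finite_measure_distr M.finite_measure_axioms) auto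
    fix A :: "'i \<Rightarrow> real set" and K :: "'i set"
    assume K: "finite K" "K \<subseteq> UNIV" and A: "\<And>i. i \<in> K \<Longrightarrow> A i \<in> sets borel"
    have [measurable]: "prod_emb UNIV (\<lambda>_. borel) K (Pi\<^sub>E K A) \<in> sets (Pi\<^sub>M UNIV (\<lambda>_. borel))"
      using K A by (intro sets_PiM_I) auto
    have set_eq: "{\<omega> \<in> space Q. (\<lambda>i. V i \<omega>) \<in> prod_emb UNIV (\<lambda>_. borel) K (Pi\<^sub>E K A)} = {\<omega> \<in> space Q. \<forall>i\<in>K. V i \<omega> \<in> A i}"
      for Q :: "'q measure" and V :: "'i \<Rightarrow> 'q \<Rightarrow> real"
      by (auto simp: prod_emb_def)
    have ind: "(\<Prod>i\<in>K. indicator (A i) (x i)) = (if \<forall>i\<in>K. x i \<in> A i then 1 else 0 :: real)" for x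
      using K(1) by (induction K) (auto simp: indicator_def)
    have [measurable]: "{\<omega> \<in> space M. \<forall>i\<in>K. X i \<omega> \<in> A i} \<in> sets M"
      using K A by (auto intro!: sets.sets_Collect_finite_All' measurable_sets_Collect[OF X] simp: )
    have [measurable]: "{\<omega> \<in> space N. \<forall>i\<in>K. Y i \<omega> \<in> A i} \<in> sets N"
      using K A by (auto intro!: sets.sets_Collect_finite_All' measurable_sets_Collect[OF Y] simp: )
    have "(\<integral>\<omega>. (\<Prod>i\<in>K. indicator (A i) (X i \<omega>)) \<partial>M) = (\<integral>\<omega>. (\<Prod>i\<in>K. indicator (A i) (Y i \<omega>)) \<partial>N :: real)"
      using main[of K "{}" A] K A by (simp del: of_real_prod)
    moreover have "(\<integral>\<omega>. (\<Prod>i\<in>K. indicator (A i) (X i \<omega>)) \<partial>M) = measure M {\<omega> \<in> space M. \<forall>i\<in>K. X i \<omega> \<in> A i}"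
      by (subst Bochner_Integration.integral_cong[OF refl, of M _ "indicator {\<omega> \<in> space M. \<forall>i\<in>K. X i \<omega> \<in> A i}"])
        (auto simp: ind)
    moreover have "(\<integral>\<omega>. (\<Prod>i\<in>K. indicator (A i) (Y i \<omega>)) \<partial>N) = measure N {\<omega> \<in> space N. \<forall>i\<in>K. Y i \<omega> \<in> A i}"
      by (subst Bochner_Integration.integral_cong[OF refl, of N _ "indicator {\<omega> \<in> space N. \<forall>i\<in>K. Y i \<omega> \<in> A i}"])
        (auto simp: ind)
    ultimately show "emeasure (distr M (Pi\<^sub>M UNIV (\<lambda>_. borel)) (\<lambda>\<omega> i. X i \<omega>)) (prod_emb UNIV (\<lambda>_. borel) K (Pi\<^sub>E K A)) =
      emeasure (distr N (Pi\<^sub>M UNIV (\<lambda>_. borel)) (\<lambda>\<omega> i. Y i \<omega>)) (prod_emb UNIV (\<lambda>_. borel) K (Pi\<^sub>E K A))"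
      by (simp add: emeasure_distr vimage_def Int_def conj_commute set_eq M.emeasure_eq_measure N.emeasure_eq_measure)
  qed auto
qed

section \<open>Polynomial maps of the plane\<close>

text \<open>Near each point \<open>f\<close> is injective with a differentiable inverse, which maps
  the negligible part of \<open>N\<close> to a negligible set. Negligibility is a local
  property.\<close>

lemma negligible_vimage_local_diffeo:
  fixes f :: "'a::euclidean_space \<Rightarrow> 'a"
  assumes S: "open S" and N: "negligible N"
    and der: "\<And>x. x \<in> S \<Longrightarrow> (f has_derivative blinfun_apply (f' x)) (at x)"
    and cont: "continuous_on S f'"
    and inj: "\<And>x. x \<in> S \<Longrightarrow> inj (blinfun_apply (f' x))"
  shows "negligible {x \<in> S. f x \<in> N}"
proof -
  have inverse: "\<exists>g'. linear g' \<and> g' \<circ> blinfun_apply (f' x) = id \<and> blinfun_apply (f' x) \<circ> g' = id"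
    if "x \<in> S" for x
    using linear_injective_isomorphism[OF _ inj[OF that]] by (auto simp: fun_eq_iff bounded_linear.linear[OF blinfun.bounded_linear_right])
  have "\<exists>U. openin (top_of_set {x \<in> S. f x \<in> N}) U \<and> a \<in> U \<and> negligible U"
    if "a \<in> {x \<in> S. f x \<in> N}" for a
  proof -
    have a: "a \<in> S" "f a \<in> N" using that by auto
    obtain g' where g': "linear g'" "g' \<circ> blinfun_apply (f' a) = id" using inverse[OF a(1)] by auto
    obtain r where r: "r > 0" "ball a r \<subseteq> S" "inj_on f (ball a r)"
    proof (rule has_derivative_locally_injective[of a S g' "\<lambda>x. blinfun_apply (f' x)" f])
      fix e :: real assume "e > 0"
      have "isCont f' a" using cont S a(1) by (simp add: continuous_on_eq_continuous_at)
      then obtain d where "d > 0" "\<And>x. dist x a < d \<Longrightarrow> dist (f' x) (f' a) < e"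
        using \<open>e > 0\<close> unfolding continuous_at_eps_delta by blast
      then show "\<exists>d>0. \<forall>x. dist a x < d \<longrightarrow> onorm (\<lambda>v. blinfun_apply (f' x) v - blinfun_apply (f' a) v) < e"
        by (intro exI[of _ d]) (auto simp: dist_commute dist_norm norm_blinfun.rep_eq blinfun.diff_left[symmetric])
    qed (use a S g' der in \<open>auto simp: linear_conv_bounded_linear\<close>)
    let ?B = "ball a r"
    let ?T = "{x \<in> ?B. f x \<in> N}"
    let ?g = "inv_into ?B f"
    have "negligible (?g ` (f ` ?T))"
    proof (rule negligible_differentiable_image_negligible)
      show "negligible (f ` ?T)" using N by (rule negligible_subset) auto
      show "?g differentiable_on (f ` ?T)"
      proof (rule differentiable_at_imp_differentiable_on)
        fix y assume "y \<in> f ` ?T"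
        then obtain x where x: "x \<in> ?B" "y = f x" by auto
        then have "x \<in> S" using r by auto
        obtain h where h: "linear h" "blinfun_apply (f' x) \<circ> h = id" using inverse[OF \<open>x \<in> S\<close>] by auto
        have "(?g has_derivative h) (at (f x))"
        proof (rule has_derivative_inverse_strong[of ?B x f ?g "blinfun_apply (f' x)"])
          show "continuous_on ?B f"
            by (meson continuous_at_imp_continuous_on der has_derivative_continuous r(2) subsetD)
        qed (use r x h der[OF \<open>x \<in> S\<close>] in \<open>auto simp: inv_into_f_f\<close>)
        then show "?g differentiable at y" using x by (auto simp: differentiable_def)
      qed
    qed simp
    moreover have "?g ` (f ` ?T) = ?T"
      using r(3) by (force simp: image_image inv_into_f_f image_iff)
    ultimately have "negligible ?T" by simp
    moreover have "openin (top_of_set {x \<in> S. f x \<in> N}) ?T"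
      using r(2) by (intro openin_open[THEN iffD2] exI[of _ ?B]) auto
    ultimately show ?thesis using r(1) a by (intro exI[of _ ?T]) auto
  qed
  then show ?thesis by (subst locally_negligible_alt) blast
qed

lemma negligible_vimage_plane:
  fixes P Q :: "real \<times> real \<Rightarrow> real"
  assumes P: "\<And>z. (P has_derivative (\<lambda>h. P1 z * fst h + P2 z * snd h)) (at z)"
    and Q: "\<And>z. (Q has_derivative (\<lambda>h. Q1 z * fst h + Q2 z * snd h)) (at z)"
    and cont: "continuous_on UNIV P1" "continuous_on UNIV P2" "continuous_on UNIV Q1" "continuous_on UNIV Q2"
    and N: "negligible N"
  shows "negligible {z. P1 z * Q2 z - P2 z * Q1 z \<noteq> 0 \<and> (P z, Q z) \<in> N}"
proof -
  \<comment> \<open>The four matrix units. As a combination of them the derivative inherits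
    continuity in operator norm from the partial derivatives.\<close>
  define b1 b2 b3 b4 :: "(real \<times> real) \<Rightarrow>\<^sub>L (real \<times> real)" where
    "b1 = Blinfun (\<lambda>h. (fst h, 0))" and "b2 = Blinfun (\<lambda>h. (snd h, 0))" and
    "b3 = Blinfun (\<lambda>h. (0, fst h))" and "b4 = Blinfun (\<lambda>h. (0, snd h))"
  have b: "blinfun_apply b1 h = (fst h, 0)" "blinfun_apply b2 h = (snd h, 0)"
    "blinfun_apply b3 h = (0, fst h)" "blinfun_apply b4 h = (0, snd h)" for h
    unfolding b1_def b2_def b3_def b4_def
    by (subst bounded_linear_Blinfun_apply;
        auto intro!: bounded_linear_Pair bounded_linear_fst bounded_linear_snd bounded_linear_zero)+
  define D where "D = (\<lambda>z. P1 z *\<^sub>R b1 + P2 z *\<^sub>R b2 + Q1 z *\<^sub>R b3 + Q2 z *\<^sub>R b4)"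
  define S where "S = {z. P1 z * Q2 z - P2 z * Q1 z \<noteq> 0}"
  have D: "blinfun_apply (D z) h = (P1 z * fst h + P2 z * snd h, Q1 z * fst h + Q2 z * snd h)" for z h
    by (simp add: D_def blinfun.add_left blinfun.scaleR_left b)
  have "negligible {z \<in> S. (P z, Q z) \<in> N}"
  proof (rule negligible_vimage_local_diffeo[where f' = D])
    show "open S" unfolding S_def
      by (intro open_Collect_neq continuous_intros cont)
    show "continuous_on S D" unfolding D_def
      by (intro continuous_intros continuous_on_subset[OF cont(1)] continuous_on_subset[OF cont(2)]
          continuous_on_subset[OF cont(3)] continuous_on_subset[OF cont(4)]) auto
    show "((\<lambda>z. (P z, Q z)) has_derivative blinfun_apply (D z)) (at z)" for z
      using has_derivative_Pair[OF P Q] by (simp add: D[abs_def])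
    show "inj (blinfun_apply (D z))" if "z \<in> S" for z
    proof (rule linear_injective_0[THEN iffD2, rule_format])
      fix h assume "blinfun_apply (D z) h = 0"
      then have e: "P1 z * fst h + P2 z * snd h = 0" "Q1 z * fst h + Q2 z * snd h = 0"
        by (auto simp: D zero_prod_def)
      \<comment> \<open>Cramer's rule: a nonzero Jacobian makes the derivative injective.\<close>
      have "(P1 z * Q2 z - P2 z * Q1 z) * fst h = Q2 z * (P1 z * fst h + P2 z * snd h) - P2 z * (Q1 z * fst h + Q2 z * snd h)"
        "(P1 z * Q2 z - P2 z * Q1 z) * snd h = P1 z * (Q1 z * fst h + Q2 z * snd h) - Q1 z * (P1 z * fst h + P2 z * snd h)"
        by (simp_all add: algebra_simps)
      then show "h = 0" using e that by (auto simp: S_def prod_eq_iff)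
    qed (auto simp: bounded_linear.linear[OF blinfun.bounded_linear_right])
  qed (fact N)
  then show ?thesis by (simp add: S_def)
qed

section \<open>Polynomials: Wronskians, convergence of coefficients, and two variables\<close>

lemma poly_eqI_infinite:
  fixes p q :: "real poly"
  assumes "infinite A" "\<And>x. x \<in> A \<Longrightarrow> poly p x = poly q x"
  shows "p = q"
proof (rule ccontr)
  assume "p \<noteq> q"
  then have "finite {x. poly (p - q) x = 0}" by (intro poly_roots_finite) simp
  moreover have "A \<subseteq> {x. poly (p - q) x = 0}" using assms by auto
  ultimately show False using assms(1) finite_subset by blast
qed

text \<open>To the right of all roots of \<open>p\<close> the quotient \<open>q / p\<close> has
  derivative 0 and is constant. This gives a polynomial identity on an infinite set, hence
  everywhere.\<close>

lemma wronskian_eq_0_imp_dependent: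
  fixes p q :: "real poly"
  assumes "p * pderiv q = pderiv p * q"
  shows "\<exists>a b. (a, b) \<noteq> (0, 0) \<and> smult a p + smult b q = 0"
proof (cases "p = 0")
  case True
  then show ?thesis by (intro exI[of _ 1] exI[of _ 0]) auto
next
  case False
  then have "finite {x. poly p x = 0}" by (rule poly_roots_finite)
  then have "bdd_above {x. poly p x = 0}" by (rule bdd_above_finite)
  then obtain c where c: "\<And>x. poly p x = 0 \<Longrightarrow> x \<le> c"
    unfolding bdd_above_def by auto
  have "\<exists>k. \<forall>x\<in>{c<..}. poly q x / poly p x = k"
  proof (rule has_field_derivative_zero_constant)
    fix x assume "x \<in> {c<..}"
    then have "poly p x \<noteq> 0" using c by fastforce
    moreover have "poly p x * poly (pderiv q) x = poly (pderiv p) x * poly q x"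
      using assms by (metis poly_mult)
    ultimately show "((\<lambda>x. poly q x / poly p x) has_field_derivative 0) (at x within {c<..})"
      by (auto intro!: derivative_eq_intros simp: field_simps)
  qed auto
  then obtain k where k: "\<And>x. x > c \<Longrightarrow> poly q x / poly p x = k" by auto
  have "q = smult k p"
  proof (rule poly_eqI_infinite)
    show "infinite {c<..}" by (rule infinite_Ioi)
    fix x assume "x \<in> {c<..}"
    then show "poly q x = poly (smult k p) x" using k[of x] c[of x] by (auto simp: field_simps)
  qed
  then show ?thesis by (intro exI[of _ k] exI[of _ "-1"]) auto
qed

text \<open>Synthetic division at a point \<open>c\<close> of convergence lowers the degree bound,
  and the quotients still converge at every other such point; hence an induction on
  \<open>n\<close>. This later turns almost everywhere convergence into convergence of
  coefficients.\<close>

lemma convergent_coeffs: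
  fixes p :: "nat \<Rightarrow> real poly"
  assumes "\<And>j. degree (p j) \<le> n" and "infinite {x. convergent (\<lambda>j. poly (p j) x)}"
  shows "convergent (\<lambda>j. coeff (p j) k)"
  using assms
proof (induction n arbitrary: p k)
  case 0
  obtain x where "convergent (\<lambda>j. poly (p j) x)" using 0(2) not_finite_existsD by blast
  moreover have "poly (p j) x = coeff (p j) 0" for j
    using 0(1)[of j] by (metis degree_0_id le_zero_eq poly_pCons add.right_neutral mult_zero_right poly_0)
  moreover have "coeff (p j) k = (if k = 0 then coeff (p j) 0 else 0)" for j
    using 0(1)[of j] by (auto intro!: coeff_eq_0)
  ultimately show ?case by (cases "k = 0") (auto simp: convergent_const)
next
  case (Suc n)
  obtain c where c: "convergent (\<lambda>j. poly (p j) c)" using Suc(3) not_finite_existsD by blast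
  define q where "q = (\<lambda>j. synthetic_div (p j) c)"
  have pq: "p j = [:-c, 1:] * q j + [:poly (p j) c:]" for j
    unfolding q_def by (rule synthetic_div_correct'[symmetric])
  have q: "convergent (\<lambda>j. coeff (q j) k)" for k
  proof (rule Suc.IH)
    show "degree (q j) \<le> n" for j using Suc(2)[of j] by (simp add: q_def degree_synthetic_div)
    have "{x. convergent (\<lambda>j. poly (p j) x)} - {c} \<subseteq> {x. convergent (\<lambda>j. poly (q j) x)}"
    proof
      fix x assume x: "x \<in> {x. convergent (\<lambda>j. poly (p j) x)} - {c}"
      have "poly (q j) x = (poly (p j) x - poly (p j) c) / (x - c)" for j
        using x arg_cong[OF pq[of j], of "\<lambda>r. poly r x"] by (simp add: field_simps)
      then show "x \<in> {x. convergent (\<lambda>j. poly (q j) x)}"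
        using x c by (simp add: convergent_diff divide_inverse convergent_mult convergent_const)
    qed
    then show "infinite {x. convergent (\<lambda>j. poly (q j) x)}"
      using Suc(3) by (metis finite_Diff_insert Diff_empty finite_subset)
  qed
  have pk: "coeff (p j) k = (case k of 0 \<Rightarrow> 0 | Suc i \<Rightarrow> coeff (q j) i) - c * coeff (q j) k + (if k = 0 then poly (p j) c else 0)" for j
    by (subst pq) (auto split: nat.split)
  have "convergent (\<lambda>j. case k of 0 \<Rightarrow> 0 | Suc i \<Rightarrow> coeff (q j) i)"
    using q by (cases k) (auto simp: convergent_const)
  moreover have "convergent (\<lambda>j. if k = 0 then poly (p j) c else 0)"
    using c by (cases "k = 0") (auto simp: convergent_const)
  ultimately show ?case unfolding pk
    by (intro convergent_add convergent_diff convergent_mult convergent_const q)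
qed

text \<open>Polynomials in \<open>r = fst z\<close> with coefficients that are polynomials in
  \<open>s = snd z\<close>. The asymmetric encoding exposes the leading coefficient in
  \<open>r\<close>, the only one that is known explicitly.\<close>

definition bipoly :: "nat \<Rightarrow> (nat \<Rightarrow> real poly) \<Rightarrow> real \<times> real \<Rightarrow> real" where
  "bipoly n p z = (\<Sum>k\<le>n. poly (p k) (snd z) * fst z ^ k)"

lemma bipoly_continuous: "continuous_on UNIV (bipoly n p)"
  unfolding bipoly_def by (intro continuous_intros)

lemma bipoly_measurable [measurable]: "bipoly n p \<in> borel_measurable borel"
  by (intro borel_measurable_continuous_onI bipoly_continuous)

lemma bipoly_has_derivative:
  "(bipoly n p has_derivative (\<lambda>h. (\<Sum>k\<le>n. real k * poly (p k) (snd z) * fst z ^ (k - 1)) * fst h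
      + bipoly n (\<lambda>k. pderiv (p k)) z * snd h)) (at z)"
proof -
  have poly_der: "((\<lambda>z::real \<times> real. poly (p k) (snd z)) has_derivative (\<lambda>h. snd h * poly (pderiv (p k)) (snd z))) (at z)" for k
    by (rule DERIV_compose_FDERIV[OF poly_DERIV]) (auto intro!: derivative_eq_intros)
  have "((\<lambda>z. \<Sum>k\<le>n. poly (p k) (snd z) * fst z ^ k) has_derivative
    (\<lambda>h. \<Sum>k\<le>n. poly (p k) (snd z) * (real k * (fst h * fst z ^ (k - 1))) + snd h * poly (pderiv (p k)) (snd z) * fst z ^ k)) (at z)"
    by (intro has_derivative_sum has_derivative_mult poly_der)
       (auto intro!: derivative_eq_intros simp: algebra_simps)
  then show ?thesis
    by (simp add: bipoly_def[abs_def] sum.distrib sum_distrib_left sum_distrib_right mult_ac add.commute)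
qed

text \<open>Only bounds on the degrees are assumed, since the leading coefficients of the sections
  below may vanish.\<close>

lemma coeff_mult_degree_le:
  fixes p q :: "'a::comm_semiring_0 poly"
  assumes "degree p \<le> i" "degree q \<le> j"
  shows "coeff (p * q) (i + j) = coeff p i * coeff q j"
proof -
  have "coeff p k * coeff q (i + j - k) = 0" if "k \<le> i + j" "k \<noteq> i" for k
  proof (cases "k < i")
    case True
    then have "degree q < i + j - k" using assms by linarith
    then show ?thesis by (simp add: coeff_eq_0)
  next
    case False
    then have "degree p < k" using that assms by linarith
    then show ?thesis by (simp add: coeff_eq_0)
  qed
  then have "(\<Sum>k\<le>i + j. coeff p k * coeff q (i + j - k)) = (\<Sum>k\<in>{i}. coeff p k * coeff q (i + j - k))"
    by (intro sum.mono_neutral_right) auto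
  then show ?thesis by (simp add: coeff_mult)
qed

text \<open>By Euler's identity, in the variable \<open>r\<close> the Jacobian has leading coefficient
  \<open>n (p\<^sub>n q\<^sub>n' - p\<^sub>n' q\<^sub>n)\<close>.\<close>

lemma bipoly_null_vimage:
  fixes p q :: "nat \<Rightarrow> real poly"
  assumes n: "n \<ge> 1" and W: "p n * pderiv (q n) \<noteq> pderiv (p n) * q n"
    and N: "N \<in> null_sets (lborel :: (real \<times> real) measure)"
  shows "{z. (bipoly n p z, bipoly n q z) \<in> N} \<in> null_sets lborel"
proof -
  \<comment> \<open>\<open>D p\<close> is the partial derivative in \<open>r\<close>; the truncated
    exponent at \<open>k = 0\<close> comes with the factor 0. \<open>J\<close> is the Jacobian
    determinant, and the preimage of \<open>N\<close> is split according to
    \<open>J z = 0\<close>.\<close>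
  define D where "D = (\<lambda>(p :: nat \<Rightarrow> real poly) z. \<Sum>k\<le>n. real k * poly (p k) (snd z) * fst z ^ (k - 1) :: real)"
  define J where "J = (\<lambda>z. D p z * bipoly n (\<lambda>k. pderiv (q k)) z - bipoly n (\<lambda>k. pderiv (p k)) z * D q z)"
  have Dcont: "continuous_on UNIV (D p)" for p unfolding D_def by (intro continuous_intros)
  have der: "(bipoly n p has_derivative (\<lambda>h. D p z * fst h + bipoly n (\<lambda>k. pderiv (p k)) z * snd h)) (at z)" for p z
    unfolding D_def by (rule bipoly_has_derivative)
  have NB [measurable]: "N \<in> sets borel" using N by auto
  have Jcont: "continuous_on UNIV J" unfolding J_def by (intro continuous_intros Dcont bipoly_continuous)
  have [measurable]: "J \<in> borel_measurable borel" using Jcont by (rule borel_measurable_continuous_onI)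
  have N': "negligible N"
    using N by (simp add: negligible_iff_null_sets null_sets_completion_iff)
  have a: "negligible {z. J z \<noteq> 0 \<and> (bipoly n p z, bipoly n q z) \<in> N}"
    unfolding J_def
    by (rule negligible_vimage_plane[OF der der Dcont bipoly_continuous Dcont bipoly_continuous N'])
  \<comment> \<open>By Fubini: for all but finitely many \<open>s\<close> the section in
    \<open>r\<close> is the zero set of a nonzero polynomial.\<close>
  have "{z. J z = 0} \<in> null_sets (lborel \<Otimes>\<^sub>M lborel)"
  proof -
    have meas: "{z. J z = 0} \<in> sets (lborel \<Otimes>\<^sub>M lborel)"
    proof -
      have "{z. J z = 0} \<in> sets borel" by measurable
      then show ?thesis unfolding lborel_prod by simp
    qed
    have slice: "finite {r. J (r, s) = 0}" if s: "poly (p n * pderiv (q n) - pderiv (p n) * q n) s \<noteq> 0" for s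
    proof -
      define A where "A = (\<lambda>(p :: nat \<Rightarrow> real poly). \<Sum>k\<le>n. monom (poly (p k) s) k)"
      have cA: "coeff (A p) k = (if k \<le> n then poly (p k) s else 0)" for p k
        by (auto simp: A_def coeff_sum)
      have dA: "degree (A p) \<le> n" for p
        unfolding A_def by (intro degree_sum_le) (auto intro: order_trans[OF degree_monom_le])
      have A: "poly (A p) r = bipoly n p (r, s)" for p r
        by (simp add: A_def bipoly_def poly_sum poly_monom)
      have A': "poly (pderiv (A p)) r = D p (r, s)" for p r
      proof -
        have "pderiv (A p) = (\<Sum>k\<le>n. monom (of_nat k * poly (p k) s) (k - 1))"
          by (simp add: A_def higher_pderiv_sum[of 1, simplified] pderiv_monom)
        then show ?thesis by (simp add: D_def poly_sum poly_monom)
      qed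
      define R where "R = pderiv (A p) * A (\<lambda>k. pderiv (q k)) - A (\<lambda>k. pderiv (p k)) * pderiv (A q)"
      have "J (r, s) = poly R r" for r by (simp add: J_def R_def A A')
      moreover have "R \<noteq> 0"
      proof
        assume "R = 0"
        have dd: "degree (pderiv (A p)) \<le> n - 1" for p using dA[of p] by (simp add: degree_pderiv)
        have cd: "coeff (pderiv (A p)) (n - 1) = n * poly (p n) s" for p
          using n by (simp add: coeff_pderiv cA)
        \<comment> \<open>The largest possible degree of \<open>R\<close>: a derivative in
          \<open>r\<close> contributes at most \<open>n - 1\<close>, a derivative in
          \<open>s\<close> at most \<open>n\<close>.\<close>
        have "coeff R ((n - 1) + n) = n * (poly (p n) s * poly (pderiv (q n)) s - poly (pderiv (p n)) s * poly (q n) s)"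
          unfolding R_def coeff_diff
          using coeff_mult_degree_le[OF dd dA, of p "\<lambda>k. pderiv (q k)"] coeff_mult_degree_le[OF dd dA, of q "\<lambda>k. pderiv (p k)"]
          by (simp add: cd[simplified One_nat_def] cA mult.commute[of "A (\<lambda>k. pderiv (p k))"] algebra_simps)
        with \<open>R = 0\<close> n s show False by simp
      qed
      ultimately show ?thesis using poly_roots_finite[of R] by simp
    qed
    have "finite {s. poly (p n * pderiv (q n) - pderiv (p n) * q n) s = 0}"
      using W by (intro poly_roots_finite) simp
    then have "AE s in lborel. poly (p n * pderiv (q n) - pderiv (p n) * q n) s \<noteq> 0"
      by (intro AE_I'[OF finite_imp_null_set_lborel]) auto
    then have "AE s in lborel. emeasure lborel ((\<lambda>r. (r, s)) -` {z. J z = 0}) = 0"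
      by eventually_elim (use slice in \<open>auto intro!: emeasure_lborel_countable countable_finite simp: vimage_def\<close>)
    then have "emeasure (lborel \<Otimes>\<^sub>M lborel) {z. J z = 0} = 0"
      by (subst lborel_pair.emeasure_pair_measure_alt2[OF meas]) (simp add: nn_integral_0_iff_AE cong: nn_integral_cong_AE)
    then show ?thesis using meas by auto
  qed
  then have b: "negligible {z. J z = 0}"
    by (simp add: lborel_prod negligible_iff_null_sets null_sets_completion_iff)
  have "negligible {z. (bipoly n p z, bipoly n q z) \<in> N}"
    by (rule negligible_subset[OF negligible_Un[OF a b]]) auto
  moreover have "{z. (bipoly n p z, bipoly n q z) \<in> N} \<in> sets borel" by measurable
  ultimately show ?thesis by (simp add: negligible_iff_null_sets null_sets_completion_iff)
qed

section \<open>Hermite polynomials and Gaussian fields\<close>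

fun hermite_poly :: "nat \<Rightarrow> real poly" where
  "hermite_poly 0 = 1"
| "hermite_poly (Suc 0) = [:0, 1:]"
| "hermite_poly (Suc (Suc n)) = [:0, 1:] * hermite_poly (Suc n) - smult (real (Suc n)) (hermite_poly n)"

lemma poly_hermite_poly: "poly (hermite_poly n) x = hermite n x"
  by (induction n rule: hermite_poly.induct) auto

lemma hermite_poly_monic: "degree (hermite_poly n) \<le> n \<and> coeff (hermite_poly n) n = 1"
proof (induction n rule: hermite_poly.induct)
  case (3 n)
  have "degree ([:0, 1:] * hermite_poly (Suc n)) \<le> Suc (Suc n)"
    using 3 by (simp add: degree_pCons_eq_if)
  moreover have "degree (smult (real (Suc n)) (hermite_poly n)) \<le> Suc (Suc n)"
    using 3 by (intro order_trans[OF degree_smult_le]) auto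
  moreover have "coeff (hermite_poly n) (Suc (Suc n)) = 0"
    using 3 by (intro coeff_eq_0) auto
  ultimately show ?case
    using 3 by (auto intro!: degree_diff_le)
qed auto

lemma pderiv_hermite_poly: "pderiv (hermite_poly (Suc n)) = smult (real (Suc n)) (hermite_poly n)"
proof (induction n rule: hermite_poly.induct)
  case 1
  show ?case by (simp add: pderiv_pCons)
next
  case 2
  show ?case by (simp add: pderiv_pCons pderiv_diff pderiv_smult pderiv_1)
next
  case (3 n)
  have "pderiv (hermite_poly (Suc (Suc (Suc n)))) = hermite_poly (Suc (Suc n))
      + [:0, 1:] * pderiv (hermite_poly (Suc (Suc n))) - smult (real (Suc (Suc n))) (pderiv (hermite_poly (Suc n)))"
    by (subst hermite_poly.simps(3)) (simp add: pderiv_diff pderiv_smult pderiv_mult pderiv_pCons del: hermite_poly.simps)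
  also have "\<dots> = hermite_poly (Suc (Suc n)) + smult (real (Suc (Suc n)))
      ([:0, 1:] * hermite_poly (Suc n) - smult (real (Suc n)) (hermite_poly n))"
    unfolding 3 by (simp add: algebra_simps smult_diff_right del: hermite_poly.simps)
  also have "\<dots> = smult (real (Suc (Suc (Suc n)))) (hermite_poly (Suc (Suc n)))"
    unfolding hermite_poly.simps(3)[symmetric] of_nat_Suc[of "Suc (Suc n)"] smult_add_left by simp
  finally show ?case .
qed

lemma hermite_measurable [measurable]: "hermite n \<in> borel_measurable borel"
  unfolding poly_hermite_poly[symmetric, abs_def]
  by (intro borel_measurable_continuous_onI continuous_intros)

section \<open>Gaussian integration by parts and its consequences for Hermite polynomials\<close>

lemma integrable_std_normal_poly: "integrable std_normal_distribution (poly p)"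
  unfolding poly_altdef
  by (intro Bochner_Integration.integrable_sum integrable_mult_right integrable_std_normal_distribution_moment)

lemma integrable_std_normal_mult_poly: "integrable std_normal_distribution (\<lambda>x. x * poly p x)"
proof -
  have "poly (pCons 0 p) = (\<lambda>x. x * poly p x)" by auto
  then show ?thesis using integrable_std_normal_poly[of "pCons 0 p"] by simp
qed

text \<open>By linearity this is the recursion that expresses the moment of order
  \<open>m + 1\<close> as \<open>m\<close> times the moment of order \<open>m - 1\<close>, and that
  is read off from the explicit moments.\<close>

lemma std_normal_integration_by_parts:
  "(\<integral>x. x * poly p x \<partial>std_normal_distribution) = (\<integral>x. poly (pderiv p) x \<partial>std_normal_distribution)"
proof -
  note int = integrable_std_normal_distribution_moment
  have mom: "(\<integral>x. x ^ Suc m \<partial>std_normal_distribution) = real m * (\<integral>x. x ^ (m - 1) \<partial>std_normal_distribution)" for m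
  proof (cases "even m")
    case True
    show ?thesis
    proof (cases "m = 0")
      case True
      then show ?thesis using integral_std_normal_distribution_moment_odd[of 1] by simp
    next
      case False
      then have "odd (Suc m)" "odd (m - 1)" using True by auto
      then show ?thesis using integral_std_normal_distribution_moment_odd by (simp del: power_Suc)
    qed
  next
    case False
    then obtain k where m: "m = 2 * k + 1" by (elim oddE)
    have "(\<integral>x. x ^ Suc m \<partial>std_normal_distribution) = fact (2 * Suc k) / (2 ^ Suc k * fact (Suc k))"
      using std_normal_distribution_even_moments(1)[of "Suc k"] by (simp add: m)
    also have "\<dots> = (2 * real (Suc k)) * (real m * fact (2 * k)) / ((2 * real (Suc k)) * (2 ^ k * fact k))"
      by (simp add: m algebra_simps)
    also have "\<dots> = real m * (fact (2 * k) / (2 ^ k * fact k))"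
      by (subst mult_divide_mult_cancel_left) auto
    also have "fact (2 * k) / (2 ^ k * fact k) = (\<integral>x. x ^ (m - 1) \<partial>std_normal_distribution)"
      using std_normal_distribution_even_moments(1)[of k] by (simp add: m)
    finally show ?thesis .
  qed
  have "(\<integral>x. x * poly p x \<partial>std_normal_distribution) = (\<integral>x. (\<Sum>i\<le>degree p. coeff p i * x ^ Suc i) \<partial>std_normal_distribution)"
    by (simp add: poly_altdef sum_distrib_left mult_ac)
  also have "\<dots> = (\<Sum>i\<le>degree p. coeff p i * (real i * (\<integral>x. x ^ (i - 1) \<partial>std_normal_distribution)))"
    using mom int[of "Suc _"] by (subst Bochner_Integration.integral_sum) (auto simp del: power_Suc)
  also have "\<dots> = (\<integral>x. (\<Sum>i\<le>degree p. real i * coeff p i * x ^ (i - 1)) \<partial>std_normal_distribution)"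
    using int by (subst Bochner_Integration.integral_sum) (auto simp: mult_ac)
  also have "\<dots> = (\<integral>x. poly (pderiv p) x \<partial>std_normal_distribution)"
  proof -
    have "pderiv p = (\<Sum>i\<le>degree p. monom (real i * coeff p i) (i - 1))"
      by (subst (1) poly_as_sum_of_monoms[symmetric]) (simp add: higher_pderiv_sum[of 1, simplified] pderiv_monom)
    then show ?thesis by (simp add: poly_sum poly_monom)
  qed
  finally show ?thesis .
qed

text \<open>\<open>H_(n+1) = x H_n - H_n'\<close>, so raising the index of a Hermite polynomial is
  adjoint to differentiation under the Gaussian measure.\<close>

lemma hermite_integration_by_parts:
  "(\<integral>x. hermite (Suc n) x * poly q x \<partial>std_normal_distribution) = (\<integral>x. hermite n x * poly (pderiv q) x \<partial>std_normal_distribution)"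
proof -
  have rec: "hermite_poly (Suc n) = [:0, 1:] * hermite_poly n - pderiv (hermite_poly n)"
    by (cases n) (auto simp: pderiv_hermite_poly pderiv_1)
  have "(\<integral>x. hermite (Suc n) x * poly q x \<partial>std_normal_distribution)
      = (\<integral>x. x * poly (hermite_poly n * q) x - poly (pderiv (hermite_poly n) * q) x \<partial>std_normal_distribution)"
    unfolding poly_hermite_poly[symmetric] rec by (simp add: algebra_simps)
  also have "\<dots> = (\<integral>x. x * poly (hermite_poly n * q) x \<partial>std_normal_distribution) - (\<integral>x. poly (pderiv (hermite_poly n) * q) x \<partial>std_normal_distribution)"
    by (intro Bochner_Integration.integral_diff integrable_std_normal_poly integrable_std_normal_mult_poly)
  also have "\<dots> = (\<integral>x. poly (pderiv (hermite_poly n * q)) x - poly (pderiv (hermite_poly n) * q) x \<partial>std_normal_distribution)"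
    unfolding std_normal_integration_by_parts
    by (intro Bochner_Integration.integral_diff[symmetric] integrable_std_normal_poly)
  also have "\<dots> = (\<integral>x. hermite n x * poly (pderiv q) x \<partial>std_normal_distribution)"
    by (simp add: pderiv_mult poly_hermite_poly)
  finally show ?thesis .
qed

lemma std_normal_integral_hermite_eq_0: "n \<ge> 1 \<Longrightarrow> (\<integral>x. hermite n x \<partial>std_normal_distribution) = 0"
  using hermite_integration_by_parts[of "n - 1" 1] by (cases n) (auto simp del: hermite.simps)

lemma std_normal_integral_hermite_square: "(\<integral>x. (hermite n x)\<^sup>2 \<partial>std_normal_distribution) = fact n"
proof (induction n)
  case 0
  interpret real_distribution std_normal_distribution by (rule real_dist_normal_dist)
  show ?case using prob_space by simp
next
  case (Suc n)
  have "(\<integral>x. (hermite (Suc n) x)\<^sup>2 \<partial>std_normal_distribution)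
      = (\<integral>x. hermite n x * poly (pderiv (hermite_poly (Suc n))) x \<partial>std_normal_distribution)"
    using hermite_integration_by_parts[of n "hermite_poly (Suc n)"] by (simp only: poly_hermite_poly power2_eq_square)
  also have "\<dots> = (\<integral>x. real (Suc n) * (hermite n x)\<^sup>2 \<partial>std_normal_distribution)"
    unfolding pderiv_hermite_poly poly_smult poly_hermite_poly by (simp only: power2_eq_square mult.left_commute)
  finally show ?case using Suc by simp
qed

text \<open>Hermite polynomials are eigenfunctions of the Ornstein-Uhlenbeck semigroup. In the
  recurrence the term with \<sigma> \<open>y\<close> is integrated by parts, and 1 - \<sigma>^2 =
  \<rho>^2 closes the induction.\<close>

lemma mehler_hermite:
  assumes "\<rho>\<^sup>2 + \<sigma>\<^sup>2 = 1"
  shows "(\<integral>y. hermite n (\<rho> * x + \<sigma> * y) \<partial>std_normal_distribution) = \<rho> ^ n * hermite n x"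
proof (induction n x rule: hermite.induct)
  case (1 x)
  interpret real_distribution std_normal_distribution by (rule real_dist_normal_dist)
  show ?case using prob_space by simp
next
  case (2 x)
  interpret real_distribution std_normal_distribution by (rule real_dist_normal_dist)
  show ?case using prob_space integral_std_normal_distribution_moment_odd[of 1] integrable_std_normal_distribution_moment[of 1]
    by simp
next
  case (3 n x)
  let ?l = "[:\<rho> * x, \<sigma>:]"
  let ?E = "\<lambda>p. (\<integral>y. poly p y \<partial>std_normal_distribution)"
  note int = integrable_std_normal_poly
  have e: "hermite m (\<rho> * x + \<sigma> * y) = poly (hermite_poly m \<circ>\<^sub>p ?l) y" for m y
    by (simp add: poly_pcompose poly_hermite_poly mult.commute)
  have Edif: "?E (p - q) = ?E p - ?E q" "?E (p + q) = ?E p + ?E q" "?E (smult c p) = c * ?E p" for p q c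
    using int[of p] int[of q] by simp_all
  have IH: "?E (hermite_poly (Suc n) \<circ>\<^sub>p ?l) = \<rho> ^ Suc n * hermite (Suc n) x"
    "?E (hermite_poly n \<circ>\<^sub>p ?l) = \<rho> ^ n * hermite n x"
    using 3 unfolding e by auto
  have "hermite_poly (Suc (Suc n)) \<circ>\<^sub>p ?l = smult (\<rho> * x) (hermite_poly (Suc n) \<circ>\<^sub>p ?l)
      + smult \<sigma> ([:0, 1:] * (hermite_poly (Suc n) \<circ>\<^sub>p ?l)) - smult (real (Suc n)) (hermite_poly n \<circ>\<^sub>p ?l)"
    by (simp add: pcompose_diff pcompose_mult pcompose_smult pcompose_pCons algebra_simps del: hermite_poly.simps(2))
  moreover have "?E ([:0, 1:] * (hermite_poly (Suc n) \<circ>\<^sub>p ?l)) = \<sigma> * real (Suc n) * ?E (hermite_poly n \<circ>\<^sub>p ?l)"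
  proof -
    have "pderiv (hermite_poly (Suc n) \<circ>\<^sub>p ?l) = smult (\<sigma> * real (Suc n)) (hermite_poly n \<circ>\<^sub>p ?l)"
      by (simp add: pderiv_pcompose pderiv_hermite_poly pderiv_pCons pcompose_smult mult.commute del: hermite_poly.simps)
    then show ?thesis
      using std_normal_integration_by_parts[of "hermite_poly (Suc n) \<circ>\<^sub>p ?l"] by (simp del: hermite_poly.simps)
  qed
  ultimately have "?E (hermite_poly (Suc (Suc n)) \<circ>\<^sub>p ?l)
      = \<rho> * x * (\<rho> ^ Suc n * hermite (Suc n) x) + \<sigma> * (\<sigma> * real (Suc n) * (\<rho> ^ n * hermite n x)) - real (Suc n) * (\<rho> ^ n * hermite n x)"
    by (simp only: Edif IH)
  also have "\<dots> = \<rho> * x * (\<rho> ^ Suc n * hermite (Suc n) x) - (1 - \<sigma>\<^sup>2) * real (Suc n) * (\<rho> ^ n * hermite n x)"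
    by (simp add: algebra_simps power2_eq_square del: hermite.simps)
  also have "1 - \<sigma>\<^sup>2 = \<rho>\<^sup>2" using assms by simp
  also have "\<rho> * x * (\<rho> ^ Suc n * hermite (Suc n) x) - \<rho>\<^sup>2 * real (Suc n) * (\<rho> ^ n * hermite n x) = \<rho> ^ Suc (Suc n) * hermite (Suc (Suc n)) x"
    by (simp add: algebra_simps power2_eq_square)
  finally show ?case unfolding e .
qed

lemma std_normal_cis: "(\<integral>x. cis (t * x) \<partial>std_normal_distribution) = of_real (exp (- t\<^sup>2 / 2))"
  using char_std_normal_distribution[THEN fun_cong, of t]
  by (simp add: char_def cis_conv_exp exp_of_real)

lemma abs_mult_le_sum_squares: "\<bar>a * b\<bar> \<le> a\<^sup>2 + (b :: real)\<^sup>2"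
proof -
  have "2 * (\<bar>a\<bar> * \<bar>b\<bar>) \<le> a\<^sup>2 + b\<^sup>2"
    using sum_squares_bound[of "\<bar>a\<bar>" "\<bar>b\<bar>"] by (simp only: power2_abs mult.assoc)
  moreover have "0 \<le> \<bar>a\<bar> * \<bar>b\<bar>" by simp
  ultimately show ?thesis unfolding abs_mult by linarith
qed

lemma integrable_mult_of_squares:
  fixes X Y :: "'w \<Rightarrow> real"
  assumes [measurable]: "X \<in> borel_measurable M" "Y \<in> borel_measurable M"
    and "integrable M (\<lambda>\<omega>. (X \<omega>)\<^sup>2)" "integrable M (\<lambda>\<omega>. (Y \<omega>)\<^sup>2)"
  shows "integrable M (\<lambda>\<omega>. X \<omega> * Y \<omega>)"
proof (rule Bochner_Integration.integrable_bound)
  show "integrable M (\<lambda>\<omega>. (X \<omega>)\<^sup>2 + (Y \<omega>)\<^sup>2)" using assms by auto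
  show "AE \<omega> in M. norm (X \<omega> * Y \<omega>) \<le> norm ((X \<omega>)\<^sup>2 + (Y \<omega>)\<^sup>2)"
    using abs_mult_le_sum_squares by (intro AE_I2) simp
qed simp

text \<open>Prescribing all characteristic functions, rather than Gaussian marginals and covariances,
  makes linearity of \<open>W\<close> up to null sets part of the assumption.\<close>

locale gaussian_field = prob_space M
  for M :: "'w measure" and W :: "'a::real_inner \<Rightarrow> 'w \<Rightarrow> real" +
  assumes W_measurable [measurable]: "\<And>h. W h \<in> borel_measurable M"
    and W_char: "\<And>(J :: 'a set) c. finite J \<Longrightarrow>
      (\<integral>\<omega>. cis (\<Sum>h\<in>J. c h * W h \<omega>) \<partial>M) = of_real (exp (- (norm (\<Sum>h\<in>J. c h *\<^sub>R h))\<^sup>2 / 2))"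
begin

lemma W_char1: "(\<integral>\<omega>. cis (t * W h \<omega>) \<partial>M) = of_real (exp (- (t * norm h)\<^sup>2 / 2))"
  using W_char[of "{h}" "\<lambda>_. t"] by (simp add: power_mult_distrib)

text \<open>Vectors may repeat here, and the coefficients of equal vectors are merged. Resampling
  needs this, because the projection \<open>rest\<close> is not injective.\<close>

lemma W_char_family:
  assumes J: "finite J"
  shows "(\<integral>\<omega>. cis (\<Sum>i\<in>J. c i * W (g i) \<omega>) \<partial>M) = of_real (exp (- (norm (\<Sum>i\<in>J. c i *\<^sub>R g i))\<^sup>2 / 2))"
proof -
  let ?d = "\<lambda>k. \<Sum>i | i \<in> J \<and> g i = k. c i"
  have "(\<Sum>k\<in>g ` J. ?d k * W k \<omega>) = (\<Sum>i\<in>J. c i * W (g i) \<omega>)" for \<omega>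
  proof -
    have "(\<Sum>k\<in>g ` J. ?d k * W k \<omega>) = (\<Sum>k\<in>g ` J. \<Sum>i | i \<in> J \<and> g i = k. c i * W (g i) \<omega>)"
      by (simp add: sum_distrib_right)
    also have "\<dots> = (\<Sum>i\<in>J. c i * W (g i) \<omega>)" using J by (intro sum.group) auto
    finally show ?thesis .
  qed
  moreover have "(\<Sum>k\<in>g ` J. ?d k *\<^sub>R k) = (\<Sum>i\<in>J. c i *\<^sub>R g i)"
  proof -
    have "(\<Sum>k\<in>g ` J. ?d k *\<^sub>R k) = (\<Sum>k\<in>g ` J. \<Sum>i | i \<in> J \<and> g i = k. c i *\<^sub>R g i)"
      by (simp add: scaleR_sum_left)
    also have "\<dots> = (\<Sum>i\<in>J. c i *\<^sub>R g i)" using J by (intro sum.group) auto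
    finally show ?thesis .
  qed
  ultimately show ?thesis using W_char[of "g ` J" ?d] J by simp
qed

lemma W_char2: "(\<integral>\<omega>. cis (s * W h \<omega> + t * W k \<omega>) \<partial>M) = of_real (exp (- (norm (s *\<^sub>R h + t *\<^sub>R k))\<^sup>2 / 2))"
  using W_char_family[of UNIV "\<lambda>i. if i then s else t" "\<lambda>i. if i then h else k"]
  by (simp add: UNIV_bool add.commute)

lemma W_unit_distr:
  assumes "norm h = 1"
  shows "distr M borel (W h) = std_normal_distribution"
proof (rule Levy_uniqueness)
  show "real_distribution (distr M borel (W h))" by (rule real_distribution_distr) simp
  show "real_distribution std_normal_distribution" by (rule real_dist_normal_dist)
  have "char (distr M borel (W h)) t = char std_normal_distribution t" for t
    using W_char1[of t h] assms
    by (simp add: char_std_normal_distribution char_def integral_distr cis_conv_exp exp_of_real)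
  then show "char (distr M borel (W h)) = char std_normal_distribution" by auto
qed

lemma integrable_poly_W:
  assumes "norm h = 1"
  shows "integrable M (\<lambda>\<omega>. poly p (W h \<omega>))"
proof -
  have [measurable]: "poly p \<in> borel_measurable borel"
    by (intro borel_measurable_continuous_onI continuous_intros)
  have "integrable (distr M borel (W h)) (poly p)"
    unfolding W_unit_distr[OF assms] by (rule integrable_std_normal_poly)
  then show ?thesis by (simp add: integrable_distr_eq)
qed

lemma integrable_hermite_W:
  assumes "norm h = 1"
  shows "integrable M (\<lambda>\<omega>. hermite n (W h \<omega>))" "integrable M (\<lambda>\<omega>. (hermite n (W h \<omega>))\<^sup>2)"
  using integrable_poly_W[OF assms, of "hermite_poly n"] integrable_poly_W[OF assms, of "hermite_poly n ^ 2"]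
  by (simp_all add: poly_hermite_poly)

lemma expectation_hermite_W:
  assumes "norm h = 1" "n \<ge> 1"
  shows "expectation (\<lambda>\<omega>. hermite n (W h \<omega>)) = 0"
proof -
  have "expectation (\<lambda>\<omega>. hermite n (W h \<omega>)) = (\<integral>x. hermite n x \<partial>distr M borel (W h))"
    by (rule integral_distr[symmetric]) auto
  then show ?thesis
    unfolding W_unit_distr[OF assms(1)] using std_normal_integral_hermite_eq_0[OF assms(2)] by simp
qed

lemma integrable_hermite_mult:
  assumes "norm h = 1" "norm k = 1"
  shows "integrable M (\<lambda>\<omega>. hermite n (W h \<omega>) * hermite n (W k \<omega>))"
  using assms by (intro integrable_mult_of_squares integrable_hermite_W) auto

text \<open>The pair \<open>(W h, W k)\<close> has the law of (x, \<rho> x + \<sigma> y) for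
  independent standard normal x and y, with \<rho> the inner product. Integrating out y by
  \<open>mehler_hermite\<close> leaves \<rho>^n times the second moment of a Hermite
  polynomial.\<close>

lemma expectation_hermite_mult:
  assumes h: "norm h = 1" and k: "norm k = 1"
  shows "expectation (\<lambda>\<omega>. hermite n (W h \<omega>) * hermite n (W k \<omega>)) = fact n * (h \<bullet> k) ^ n"
proof -
  let ?\<gamma> = std_normal_distribution
  interpret G: real_distribution ?\<gamma> by (rule real_dist_normal_dist)
  interpret GG: pair_prob_space ?\<gamma> ?\<gamma> ..
  define \<rho> where "\<rho> = h \<bullet> k"
  have "\<bar>\<rho>\<bar> \<le> 1" using Cauchy_Schwarz_ineq2[of h k] h k by (simp add: \<rho>_def)
  define \<sigma> where "\<sigma> = sqrt (1 - \<rho>\<^sup>2)"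
  have \<rho>\<sigma>: "\<rho>\<^sup>2 + \<sigma>\<^sup>2 = 1"
    using \<open>\<bar>\<rho>\<bar> \<le> 1\<close> by (simp add: \<sigma>_def abs_square_le_1)
  \<comment> \<open>The pair is indexed by \<open>bool\<close>, so that the uniqueness result for
    families applies.\<close>
  let ?X = "\<lambda>(i::bool) \<omega>. W (if i then h else k) \<omega>"
  let ?Y = "\<lambda>(i::bool) (z :: real \<times> real). if i then fst z else \<rho> * fst z + \<sigma> * snd z"
  have cisI: "integrable (?\<gamma> \<Otimes>\<^sub>M ?\<gamma>) (\<lambda>z. cis (f z))" if [measurable]: "f \<in> borel_measurable (?\<gamma> \<Otimes>\<^sub>M ?\<gamma>)" for f
    using integrable_mult_cis[OF GG.prob_space_axioms, of "\<lambda>_. 1" f 1] that by simp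
  have YY: "(\<integral>z. cis (s * fst z + t * (\<rho> * fst z + \<sigma> * snd z)) \<partial>(?\<gamma> \<Otimes>\<^sub>M ?\<gamma>)) = of_real (exp (- (norm (s *\<^sub>R h + t *\<^sub>R k))\<^sup>2 / 2))" for s t
  proof -
    have "(\<integral>z. cis (s * fst z + t * (\<rho> * fst z + \<sigma> * snd z)) \<partial>(?\<gamma> \<Otimes>\<^sub>M ?\<gamma>))
        = (\<integral>x. \<integral>y. cis (s * x + t * (\<rho> * x + \<sigma> * y)) \<partial>?\<gamma> \<partial>?\<gamma>)"
      using GG.integral_fst'[OF cisI[of "\<lambda>z. s * fst z + t * (\<rho> * fst z + \<sigma> * snd z)"]] by simp
    also have "\<dots> = (\<integral>x. cis ((s + t * \<rho>) * x) * (\<integral>y. cis ((t * \<sigma>) * y) \<partial>?\<gamma>) \<partial>?\<gamma>)"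
      by (subst integral_mult_right_zero[symmetric]) (simp add: cis_mult algebra_simps)
    also have "\<dots> = of_real (exp (- (s + t * \<rho>)\<^sup>2 / 2) * exp (- (t * \<sigma>)\<^sup>2 / 2))"
      unfolding std_normal_cis by (simp add: std_normal_cis)
    also have "exp (- (s + t * \<rho>)\<^sup>2 / 2) * exp (- (t * \<sigma>)\<^sup>2 / 2) = exp (- ((s + t * \<rho>)\<^sup>2 + (t * \<sigma>)\<^sup>2) / 2)"
      by (simp add: exp_add[symmetric] add_divide_distrib)
    also have "(s + t * \<rho>)\<^sup>2 + (t * \<sigma>)\<^sup>2 = (norm (s *\<^sub>R h + t *\<^sub>R k))\<^sup>2"
    proof -
      have "(s + t * \<rho>)\<^sup>2 + (t * \<sigma>)\<^sup>2 = s\<^sup>2 + 2 * s * t * \<rho> + t\<^sup>2 * (\<rho>\<^sup>2 + \<sigma>\<^sup>2)"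
        by (simp add: power2_eq_square algebra_simps)
      moreover have "h \<bullet> h = 1" "k \<bullet> k = 1" using h k by (simp_all add: dot_square_norm)
      then have "(norm (s *\<^sub>R h + t *\<^sub>R k))\<^sup>2 = s\<^sup>2 + 2 * s * t * \<rho> + t\<^sup>2"
        unfolding power2_norm_eq_inner
        by (simp add: inner_add_left inner_add_right \<rho>_def inner_commute power2_eq_square algebra_simps)
      ultimately show ?thesis by (simp add: \<rho>\<sigma>)
    qed
    finally show ?thesis .
  qed
  have law: "distr M (Pi\<^sub>M UNIV (\<lambda>_. borel)) (\<lambda>\<omega> i. ?X i \<omega>) = distr (?\<gamma> \<Otimes>\<^sub>M ?\<gamma>) (Pi\<^sub>M UNIV (\<lambda>_. borel)) (\<lambda>\<omega> i. ?Y i \<omega>)"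
  proof (rule law_eqI)
    fix J :: "bool set" and t :: "bool \<Rightarrow> real"
    \<comment> \<open>Extension of \<open>t\<close> by 0, which reduces all subsets \<open>J\<close>
      of \<open>bool\<close> to one sum of two terms.\<close>
    define a where "a = (\<lambda>i. if i \<in> J then t i else 0)"
    have *: "(\<Sum>i\<in>J. t i * x i) = a True * x True + a False * x False" for x
    proof -
      have "(\<Sum>i\<in>J. t i * x i) = (\<Sum>i\<in>UNIV. a i * x i)"
        by (rule sum.mono_neutral_cong_left) (auto simp: a_def)
      then show ?thesis by (simp add: UNIV_bool)
    qed
    show "(\<integral>\<omega>. cis (\<Sum>i\<in>J. t i * ?X i \<omega>) \<partial>M) = (\<integral>\<omega>. cis (\<Sum>i\<in>J. t i * ?Y i \<omega>) \<partial>(?\<gamma> \<Otimes>\<^sub>M ?\<gamma>))"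
      unfolding * using W_char2[of "a True" h "a False" k] YY[of "a True" "a False"] by simp
  qed (auto intro: prob_space_axioms GG.prob_space_axioms)
  define \<phi> where "\<phi> = (\<lambda>v :: bool \<Rightarrow> real. hermite n (v True) * hermite n (v False))"
  have [measurable]: "\<phi> \<in> borel_measurable (Pi\<^sub>M UNIV (\<lambda>_. borel))"
    unfolding \<phi>_def by measurable
  have [measurable]: "(\<lambda>\<omega> i. ?X i \<omega>) \<in> M \<rightarrow>\<^sub>M Pi\<^sub>M UNIV (\<lambda>_. borel)"
    by (intro measurable_PiM_single') auto
  have [measurable]: "(\<lambda>\<omega> i. ?Y i \<omega>) \<in> (?\<gamma> \<Otimes>\<^sub>M ?\<gamma>) \<rightarrow>\<^sub>M Pi\<^sub>M UNIV (\<lambda>_. borel)"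
    by (intro measurable_PiM_single') auto
  have "integrable (distr M (Pi\<^sub>M UNIV (\<lambda>_. borel)) (\<lambda>\<omega> i. ?X i \<omega>)) \<phi>"
    using integrable_hermite_mult[OF h k] by (simp add: integrable_distr_eq \<phi>_def)
  then have int: "integrable (?\<gamma> \<Otimes>\<^sub>M ?\<gamma>) (\<lambda>z. hermite n (fst z) * hermite n (\<rho> * fst z + \<sigma> * snd z))"
    unfolding law by (simp add: integrable_distr_eq \<phi>_def)
  have "expectation (\<lambda>\<omega>. hermite n (W h \<omega>) * hermite n (W k \<omega>)) = integral\<^sup>L (distr M (Pi\<^sub>M UNIV (\<lambda>_. borel)) (\<lambda>\<omega> i. ?X i \<omega>)) \<phi>"
    by (subst integral_distr) (auto simp: \<phi>_def)
  also have "\<dots> = (\<integral>z. hermite n (fst z) * hermite n (\<rho> * fst z + \<sigma> * snd z) \<partial>(?\<gamma> \<Otimes>\<^sub>M ?\<gamma>))"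
    unfolding law by (subst integral_distr) (auto simp: \<phi>_def)
  also have "\<dots> = (\<integral>x. \<integral>y. hermite n x * hermite n (\<rho> * x + \<sigma> * y) \<partial>?\<gamma> \<partial>?\<gamma>)"
    using GG.integral_fst'[OF int] by simp
  also have "\<dots> = (\<integral>x. \<rho> ^ n * (hermite n x)\<^sup>2 \<partial>?\<gamma>)"
    by (intro Bochner_Integration.integral_cong refl) (simp add: mehler_hermite[OF \<rho>\<sigma>], simp add: power2_eq_square)
  also have "\<dots> = fact n * \<rho> ^ n"
    by (simp add: std_normal_integral_hermite_square)
  finally show ?thesis by (simp add: \<rho>_def)
qed

definition hermite_sum :: "nat \<Rightarrow> 'a set \<Rightarrow> ('a \<Rightarrow> real) \<Rightarrow> 'w \<Rightarrow> real" where
  "hermite_sum n A c \<omega> = (\<Sum>h\<in>A. c h * hermite n (W h \<omega>))"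

lemma hermite_sum_measurable [measurable]: "hermite_sum n A c \<in> borel_measurable M"
  unfolding hermite_sum_def by measurable

text \<open>The double sum is the squared norm of the corresponding combination of tensor powers,
  written without a tensor power because this locale has none.\<close>

lemma hermite_sum_square:
  assumes "finite A" and "\<forall>h\<in>A. norm h = 1"
  shows "integrable M (\<lambda>\<omega>. (hermite_sum n A c \<omega>)\<^sup>2)"
    and "expectation (\<lambda>\<omega>. (hermite_sum n A c \<omega>)\<^sup>2) = fact n * (\<Sum>h\<in>A. \<Sum>k\<in>A. c h * c k * (h \<bullet> k) ^ n)"
proof -
  have e: "(hermite_sum n A c \<omega>)\<^sup>2 = (\<Sum>h\<in>A. \<Sum>k\<in>A. c h * c k * (hermite n (W h \<omega>) * hermite n (W k \<omega>)))" for \<omega>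
    unfolding hermite_sum_def power2_eq_square sum_product by (simp add: mult_ac)
  show "integrable M (\<lambda>\<omega>. (hermite_sum n A c \<omega>)\<^sup>2)"
    unfolding e using assms by (intro Bochner_Integration.integrable_sum integrable_mult_right integrable_hermite_mult) auto
  have "expectation (\<lambda>\<omega>. (hermite_sum n A c \<omega>)\<^sup>2) = (\<Sum>h\<in>A. \<Sum>k\<in>A. c h * c k * (fact n * (h \<bullet> k) ^ n))"
    unfolding e using assms
    by (simp add: Bochner_Integration.integral_sum Bochner_Integration.integrable_sum integrable_hermite_mult expectation_hermite_mult)
  then show "expectation (\<lambda>\<omega>. (hermite_sum n A c \<omega>)\<^sup>2) = fact n * (\<Sum>h\<in>A. \<Sum>k\<in>A. c h * c k * (h \<bullet> k) ^ n)"
    by (simp add: sum_distrib_left mult_ac)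
qed

lemma integrable_hermite_sum: "\<forall>h\<in>A. norm h = 1 \<Longrightarrow> integrable M (hermite_sum n A c)"
  unfolding hermite_sum_def
  by (intro Bochner_Integration.integrable_sum integrable_mult_right integrable_hermite_W) auto

lemma expectation_hermite_sum:
  "\<forall>h\<in>A. norm h = 1 \<Longrightarrow> n \<ge> 1 \<Longrightarrow> expectation (hermite_sum n A c) = 0"
  unfolding hermite_sum_def
  by (subst Bochner_Integration.integral_sum) (auto intro: integrable_hermite_W simp: expectation_hermite_W)

end

section \<open>Tensor powers\<close>

text \<open>Inclusion-exclusion: the sum is the expansion of a product over \<open>N\<close> whose
  factors are 1 on \<open>R\<close> and \<open>1 - 1\<close> outside.\<close>

lemma sum_alternating_supersets:
  assumes N: "finite N" and R: "R \<subseteq> N"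
  shows "(\<Sum>S\<in>Pow N. if R \<subseteq> S then (-1) ^ card (N - S) else 0) = (if R = N then 1 else 0 :: real)"
proof -
  have "(\<Prod>x\<in>N. 1 + (if x \<in> R then 0 else -1 :: real)) = (\<Sum>X\<in>Pow N. (\<Prod>x\<in>X. 1) * (\<Prod>x\<in>N - X. if x \<in> R then 0 else -1))"
    by (rule prod_add[OF N])
  also have "\<dots> = (\<Sum>S\<in>Pow N. if R \<subseteq> S then (-1) ^ card (N - S) else 0)"
  proof (intro sum.cong refl)
    fix X assume "X \<in> Pow N"
    show "(\<Prod>x\<in>X. 1) * (\<Prod>x\<in>N - X. if x \<in> R then 0 else -1) = (if R \<subseteq> X then (-1) ^ card (N - X) else 0 :: real)"
    proof (cases "R \<subseteq> X")
      case True
      then have "(\<Prod>x\<in>N - X. if x \<in> R then 0 else -1) = (\<Prod>x\<in>N - X. -1 :: real)"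
        by (intro prod.cong) auto
      then show ?thesis using True by simp
    next
      case False
      then have "\<exists>x\<in>N - X. (if x \<in> R then 0 else -1) = (0 :: real)" using R by auto
      then have "(\<Prod>x\<in>N - X. if x \<in> R then 0 else -1 :: real) = 0" using N by (intro prod_zero) auto
      then show ?thesis using False by simp
    qed
  qed
  also have "(\<Prod>x\<in>N. 1 + (if x \<in> R then 0 else -1 :: real)) = (if R = N then 1 else 0)"
  proof (cases "R = N")
    case False
    then have "\<exists>x\<in>N. 1 + (if x \<in> R then 0 else -1) = (0 :: real)" using R by auto
    then show ?thesis using N False prod_zero[of N "\<lambda>x. 1 + (if x \<in> R then 0 else -1 :: real)"] by simp
  qed (auto intro!: prod.neutral)
  finally show ?thesis ..
qed

text \<open>Expanding the product of sums gives a sum over maps of \<open>N\<close> into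
  \<open>S\<close>. The alternating sum over all \<open>S\<close> that contain the image cancels
  every map that is not onto \<open>N\<close>, and the surjective ones are the permutations.\<close>

lemma permanent_Ryser:
  fixes a :: "'i \<Rightarrow> 'i \<Rightarrow> real"
  assumes N: "finite N"
  shows "(\<Sum>\<pi> | \<pi> permutes N. \<Prod>i\<in>N. a (\<pi> i) i) = (\<Sum>S\<in>Pow N. (-1) ^ card (N - S) * (\<Prod>i\<in>N. \<Sum>j\<in>S. a j i))"
proof -
  let ?F = "PiE N (\<lambda>_. N)"
  let ?b = "\<lambda>\<phi>. \<Prod>i\<in>N. a (\<phi> i) i"
  have finF: "finite ?F" using N by (intro finite_PiE) auto
  have "(\<Sum>S\<in>Pow N. (-1) ^ card (N - S) * (\<Prod>i\<in>N. \<Sum>j\<in>S. a j i))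
      = (\<Sum>S\<in>Pow N. \<Sum>\<phi>\<in>?F. (if \<phi> ` N \<subseteq> S then (-1) ^ card (N - S) else 0) * ?b \<phi>)"
  proof (intro sum.cong refl)
    fix S assume S: "S \<in> Pow N"
    then have "finite S" using N finite_subset by auto
    then have "(\<Prod>i\<in>N. \<Sum>j\<in>S. a j i) = (\<Sum>\<phi>\<in>PiE N (\<lambda>_. S). ?b \<phi>)"
      using N by (subst prod_sum_PiE) auto
    also have "\<dots> = (\<Sum>\<phi>\<in>{\<phi> \<in> ?F. \<phi> ` N \<subseteq> S}. ?b \<phi>)"
      using S by (intro sum.cong) (auto simp: PiE_def Pi_def)
    also have "\<dots> = (\<Sum>\<phi>\<in>?F. if \<phi> ` N \<subseteq> S then ?b \<phi> else 0)"
      using finF by (rule sum.inter_filter)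
    finally show "(-1) ^ card (N - S) * (\<Prod>i\<in>N. \<Sum>j\<in>S. a j i)
        = (\<Sum>\<phi>\<in>?F. (if \<phi> ` N \<subseteq> S then (-1) ^ card (N - S) else 0) * ?b \<phi>)"
      by (simp add: sum_distrib_left) (intro sum.cong, auto)
  qed
  also have "\<dots> = (\<Sum>\<phi>\<in>?F. (\<Sum>S\<in>Pow N. if \<phi> ` N \<subseteq> S then (-1) ^ card (N - S) else 0) * ?b \<phi>)"
    by (subst sum.swap) (simp add: sum_distrib_right)
  also have "\<dots> = (\<Sum>\<phi>\<in>?F. if \<phi> ` N = N then ?b \<phi> else 0)"
    by (intro sum.cong refl, subst sum_alternating_supersets[OF N]) auto
  also have "\<dots> = (\<Sum>\<phi>\<in>{\<phi> \<in> ?F. \<phi> ` N = N}. ?b \<phi>)"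
    using finF by (rule sum.inter_filter[symmetric])
  also have "\<dots> = (\<Sum>\<pi> | \<pi> permutes N. ?b \<pi>)"
  \<comment> \<open>Elements of \<open>PiE\<close> are \<open>undefined\<close> outside
    \<open>N\<close>, permutations are the identity there; the witnesses translate.\<close>
  proof (rule sum.reindex_bij_witness[where j = "\<lambda>\<phi> x. if x \<in> N then \<phi> x else x" and i = "\<lambda>\<pi>. restrict \<pi> N"])
    fix \<phi> assume "\<phi> \<in> {\<phi> \<in> ?F. \<phi> ` N = N}"
    then have "\<phi> \<in> ?F" and im: "\<phi> ` N = N" by auto
    then have "bij_betw \<phi> N N" using N by (simp add: bij_betw_def eq_card_imp_inj_on)
    then have "bij_betw (\<lambda>x. if x \<in> N then \<phi> x else x) N N"
      by (subst bij_betw_cong[of N _ \<phi>]) auto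
    then show "(\<lambda>x. if x \<in> N then \<phi> x else x) \<in> {\<pi>. \<pi> permutes N}"
      by (auto intro: bij_imp_permutes)
  qed (auto simp: permutes_in_image permutes_image permutes_not_in PiE_def extensional_def fun_eq_iff intro!: prod.cong)
  finally show ?thesis ..
qed

context hilbert_tensor_power
begin

lemma inner_powers: "tensor (replicate n h) \<bullet> tensor (replicate n k) = (h \<bullet> k) ^ n"
  by (simp add: inner_tensor)

lemma eq_0_if_orthogonal_tensors:
  assumes "\<And>ys. length ys = n \<Longrightarrow> z \<bullet> tensor ys = 0"
  shows "z = 0"
proof -
  let ?L = "{xs :: 'a list. length xs = n}"
  have "span (tensor ` ?L) \<subseteq> {x. z \<bullet> x = 0}"
    by (intro span_minimal subspace_hyperplane) (use assms in auto)
  then have "closure (span (tensor ` ?L)) \<subseteq> {x. z \<bullet> x = 0}"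
    by (intro closure_minimal closed_hyperplane)
  then have "z \<in> {x. z \<bullet> x = 0}" unfolding total by blast
  then show ?thesis by simp
qed

text \<open>Pairing with an elementary tensor turns the left side into a permanent and the right
  side into Ryser's formula for it; elementary tensors are total.\<close>

lemma polarization:
  assumes xs: "length xs = n"
  shows "(\<Sum>\<pi> | \<pi> permutes {..<n}. tensor (permute_list \<pi> xs))
       = (\<Sum>S\<in>Pow {..<n}. (-1) ^ card ({..<n} - S) *\<^sub>R tensor (replicate n (\<Sum>j\<in>S. xs ! j)))"
    (is "?l = ?r")
proof -
  have "?l - ?r = 0"
  proof (rule eq_0_if_orthogonal_tensors)
    fix ys :: "'a list" assume ys: "length ys = n"
    have "?l \<bullet> tensor ys = (\<Sum>\<pi> | \<pi> permutes {..<n}. \<Prod>i<n. (xs ! \<pi> i) \<bullet> (ys ! i))"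
      unfolding inner_sum_left using xs ys
      by (intro sum.cong refl) (auto simp: inner_tensor permute_list_nth intro!: prod.cong)
    also have "\<dots> = (\<Sum>S\<in>Pow {..<n}. (-1) ^ card ({..<n} - S) * (\<Prod>i<n. \<Sum>j\<in>S. (xs ! j) \<bullet> (ys ! i)))"
      by (rule permanent_Ryser) simp
    also have "\<dots> = ?r \<bullet> tensor ys"
      using ys by (simp add: inner_sum_left inner_tensor)
    finally show "(?l - ?r) \<bullet> tensor ys = 0" by (simp add: inner_diff_left)
  qed
  then show ?thesis by simp
qed

definition unit_powers :: "'b set" where
  "unit_powers = (\<lambda>h. tensor (replicate n h)) ` {h. norm h = 1}"

lemma tensor_scale: "tensor (replicate n (r *\<^sub>R h)) = r ^ n *\<^sub>R tensor (replicate n h)"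
proof -
  have "tensor (replicate n (r *\<^sub>R h)) - r ^ n *\<^sub>R tensor (replicate n h) = 0"
    by (rule eq_0_if_orthogonal_tensors) (simp add: inner_diff_left inner_tensor prod.distrib)
  then show ?thesis by simp
qed

lemma power_in_span_unit_powers:
  assumes "n \<ge> 1"
  shows "tensor (replicate n h) \<in> span unit_powers"
proof (cases "h = 0")
  case True
  have "tensor (replicate n h) = 0"
    using tensor_scale[of 0 h] assms True by (simp add: power_0_left)
  then show ?thesis by (simp add: span_zero)
next
  case False
  then have "tensor (replicate n h) = norm h ^ n *\<^sub>R tensor (replicate n (h /\<^sub>R norm h))"
    unfolding tensor_scale[symmetric] by simp
  moreover have "tensor (replicate n (h /\<^sub>R norm h)) \<in> unit_powers"
    using False by (auto simp: unit_powers_def)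
  ultimately show ?thesis by (simp add: span_base span_scale)
qed

lemma symmetrized_in_span_unit_powers:
  assumes "n \<ge> 1" "length xs = n"
  shows "(\<Sum>\<pi> | \<pi> permutes {..<n}. tensor (permute_list \<pi> xs)) \<in> span unit_powers"
  unfolding polarization[OF assms(2)]
  by (intro span_sum span_scale power_in_span_unit_powers assms)

text \<open>Permuting the factors in an approximant \<open>y\<close> of a symmetric \<open>f\<close> does not change the distance
  to \<open>f\<close>; hence averaging over all permutations does not increase it.\<close>

lemma symmetric_approx:
  assumes n: "n \<ge> 1" and f: "f \<in> symmetric_tensors n tensor" and \<epsilon>: "\<epsilon> > 0"
  shows "\<exists>y \<in> span unit_powers. norm (f - y) < \<epsilon>"
proof -
  let ?L = "{xs :: 'a list. length xs = n}"
  let ?P = "{\<pi>. \<pi> permutes {..<n}}"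
  have finP: "finite ?P" by (rule finite_permutations) simp
  have cardP: "card ?P = fact n" by (simp add: card_permutations[of "{..<n}" n])
  have "f \<in> closure (span (tensor ` ?L))" unfolding total by simp
  then obtain y where y: "y \<in> span (tensor ` ?L)" "norm (f - y) < \<epsilon>"
    using \<epsilon> unfolding closure_approachable by (auto simp: dist_norm norm_minus_commute)
  then obtain T r where T: "finite T" "T \<subseteq> tensor ` ?L" and yT: "y = (\<Sum>t\<in>T. r t *\<^sub>R t)"
    unfolding span_explicit by auto
  obtain g where g: "\<And>t. t \<in> T \<Longrightarrow> length (g t) = n \<and> tensor (g t) = t"
  proof -
    have "\<forall>t\<in>T. \<exists>xs. length xs = n \<and> tensor xs = t" using T by auto
    then show ?thesis using that by metis
  qed
  \<comment> \<open>Only the approximant is permuted, through the chosen factors \<open>g t\<close>,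
    which avoids constructing the unitary action of a permutation on the whole space. The inner
    products \<open>fY\<close> and \<open>YY\<close> are all that the distance requires.\<close>
  define Y where "Y = (\<lambda>\<pi>. \<Sum>t\<in>T. r t *\<^sub>R tensor (permute_list \<pi> (g t)))"
  have fY: "f \<bullet> Y \<pi> = f \<bullet> y" if "\<pi> \<in> ?P" for \<pi>
    unfolding Y_def yT inner_sum_right
    using f that g by (intro sum.cong refl) (auto simp: symmetric_tensors_def)
  have YY: "Y \<pi> \<bullet> Y \<pi> = y \<bullet> y" if "\<pi> \<in> ?P" for \<pi>
  proof -
    have "tensor (permute_list \<pi> (g s)) \<bullet> tensor (permute_list \<pi> (g t)) = s \<bullet> t" if "s \<in> T" "t \<in> T" for s t
    proof -
      have "tensor (permute_list \<pi> (g s)) \<bullet> tensor (permute_list \<pi> (g t)) = (\<Prod>i<n. (g s ! \<pi> i) \<bullet> (g t ! \<pi> i))"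
        using g that \<open>\<pi> \<in> ?P\<close> by (auto simp: inner_tensor permute_list_nth intro!: prod.cong)
      also have "\<dots> = (\<Prod>i<n. (g s ! i) \<bullet> (g t ! i))"
        using \<open>\<pi> \<in> ?P\<close> by (intro prod.reindex_bij_betw[of \<pi> "{..<n}" "{..<n}" "\<lambda>i. (g s ! i) \<bullet> (g t ! i)"]) (auto intro: permutes_imp_bij)
      also have "\<dots> = s \<bullet> t"
        using g[OF that(1)] g[OF that(2)] by (metis inner_tensor)
      finally show ?thesis .
    qed
    then show ?thesis unfolding Y_def yT by (simp add: inner_sum_left inner_sum_right)
  qed
  have nY: "norm (f - Y \<pi>) = norm (f - y)" if "\<pi> \<in> ?P" for \<pi>
    unfolding norm_eq_sqrt_inner using fY[OF that] YY[OF that]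
    by (simp add: inner_diff_left inner_diff_right inner_commute)
  define z where "z = (1 / fact n) *\<^sub>R (\<Sum>\<pi>\<in>?P. Y \<pi>)"
  \<comment> \<open>After exchanging the sums the average consists of symmetrized elementary
    tensors, to which polarization applies.\<close>
  have "(\<Sum>\<pi>\<in>?P. Y \<pi>) = (\<Sum>t\<in>T. r t *\<^sub>R (\<Sum>\<pi>\<in>?P. tensor (permute_list \<pi> (g t))))"
    unfolding Y_def by (subst sum.swap) (simp add: scaleR_sum_right)
  also have "\<dots> \<in> span unit_powers"
    using g n by (intro span_sum span_scale symmetrized_in_span_unit_powers) auto
  finally have "z \<in> span unit_powers" unfolding z_def by (rule span_scale)
  have "f = (1 / fact n) *\<^sub>R (\<Sum>\<pi>\<in>?P. f)"
    by (simp add: sum_constant_scaleR cardP)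
  then have "f - z = (1 / fact n) *\<^sub>R (\<Sum>\<pi>\<in>?P. f - Y \<pi>)"
    unfolding z_def sum_subtractf scaleR_diff_right by simp
  then have "norm (f - z) \<le> (1 / fact n) * (\<Sum>\<pi>\<in>?P. norm (f - Y \<pi>))"
    by (simp add: divide_right_mono norm_sum)
  also have "\<dots> = norm (f - y)"
    using nY cardP by simp
  finally show ?thesis using \<open>z \<in> span unit_powers\<close> y(2) by (meson le_less_trans)
qed

text \<open>The tensor counterpart of \<open>hermite_sum\<close>: with equal \<open>A\<close> and
  \<open>c\<close> the two form a point of the graph whose closure defines the integral.\<close>

definition power_sum :: "'a set \<Rightarrow> ('a \<Rightarrow> real) \<Rightarrow> 'b" where
  "power_sum A c = (\<Sum>h\<in>A. c h *\<^sub>R tensor (replicate n h))"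

lemma power_sum_inner: "power_sum A c \<bullet> tensor (replicate n u) = (\<Sum>h\<in>A. c h * (h \<bullet> u) ^ n)"
  by (simp add: power_sum_def inner_sum_left inner_powers)

lemma power_sum_norm: "(norm (power_sum A c))\<^sup>2 = (\<Sum>h\<in>A. \<Sum>k\<in>A. c h * c k * (h \<bullet> k) ^ n)"
  by (simp add: power_sum_def power2_norm_eq_inner inner_sum_left inner_sum_right inner_powers inner_commute mult_ac sum_distrib_left)

lemma span_unit_powersE:
  assumes "y \<in> span unit_powers"
  obtains A c where "finite A" "\<forall>h\<in>A. norm h = 1" "y = power_sum A c"
proof -
  have "\<exists>A c. finite A \<and> (\<forall>h\<in>A. norm h = 1) \<and> y = power_sum A c"
  proof -
    obtain T r where T: "finite T" "T \<subseteq> unit_powers" and y: "y = (\<Sum>t\<in>T. r t *\<^sub>R t)"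
      using assms unfolding span_explicit by auto
    \<comment> \<open>Injectivity on \<open>A\<close> matters: for even \<open>n\<close> the vectors
      \<open>h\<close> and \<open>- h\<close> have the same power.\<close>
    obtain A where A: "A \<subseteq> {h. norm h = 1}" "inj_on (\<lambda>h. tensor (replicate n h)) A" "T = (\<lambda>h. tensor (replicate n h)) ` A"
      using T(2) unfolding unit_powers_def subset_image_inj by auto
    then have "finite A" using T(1) finite_image_iff by blast
    show ?thesis
      by (rule exI[of _ A], rule exI[of _ "\<lambda>h. r (tensor (replicate n h))"])
        (use A \<open>finite A\<close> in \<open>auto simp: y power_sum_def sum.reindex\<close>)
  qed
  then show ?thesis using that by blast
qed

end

section \<open>Multiple integrals\<close>

lemma (in prob_space) centered_gaussian_facts:
  assumes [measurable]: "X \<in> borel_measurable M" and X: "centered_gaussian M X"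
  shows "integrable M (\<lambda>\<omega>. (X \<omega>)\<^sup>2)"
    and "(\<integral>\<omega>. cis (X \<omega>) \<partial>M) = of_real (exp (- expectation (\<lambda>\<omega>. (X \<omega>)\<^sup>2) / 2))"
proof -
  have "integrable M (\<lambda>\<omega>. (X \<omega>)\<^sup>2) \<and>
    (\<integral>\<omega>. cis (X \<omega>) \<partial>M) = of_real (exp (- expectation (\<lambda>\<omega>. (X \<omega>)\<^sup>2) / 2))"
    using X unfolding centered_gaussian_def
  proof
    assume 0: "AE \<omega> in M. X \<omega> = 0"
    have "integrable M (\<lambda>\<omega>. (X \<omega>)\<^sup>2) \<longleftrightarrow> integrable M (\<lambda>_. 0 :: real)"
      by (rule integrable_cong_AE) (use 0 in auto)
    moreover have "expectation (\<lambda>\<omega>. (X \<omega>)\<^sup>2) = expectation (\<lambda>_. 0)"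
      by (rule integral_cong_AE) (use 0 in auto)
    moreover have "(\<integral>\<omega>. cis (X \<omega>) \<partial>M) = (\<integral>\<omega>. 1 \<partial>M)"
      by (rule integral_cong_AE) (use 0 in \<open>auto elim!: eventually_mono\<close>)
    ultimately show ?thesis by (simp add: prob_space)
  next
    assume "\<exists>\<sigma>>0. distributed M lborel X (normal_density 0 \<sigma>)"
    then obtain \<sigma> where \<sigma>: "\<sigma> > 0" "distributed M lborel X (normal_density 0 \<sigma>)" by auto
    have int: "integrable M (\<lambda>\<omega>. (X \<omega>)\<^sup>2)"
      using distributed_integrable[OF \<sigma>(2), of "\<lambda>x. x\<^sup>2"] integrable_normal_moment[OF \<sigma>(1), of 0 2]
      by simp
    have var: "expectation (\<lambda>\<omega>. (X \<omega>)\<^sup>2) = \<sigma>\<^sup>2"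
      using normal_distributed_variance[OF \<sigma>] normal_distributed_expectation[OF \<sigma>] by simp
    have "distributed M lborel (\<lambda>\<omega>. X \<omega> / \<sigma>) std_normal_density"
      using normal_standard_normal_convert[OF \<sigma>(1), of X 0] \<sigma>(2) by simp
    then have law: "distr M lborel (\<lambda>\<omega>. X \<omega> / \<sigma>) = std_normal_distribution"
      by (simp add: distributed_def)
    have "(\<integral>\<omega>. cis (X \<omega>) \<partial>M) = (\<integral>\<omega>. cis (\<sigma> * (X \<omega> / \<sigma>)) \<partial>M)"
      using \<sigma>(1) by simp
    also have "\<dots> = (\<integral>x. cis (\<sigma> * x) \<partial>distr M lborel (\<lambda>\<omega>. X \<omega> / \<sigma>))"
      by (rule integral_distr[symmetric]) auto
    also have "\<dots> = of_real (exp (- \<sigma>\<^sup>2 / 2))"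
      unfolding law std_normal_cis ..
    finally show ?thesis using int var by simp
  qed
  then show "integrable M (\<lambda>\<omega>. (X \<omega>)\<^sup>2)"
    and "(\<integral>\<omega>. cis (X \<omega>) \<partial>M) = of_real (exp (- expectation (\<lambda>\<omega>. (X \<omega>)\<^sup>2) / 2))" by auto
qed

text \<open>A centered Gaussian characteristic function is determined by the second moment, which
  for a linear combination of the \<open>W h\<close> is computed from the covariances.\<close>

lemma (in isonormal_process) gaussian_field: "gaussian_field M W"
proof
  show meas: "W h \<in> borel_measurable M" for h by (rule measurable_W)
  note [measurable] = meas
  fix J :: "'a set" and c :: "'a \<Rightarrow> real" assume J: "finite J"
  have sq: "integrable M (\<lambda>\<omega>. (W h \<omega>)\<^sup>2)" for h
    using centered_gaussian_facts(1)[OF _ gaussian_family[of "{h}" "\<lambda>_. 1"]] by simp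
  have int: "integrable M (\<lambda>\<omega>. W h \<omega> * W k \<omega>)" for h k
    by (rule integrable_mult_of_squares) (use sq in auto)
  have "expectation (\<lambda>\<omega>. (\<Sum>h\<in>J. c h * W h \<omega>)\<^sup>2) = expectation (\<lambda>\<omega>. \<Sum>h\<in>J. \<Sum>k\<in>J. (c h * c k) * (W h \<omega> * W k \<omega>))"
    by (simp add: power2_eq_square sum_product mult_ac)
  also have "\<dots> = (\<Sum>h\<in>J. \<Sum>k\<in>J. (c h * c k) * (h \<bullet> k))"
    using int by (simp add: Bochner_Integration.integral_sum Bochner_Integration.integrable_sum covariance_W)
  also have "\<dots> = (norm (\<Sum>h\<in>J. c h *\<^sub>R h))\<^sup>2"
    by (simp add: power2_norm_eq_inner inner_sum_left inner_sum_right inner_commute mult_ac sum_distrib_left)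
  finally show "(\<integral>\<omega>. cis (\<Sum>h\<in>J. c h * W h \<omega>) \<partial>M) = of_real (exp (- (norm (\<Sum>h\<in>J. c h *\<^sub>R h))\<^sup>2 / 2))"
    using centered_gaussian_facts(2)[OF _ gaussian_family[OF J, of c]] by simp
qed

text \<open>Completeness of \<open>L^2\<close> for rapidly Cauchy sequences: the differences of
  neighbours are summable in \<open>L^1\<close>, so the sequence converges almost surely, and
  Fatou's lemma carries the \<open>L^2\<close> bounds to the limit.\<close>

lemma (in prob_space) L2_limit:
  fixes X :: "nat \<Rightarrow> 'a \<Rightarrow> real"
  assumes [measurable]: "\<And>j. X j \<in> borel_measurable M"
    and int: "\<And>j k. integrable M (\<lambda>\<omega>. (X j \<omega> - X k \<omega>)\<^sup>2)"
    and bound: "\<And>j k. k \<le> j \<Longrightarrow> expectation (\<lambda>\<omega>. (X j \<omega> - X k \<omega>)\<^sup>2) \<le> C * (1 / 4) ^ k"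
  obtains Y where "Y \<in> borel_measurable M"
    and "\<And>k. integrable M (\<lambda>\<omega>. (Y \<omega> - X k \<omega>)\<^sup>2)"
    and "\<And>k. expectation (\<lambda>\<omega>. (Y \<omega> - X k \<omega>)\<^sup>2) \<le> C * (1 / 4) ^ k"
proof -
  have C: "C \<ge> 0" using bound[of 0 0] by simp
  define D where "D = (\<lambda>j \<omega>. \<bar>X (Suc j) \<omega> - X j \<omega>\<bar>)"
  have [measurable]: "D j \<in> borel_measurable M" for j unfolding D_def by measurable
  have D: "(\<integral>\<^sup>+\<omega>. ennreal (D j \<omega>) \<partial>M) \<le> ennreal ((C + 1) * (1 / 2) ^ j)" for j
  proof -
    \<comment> \<open>The weight \<open>2^j\<close> balances the two terms: with second moments of
      order \<open>4^(-j)\<close> both are of order \<open>2^(-j)\<close>.\<close>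
    have le: "\<bar>a\<bar> \<le> 2 ^ j * a\<^sup>2 + (1 / 2) ^ j" for a :: real
    proof -
      have "0 \<le> (2 ^ j * \<bar>a\<bar> - 1)\<^sup>2" by simp
      then have "2 * 2 ^ j * \<bar>a\<bar> \<le> 2 ^ j * (2 ^ j * a\<^sup>2) + 1"
        by (simp add: power2_eq_square algebra_simps)
      moreover have "2 ^ j * (1 / 2 :: real) ^ j = 1" by (simp add: power_mult_distrib[symmetric])
      ultimately have "2 ^ j * (2 * \<bar>a\<bar>) \<le> 2 ^ j * (2 ^ j * a\<^sup>2 + (1 / 2) ^ j)"
        by (simp add: algebra_simps)
      then have "2 * \<bar>a\<bar> \<le> 2 ^ j * a\<^sup>2 + (1 / 2) ^ j" by simp
      then show ?thesis by linarith
    qed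
    have "(\<integral>\<^sup>+\<omega>. ennreal (D j \<omega>) \<partial>M) \<le> (\<integral>\<^sup>+\<omega>. ennreal (2 ^ j * (X (Suc j) \<omega> - X j \<omega>)\<^sup>2 + (1 / 2) ^ j) \<partial>M)"
      using le by (intro nn_integral_mono ennreal_leI) (auto simp: D_def)
    also have "\<dots> = ennreal (2 ^ j * expectation (\<lambda>\<omega>. (X (Suc j) \<omega> - X j \<omega>)\<^sup>2) + (1 / 2) ^ j)"
      using int[of "Suc j" j] by (subst nn_integral_eq_integral) (auto simp: prob_space)
    also have "\<dots> \<le> ennreal (2 ^ j * (C * (1 / 4) ^ j) + (1 / 2) ^ j)"
      using bound[of j "Suc j"] by (intro ennreal_leI add_right_mono mult_left_mono) auto
    also have "2 ^ j * (C * (1 / 4) ^ j) + (1 / 2) ^ j = (C + 1) * (1 / 2) ^ j"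
    proof -
      have "(4 :: real) ^ j = 2 ^ j * 2 ^ j" by (simp flip: power_mult_distrib)
      then show ?thesis by (simp add: power_divide field_simps)
    qed
    finally show ?thesis .
  qed
  have "(\<integral>\<^sup>+\<omega>. (\<Sum>j. ennreal (D j \<omega>)) \<partial>M) = (\<Sum>j. \<integral>\<^sup>+\<omega>. ennreal (D j \<omega>) \<partial>M)"
    by (rule nn_integral_suminf) measurable
  also have "\<dots> \<le> (\<Sum>j. ennreal ((C + 1) * (1 / 2) ^ j))"
    by (intro suminf_le D) auto
  also have "\<dots> = ennreal (\<Sum>j. (C + 1) * (1 / 2) ^ j)"
    using C by (intro suminf_ennreal2 summable_mult summable_geometric) auto
  also have "\<dots> < \<infinity>" by simp
  finally have "AE \<omega> in M. (\<Sum>j. ennreal (D j \<omega>)) \<noteq> \<infinity>"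
    by (intro nn_integral_noteq_infinite) auto
  then have conv: "AE \<omega> in M. convergent (\<lambda>j. X j \<omega>)"
  proof eventually_elim
    case (elim \<omega>)
    then have "summable (\<lambda>j. D j \<omega>)"
      by (intro summable_suminf_not_top) (auto simp: D_def)
    then have "summable (\<lambda>j. X (Suc j) \<omega> - X j \<omega>)"
      unfolding D_def by (rule summable_rabs_cancel)
    then have "convergent (\<lambda>j. X j \<omega> - X 0 \<omega>)"
      unfolding summable_iff_convergent
      using sum_lessThan_telescope[of "\<lambda>i. X i \<omega>"] by simp
    then have "convergent (\<lambda>j. (X j \<omega> - X 0 \<omega>) + X 0 \<omega>)"
      by (intro convergent_add convergent_const)
    then show ?case by simp
  qed
  define Y where "Y = (\<lambda>\<omega>. lim (\<lambda>j. X j \<omega>))"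
  have [measurable]: "Y \<in> borel_measurable M" unfolding Y_def by measurable
  have nn: "(\<integral>\<^sup>+\<omega>. ennreal ((Y \<omega> - X k \<omega>)\<^sup>2) \<partial>M) \<le> ennreal (C * (1 / 4) ^ k)" for k
  proof -
    have "(\<integral>\<^sup>+\<omega>. ennreal ((Y \<omega> - X k \<omega>)\<^sup>2) \<partial>M) = (\<integral>\<^sup>+\<omega>. liminf (\<lambda>j. ennreal ((X j \<omega> - X k \<omega>)\<^sup>2)) \<partial>M)"
    proof (rule nn_integral_cong_AE)
      show "AE \<omega> in M. ennreal ((Y \<omega> - X k \<omega>)\<^sup>2) = liminf (\<lambda>j. ennreal ((X j \<omega> - X k \<omega>)\<^sup>2))"
        using conv
      proof eventually_elim
        case (elim \<omega>)
        then have "(\<lambda>j. X j \<omega>) \<longlonglongrightarrow> Y \<omega>" by (simp add: Y_def convergent_LIMSEQ_iff)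
        then have "(\<lambda>j. ennreal ((X j \<omega> - X k \<omega>)\<^sup>2)) \<longlonglongrightarrow> ennreal ((Y \<omega> - X k \<omega>)\<^sup>2)"
          by (intro tendsto_ennrealI tendsto_intros)
        then show ?case by (intro lim_imp_Liminf[symmetric]) auto
      qed
    qed
    also have "\<dots> \<le> liminf (\<lambda>j. \<integral>\<^sup>+\<omega>. ennreal ((X j \<omega> - X k \<omega>)\<^sup>2) \<partial>M)"
      by (rule nn_integral_liminf) measurable
    also have "\<dots> \<le> ennreal (C * (1 / 4) ^ k)"
    proof (rule Liminf_le)
      show "\<forall>\<^sub>F j in sequentially. (\<integral>\<^sup>+\<omega>. ennreal ((X j \<omega> - X k \<omega>)\<^sup>2) \<partial>M) \<le> ennreal (C * (1 / 4) ^ k)"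
        using eventually_ge_at_top[of k]
      proof eventually_elim
        case (elim j)
        then show ?case
          using int[of j k] bound[of k j] by (subst nn_integral_eq_integral) (auto intro: ennreal_leI)
      qed
    qed simp
    finally show ?thesis .
  qed
  have intY: "integrable M (\<lambda>\<omega>. (Y \<omega> - X k \<omega>)\<^sup>2)" for k
    by (rule integrableI_bounded) (use nn[of k] in \<open>auto intro: le_less_trans\<close>)
  moreover have "expectation (\<lambda>\<omega>. (Y \<omega> - X k \<omega>)\<^sup>2) \<le> C * (1 / 4) ^ k" for k
    using nn[of k] C intY[of k] by (subst (asm) nn_integral_eq_integral) auto
  ultimately show ?thesis using that[of Y] by simp
qed

text \<open>The constant 2 from (x + y)^2 \<le> 2 x^2 + 2 y^2 stands in for Minkowski's inequality;
  only limits at 0 matter below.\<close>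

lemma (in prob_space) L2_triangle:
  fixes X Y Z :: "'a \<Rightarrow> real"
  assumes [measurable]: "X \<in> borel_measurable M" "Y \<in> borel_measurable M"
    and X: "integrable M (\<lambda>\<omega>. (X \<omega>)\<^sup>2)" and Y: "integrable M (\<lambda>\<omega>. (Y \<omega>)\<^sup>2)"
  shows "integrable M (\<lambda>\<omega>. (X \<omega> + Y \<omega>)\<^sup>2)"
    and "expectation (\<lambda>\<omega>. (X \<omega> + Y \<omega>)\<^sup>2) \<le> 2 * expectation (\<lambda>\<omega>. (X \<omega>)\<^sup>2) + 2 * expectation (\<lambda>\<omega>. (Y \<omega>)\<^sup>2)"
proof -
  have le: "(x + y)\<^sup>2 \<le> 2 * x\<^sup>2 + 2 * y\<^sup>2" for x y :: real
    using sum_squares_bound[of x y] by (simp add: power2_sum)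
  show i: "integrable M (\<lambda>\<omega>. (X \<omega> + Y \<omega>)\<^sup>2)"
    by (rule Bochner_Integration.integrable_bound[of _ "\<lambda>\<omega>. 2 * (X \<omega>)\<^sup>2 + 2 * (Y \<omega>)\<^sup>2"])
      (use X Y le in auto)
  have "expectation (\<lambda>\<omega>. (X \<omega> + Y \<omega>)\<^sup>2) \<le> expectation (\<lambda>\<omega>. 2 * (X \<omega>)\<^sup>2 + 2 * (Y \<omega>)\<^sup>2)"
    using X Y le i by (intro integral_mono) auto
  then show "expectation (\<lambda>\<omega>. (X \<omega> + Y \<omega>)\<^sup>2) \<le> 2 * expectation (\<lambda>\<omega>. (X \<omega>)\<^sup>2) + 2 * expectation (\<lambda>\<omega>. (Y \<omega>)\<^sup>2)"
    using X Y by simp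
qed

lemma sum_scaleR_combine:
  fixes v :: "'x \<Rightarrow> 'v::real_vector"
  assumes "finite A" "finite B"
  shows "s *\<^sub>R (\<Sum>h\<in>A. c h *\<^sub>R v h) + t *\<^sub>R (\<Sum>h\<in>B. d h *\<^sub>R v h)
    = (\<Sum>h\<in>A \<union> B. (s * (if h \<in> A then c h else 0) + t * (if h \<in> B then d h else 0)) *\<^sub>R v h)"
proof -
  have "(\<Sum>h\<in>A. c h *\<^sub>R v h) = (\<Sum>h\<in>A \<union> B. (if h \<in> A then c h else 0) *\<^sub>R v h)"
    "(\<Sum>h\<in>B. d h *\<^sub>R v h) = (\<Sum>h\<in>A \<union> B. (if h \<in> B then d h else 0) *\<^sub>R v h)"
    using assms by (auto intro!: sum.mono_neutral_cong_left)
  then show ?thesis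
    by (simp only: scaleR_sum_right scaleR_add_left sum.distrib scaleR_scaleR)
qed

section \<open>Existence, mean and linear relations of representing variables\<close>

locale chaos = gaussian_field M W + hilbert_tensor_power n tensor
  for M :: "'w measure" and W :: "'a::real_inner \<Rightarrow> 'w \<Rightarrow> real"
    and n :: nat and tensor :: "'a list \<Rightarrow> 'b::{real_inner, complete_space}" +
  assumes n: "n \<ge> 1"
begin

abbreviation represents :: "'b \<Rightarrow> ('w \<Rightarrow> real) \<Rightarrow> bool" where
  "represents \<equiv> represents_multiple_integral M W n tensor"

lemma represents_iff:
  "represents f X \<longleftrightarrow> X \<in> borel_measurable M \<and> integrable M (\<lambda>\<omega>. (X \<omega>)\<^sup>2) \<and>
     (\<forall>\<epsilon>>0. \<exists>A c. finite A \<and> (\<forall>h\<in>A. norm h = 1) \<and> norm (f - power_sum A c) < \<epsilon> \<and>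
        expectation (\<lambda>\<omega>. (X \<omega> - hermite_sum n A c \<omega>)\<^sup>2) < \<epsilon>)"
  unfolding represents_multiple_integral_def power_sum_def hermite_sum_def ..

lemma hermite_sum_isometry:
  assumes "finite A" "\<forall>h\<in>A. norm h = 1"
  shows "expectation (\<lambda>\<omega>. (hermite_sum n A c \<omega>)\<^sup>2) = fact n * (norm (power_sum A c))\<^sup>2"
  unfolding power_sum_norm by (rule hermite_sum_square(2)[OF assms])

text \<open>One and the same \<open>e\<close> serves both identities, so linear combinations stay in
  the graph of the integral and the isometry applies to them.\<close>

lemma hermite_sum_linear_combination:
  assumes "finite A" "\<forall>h\<in>A. norm h = 1" "finite B" "\<forall>h\<in>B. norm h = 1"
  shows "\<exists>e. finite (A \<union> B) \<and> (\<forall>h\<in>A \<union> B. norm h = 1) \<and>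
    s *\<^sub>R power_sum A c + t *\<^sub>R power_sum B d = power_sum (A \<union> B) e \<and>
    (\<forall>\<omega>. s * hermite_sum n A c \<omega> + t * hermite_sum n B d \<omega> = hermite_sum n (A \<union> B) e \<omega>)"
proof (intro exI conjI allI)
  let ?e = "\<lambda>h. s * (if h \<in> A then c h else 0) + t * (if h \<in> B then d h else 0)"
  show "s *\<^sub>R power_sum A c + t *\<^sub>R power_sum B d = power_sum (A \<union> B) ?e"
    unfolding power_sum_def by (rule sum_scaleR_combine[OF assms(1,3)])
  show "s * hermite_sum n A c \<omega> + t * hermite_sum n B d \<omega> = hermite_sum n (A \<union> B) ?e \<omega>" for \<omega>
    unfolding hermite_sum_def
    using sum_scaleR_combine[OF assms(1,3), of s c "\<lambda>h. hermite n (W h \<omega>)" t d] by simp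
qed (use assms in auto)

text \<open>The isometry turns approximating power sums into an \<open>L^2\<close> Cauchy sequence
  of Hermite sums. This makes the choice in \<open>multiple_integral\<close> meaningful.\<close>

lemma represents_ex:
  assumes f: "f \<in> symmetric_tensors n tensor"
  shows "\<exists>X. represents f X"
proof -
  have "\<exists>A c. finite A \<and> (\<forall>h\<in>A. norm h = 1) \<and> norm (f - power_sum A c) < (1 / 2) ^ j" for j
  proof -
    obtain y where "y \<in> span unit_powers" "norm (f - y) < (1 / 2) ^ j"
      using symmetric_approx[OF n f, of "(1 / 2) ^ j"] by auto
    then show ?thesis by (metis span_unit_powersE)
  qed
  then obtain A c where A: "finite (A j)" "\<forall>h\<in>A j. norm h = 1"
    and near: "norm (f - power_sum (A j) (c j)) < (1 / 2) ^ j" for j :: nat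
    by metis
  have diff: "integrable M (\<lambda>\<omega>. (hermite_sum n (A j) (c j) \<omega> - hermite_sum n (A k) (c k) \<omega>)\<^sup>2) \<and>
    expectation (\<lambda>\<omega>. (hermite_sum n (A j) (c j) \<omega> - hermite_sum n (A k) (c k) \<omega>)\<^sup>2)
      = fact n * (norm (power_sum (A j) (c j) - power_sum (A k) (c k)))\<^sup>2" for j k
  proof -
    obtain e where e: "finite (A j \<union> A k)" "\<forall>h\<in>A j \<union> A k. norm h = 1"
      "1 *\<^sub>R power_sum (A j) (c j) + (-1) *\<^sub>R power_sum (A k) (c k) = power_sum (A j \<union> A k) e"
      "\<And>\<omega>. 1 * hermite_sum n (A j) (c j) \<omega> + (-1) * hermite_sum n (A k) (c k) \<omega> = hermite_sum n (A j \<union> A k) e \<omega>"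
      using hermite_sum_linear_combination[OF A(1)[of j] A(2)[of j] A(1)[of k] A(2)[of k], where s = 1 and t = "-1" and c = "c j" and d = "c k"] by blast
    then show ?thesis
      using hermite_sum_isometry[OF e(1,2), of e] hermite_sum_square(1)[OF e(1,2), of n e] by simp
  qed
  obtain X where X: "X \<in> borel_measurable M"
    "\<And>k. integrable M (\<lambda>\<omega>. (X \<omega> - hermite_sum n (A k) (c k) \<omega>)\<^sup>2)"
    "\<And>k. expectation (\<lambda>\<omega>. (X \<omega> - hermite_sum n (A k) (c k) \<omega>)\<^sup>2) \<le> (fact n * 4) * (1 / 4) ^ k"
  \<comment> \<open>The isometry contributes \<open>fact n\<close>; the squared distance of two
    power sums is at most \<open>(2 * (1 / 2) ^ k)^2\<close>, whence the factor 4.\<close>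
  proof (rule L2_limit[of "\<lambda>j. hermite_sum n (A j) (c j)" "fact n * 4"])
    fix j k :: nat assume "k \<le> j"
    have "norm (power_sum (A j) (c j) - power_sum (A k) (c k)) \<le> norm (f - power_sum (A k) (c k)) + norm (f - power_sum (A j) (c j))"
      using norm_triangle_ineq4[of "f - power_sum (A k) (c k)" "f - power_sum (A j) (c j)"] by simp
    also have "\<dots> \<le> (1 / 2) ^ k + (1 / 2) ^ j"
      using near[of j] near[of k] by linarith
    also have "\<dots> \<le> 2 * (1 / 2) ^ k"
      using power_decreasing[OF \<open>k \<le> j\<close>, of "1 / 2 :: real"] by simp
    finally have "(norm (power_sum (A j) (c j) - power_sum (A k) (c k)))\<^sup>2 \<le> (2 * (1 / 2) ^ k)\<^sup>2"
      by (intro power_mono) auto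
    also have "\<dots> = 4 * (1 / 4) ^ k"
    proof -
      have "(1 / 4 :: real) ^ k = (1 / 2) ^ k * (1 / 2) ^ k" by (simp flip: power_mult_distrib)
      then show ?thesis by (simp add: power2_eq_square)
    qed
    finally show "expectation (\<lambda>\<omega>. (hermite_sum n (A j) (c j) \<omega> - hermite_sum n (A k) (c k) \<omega>)\<^sup>2) \<le> (fact n * 4) * (1 / 4) ^ k"
      using diff[of j k] by simp
  qed (use diff in auto)
  note [measurable] = X(1)
  have "integrable M (\<lambda>\<omega>. ((X \<omega> - hermite_sum n (A 0) (c 0) \<omega>) + hermite_sum n (A 0) (c 0) \<omega>)\<^sup>2)"
    using X(2) hermite_sum_square(1)[OF A] by (intro L2_triangle) auto
  then have intX: "integrable M (\<lambda>\<omega>. (X \<omega>)\<^sup>2)" by simp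
  have "represents f X"
    unfolding represents_iff
  proof (intro conjI allI impI X(1) intX)
    fix \<epsilon> :: real assume \<epsilon>: "\<epsilon> > 0"
    have "(\<lambda>k. (1 / 2 :: real) ^ k) \<longlonglongrightarrow> 0" "(\<lambda>k. (fact n * 4) * (1 / 4 :: real) ^ k) \<longlonglongrightarrow> 0"
      by (auto intro!: LIMSEQ_power_zero tendsto_mult_right_zero)
    then have "\<forall>\<^sub>F k in sequentially. (1 / 2 :: real) ^ k < \<epsilon>" "\<forall>\<^sub>F k in sequentially. (fact n * 4) * (1 / 4 :: real) ^ k < \<epsilon>"
      using \<epsilon> by (blast dest: order_tendstoD(2))+
    then have "\<forall>\<^sub>F k in sequentially. (1 / 2 :: real) ^ k < \<epsilon> \<and> (fact n * 4) * (1 / 4 :: real) ^ k < \<epsilon>"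
      by eventually_elim auto
    then obtain k where "(1 / 2 :: real) ^ k < \<epsilon>" "(fact n * 4) * (1 / 4 :: real) ^ k < \<epsilon>"
      by (auto simp: eventually_sequentially)
    then show "\<exists>A c. finite A \<and> (\<forall>h\<in>A. norm h = 1) \<and> norm (f - power_sum A c) < \<epsilon> \<and>
        expectation (\<lambda>\<omega>. (X \<omega> - hermite_sum n A c \<omega>)\<^sup>2) < \<epsilon>"
      using A[of k] near[of k] X(3)[of k] by (intro exI[of _ "A k"] exI[of _ "c k"]) auto
  qed
  then show ?thesis by blast
qed

lemma represents_cong:
  assumes "represents f X" "Y \<in> borel_measurable M" "AE \<omega> in M. Y \<omega> = X \<omega>"
  shows "represents f Y"
proof -
  have [measurable]: "X \<in> borel_measurable M" "Y \<in> borel_measurable M" using assms by (auto simp: represents_iff)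
  have "integrable M (\<lambda>\<omega>. (Y \<omega>)\<^sup>2) = integrable M (\<lambda>\<omega>. (X \<omega>)\<^sup>2)"
    using assms(3) by (intro integrable_cong_AE) auto
  moreover have "expectation (\<lambda>\<omega>. (Y \<omega> - hermite_sum n A c \<omega>)\<^sup>2) = expectation (\<lambda>\<omega>. (X \<omega> - hermite_sum n A c \<omega>)\<^sup>2)" for A c
    using assms(3) by (intro integral_cong_AE) auto
  ultimately show ?thesis using assms(1,2) unfolding represents_iff by simp
qed

text \<open>From here on only \<open>represents\<close> is used, so the version selected by the
  choice operator is irrelevant.\<close>

lemma represents_multiple_integral:
  assumes "f \<in> symmetric_tensors n tensor" "X \<in> borel_measurable M"
    "AE \<omega> in M. X \<omega> = multiple_integral M W n tensor f \<omega>"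
  shows "represents f X"
  using represents_cong[OF _ assms(2,3)] someI_ex[OF represents_ex[OF assms(1)]]
  by (simp add: multiple_integral_def)

lemma representsE:
  assumes "represents f X"
  obtains A c where "\<And>j::nat. finite (A j)" "\<And>j. \<forall>h\<in>A j. norm h = 1"
    "(\<lambda>j. power_sum (A j) (c j)) \<longlonglongrightarrow> f"
    "\<And>j. integrable M (\<lambda>\<omega>. (X \<omega> - hermite_sum n (A j) (c j) \<omega>)\<^sup>2)"
    "(\<lambda>j. expectation (\<lambda>\<omega>. (X \<omega> - hermite_sum n (A j) (c j) \<omega>)\<^sup>2)) \<longlonglongrightarrow> 0"
proof -
  have [measurable]: "X \<in> borel_measurable M" using assms by (simp add: represents_iff)
  define Q where "Q = (\<lambda>j A c. finite A \<and> (\<forall>h\<in>A. norm h = 1) \<and> norm (f - power_sum A c) < inverse (real (Suc j)) \<and>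
        expectation (\<lambda>\<omega>. (X \<omega> - hermite_sum n A c \<omega>)\<^sup>2) < inverse (real (Suc j)))"
  have "\<exists>A c. Q j A c" for j
    using assms[unfolded represents_iff, THEN conjunct2, THEN conjunct2, rule_format, of "inverse (real (Suc j))"]
    by (simp add: Q_def)
  then obtain A c where "\<And>j. Q j (A j) (c j)"
    by metis
  then have A: "finite (A j)" "\<forall>h\<in>A j. norm h = 1"
    and near: "norm (f - power_sum (A j) (c j)) < inverse (real (Suc j))"
    and E: "expectation (\<lambda>\<omega>. (X \<omega> - hermite_sum n (A j) (c j) \<omega>)\<^sup>2) < inverse (real (Suc j))" for j
    by (auto simp: Q_def)
  show ?thesis
  proof (rule that[of A c])
    have "(\<lambda>j. norm (f - power_sum (A j) (c j))) \<longlonglongrightarrow> 0"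
      by (rule tendsto_sandwich[OF _ _ tendsto_const LIMSEQ_inverse_real_of_nat])
        (use near in \<open>auto intro!: always_eventually less_imp_le\<close>)
    then show "(\<lambda>j. power_sum (A j) (c j)) \<longlonglongrightarrow> f"
      by (subst Lim_null, subst tendsto_norm_zero_iff[symmetric], subst norm_minus_commute)
    show "integrable M (\<lambda>\<omega>. (X \<omega> - hermite_sum n (A j) (c j) \<omega>)\<^sup>2)" for j
      using L2_triangle(1)[of X "\<lambda>\<omega>. - hermite_sum n (A j) (c j) \<omega>"] assms hermite_sum_square(1)[OF A, of n j "c j"]
      by (simp add: represents_iff)
    show "(\<lambda>j. expectation (\<lambda>\<omega>. (X \<omega> - hermite_sum n (A j) (c j) \<omega>)\<^sup>2)) \<longlonglongrightarrow> 0"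
      by (rule tendsto_sandwich[OF _ _ tendsto_const LIMSEQ_inverse_real_of_nat])
        (use E in \<open>auto intro!: always_eventually less_imp_le\<close>)
  qed (use A in auto)
qed

text \<open>Hermite sums have mean 0 because \<open>n\<close> is positive; the square of a mean is
  at most the second moment, so the mean of \<open>X\<close> is 0 in the limit.\<close>

lemma represents_expectation:
  assumes "represents f X"
  shows "integrable M X" "expectation X = 0"
proof -
  have [measurable]: "X \<in> borel_measurable M" and X2: "integrable M (\<lambda>\<omega>. (X \<omega>)\<^sup>2)"
    using assms by (auto simp: represents_iff)
  show X1: "integrable M X" using X2 by (rule square_integrable_imp_integrable[rotated]) simp
  obtain A c where A: "\<And>j::nat. finite (A j)" "\<And>j. \<forall>h\<in>A j. norm h = 1"
    and "(\<lambda>j. power_sum (A j) (c j)) \<longlonglongrightarrow> f"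
    and int: "\<And>j. integrable M (\<lambda>\<omega>. (X \<omega> - hermite_sum n (A j) (c j) \<omega>)\<^sup>2)"
    and lim: "(\<lambda>j. expectation (\<lambda>\<omega>. (X \<omega> - hermite_sum n (A j) (c j) \<omega>)\<^sup>2)) \<longlonglongrightarrow> 0"
    using representsE[OF assms] by blast
  have "(expectation X)\<^sup>2 \<le> expectation (\<lambda>\<omega>. (X \<omega> - hermite_sum n (A j) (c j) \<omega>)\<^sup>2)" for j
  proof -
    let ?Z = "\<lambda>\<omega>. X \<omega> - hermite_sum n (A j) (c j) \<omega>"
    have Z: "integrable M ?Z" using X1 integrable_hermite_sum[OF A(2)] by auto
    have "expectation ?Z = expectation X"
      using X1 integrable_hermite_sum[OF A(2)] expectation_hermite_sum[OF A(2) n] by simp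
    moreover have "(expectation ?Z)\<^sup>2 \<le> expectation (\<lambda>\<omega>. (?Z \<omega>)\<^sup>2)"
      using variance_positive[of ?Z] variance_eq[OF Z int[of j]] by linarith
    ultimately show ?thesis by simp
  qed
  then have "(expectation X)\<^sup>2 \<le> 0"
    by (intro tendsto_lowerbound[OF lim]) auto
  then show "expectation X = 0" by simp
qed

text \<open>Used in contraposition: integrals that are not proportional come from independent
  tensors.\<close>

lemma represents_dependent:
  assumes X: "represents f X" and Y: "represents g Y" and fg: "a *\<^sub>R f + b *\<^sub>R g = 0"
  shows "AE \<omega> in M. a * X \<omega> + b * Y \<omega> = 0"
proof -
  have [measurable]: "X \<in> borel_measurable M" "Y \<in> borel_measurable M"
    and sq: "integrable M (\<lambda>\<omega>. (X \<omega>)\<^sup>2)" "integrable M (\<lambda>\<omega>. (Y \<omega>)\<^sup>2)"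
    using X Y by (auto simp: represents_iff)
  obtain A c where A: "\<And>j::nat. finite (A j)" "\<And>j. \<forall>h\<in>A j. norm h = 1"
    and pA: "(\<lambda>j. power_sum (A j) (c j)) \<longlonglongrightarrow> f"
    and iA: "\<And>j. integrable M (\<lambda>\<omega>. (X \<omega> - hermite_sum n (A j) (c j) \<omega>)\<^sup>2)"
    and lA: "(\<lambda>j. expectation (\<lambda>\<omega>. (X \<omega> - hermite_sum n (A j) (c j) \<omega>)\<^sup>2)) \<longlonglongrightarrow> 0"
    using representsE[OF X] by blast
  obtain B d where B: "\<And>j::nat. finite (B j)" "\<And>j. \<forall>h\<in>B j. norm h = 1"
    and pB: "(\<lambda>j. power_sum (B j) (d j)) \<longlonglongrightarrow> g"
    and iB: "\<And>j. integrable M (\<lambda>\<omega>. (Y \<omega> - hermite_sum n (B j) (d j) \<omega>)\<^sup>2)"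
    and lB: "(\<lambda>j. expectation (\<lambda>\<omega>. (Y \<omega> - hermite_sum n (B j) (d j) \<omega>)\<^sup>2)) \<longlonglongrightarrow> 0"
    using representsE[OF Y] by blast
  let ?Z = "\<lambda>\<omega>. a * X \<omega> + b * Y \<omega>"
  \<comment> \<open>Two uses of \<open>L2_triangle\<close>: the approximation errors of both
    integrals, and the isometric image of a power sum that tends to
    \<open>a f + b g = 0\<close>.\<close>
  let ?R = "\<lambda>j. 2 * (2 * (a\<^sup>2 * expectation (\<lambda>\<omega>. (X \<omega> - hermite_sum n (A j) (c j) \<omega>)\<^sup>2))
      + 2 * (b\<^sup>2 * expectation (\<lambda>\<omega>. (Y \<omega> - hermite_sum n (B j) (d j) \<omega>)\<^sup>2)))
      + 2 * (fact n * (norm (a *\<^sub>R power_sum (A j) (c j) + b *\<^sub>R power_sum (B j) (d j)))\<^sup>2)"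
  have "expectation (\<lambda>\<omega>. (?Z \<omega>)\<^sup>2) \<le> ?R j" for j
  proof -
    let ?hA = "hermite_sum n (A j) (c j)" and ?hB = "hermite_sum n (B j) (d j)"
    obtain e where e: "finite (A j \<union> B j)" "\<forall>h\<in>A j \<union> B j. norm h = 1"
      "a *\<^sub>R power_sum (A j) (c j) + b *\<^sub>R power_sum (B j) (d j) = power_sum (A j \<union> B j) e"
      "\<And>\<omega>. a * ?hA \<omega> + b * ?hB \<omega> = hermite_sum n (A j \<union> B j) e \<omega>"
      using hermite_sum_linear_combination[OF A(1)[of j] A(2)[of j] B(1)[of j] B(2)[of j], where s = a and t = b and c = "c j" and d = "d j"] by blast
    have i: "integrable M (\<lambda>\<omega>. (a * (X \<omega> - ?hA \<omega>))\<^sup>2)" "integrable M (\<lambda>\<omega>. (b * (Y \<omega> - ?hB \<omega>))\<^sup>2)"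
      using iA iB by (simp_all add: power_mult_distrib)
    have i': "integrable M (\<lambda>\<omega>. (a * (X \<omega> - ?hA \<omega>) + b * (Y \<omega> - ?hB \<omega>))\<^sup>2)"
      using i by (intro L2_triangle) auto
    have "expectation (\<lambda>\<omega>. (?Z \<omega>)\<^sup>2) = expectation (\<lambda>\<omega>. ((a * (X \<omega> - ?hA \<omega>) + b * (Y \<omega> - ?hB \<omega>)) + hermite_sum n (A j \<union> B j) e \<omega>)\<^sup>2)"
      unfolding e(4)[symmetric] by (simp add: algebra_simps)
    also have "\<dots> \<le> 2 * expectation (\<lambda>\<omega>. (a * (X \<omega> - ?hA \<omega>) + b * (Y \<omega> - ?hB \<omega>))\<^sup>2) + 2 * expectation (\<lambda>\<omega>. (hermite_sum n (A j \<union> B j) e \<omega>)\<^sup>2)"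
      using i i' hermite_sum_square(1)[OF e(1,2)] by (intro L2_triangle) auto
    also have "expectation (\<lambda>\<omega>. (a * (X \<omega> - ?hA \<omega>) + b * (Y \<omega> - ?hB \<omega>))\<^sup>2)
        \<le> 2 * expectation (\<lambda>\<omega>. (a * (X \<omega> - ?hA \<omega>))\<^sup>2) + 2 * expectation (\<lambda>\<omega>. (b * (Y \<omega> - ?hB \<omega>))\<^sup>2)"
      using i by (intro L2_triangle) auto
    also have "\<dots> = 2 * (a\<^sup>2 * expectation (\<lambda>\<omega>. (X \<omega> - ?hA \<omega>)\<^sup>2)) + 2 * (b\<^sup>2 * expectation (\<lambda>\<omega>. (Y \<omega> - ?hB \<omega>)\<^sup>2))"
      by (simp add: power_mult_distrib)
    finally show ?thesis unfolding e(3) hermite_sum_isometry[OF e(1,2)] by linarith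
  qed
  moreover have "?R \<longlonglongrightarrow> 2 * (2 * (a\<^sup>2 * 0) + 2 * (b\<^sup>2 * 0)) + 2 * (fact n * (norm (a *\<^sub>R f + b *\<^sub>R g))\<^sup>2)"
    by (intro tendsto_intros lA lB pA pB)
  ultimately have "expectation (\<lambda>\<omega>. (?Z \<omega>)\<^sup>2) \<le> 2 * (2 * (a\<^sup>2 * 0) + 2 * (b\<^sup>2 * 0)) + 2 * (fact n * (norm (a *\<^sub>R f + b *\<^sub>R g))\<^sup>2)"
    by (intro tendsto_lowerbound[where f = ?R and F = sequentially]) auto
  then have "expectation (\<lambda>\<omega>. (?Z \<omega>)\<^sup>2) \<le> 0" using fg by simp
  moreover have "0 \<le> expectation (\<lambda>\<omega>. (?Z \<omega>)\<^sup>2)" by (rule Bochner_Integration.integral_nonneg) auto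
  ultimately have "expectation (\<lambda>\<omega>. (?Z \<omega>)\<^sup>2) = 0" by simp
  moreover have "integrable M (\<lambda>\<omega>. (?Z \<omega>)\<^sup>2)"
    using L2_triangle(1)[of "\<lambda>\<omega>. a * X \<omega>" "\<lambda>\<omega>. b * Y \<omega>"] sq by (simp add: power_mult_distrib)
  ultimately show ?thesis
    by (subst (asm) integral_nonneg_eq_0_iff_AE) auto
qed

end

section \<open>Resampling two coordinates\<close>

text \<open>\<open>convergent_coeffs\<close> is applied twice, first in \<open>r\<close> for almost
  every fixed \<open>s\<close>, then in \<open>s\<close> to each coefficient. The limit is thus a
  polynomial and is attained at every point, not just almost everywhere.\<close>

lemma bipoly_convergent:
  fixes P :: "nat \<Rightarrow> nat \<Rightarrow> real poly"
  assumes deg: "\<And>j k. k \<le> n \<Longrightarrow> degree (P j k) \<le> n"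
    and conv: "AE z in lborel. convergent (\<lambda>j. bipoly n (P j) z)"
  obtains Q where "\<And>k s. k \<le> n \<Longrightarrow> (\<lambda>j. poly (P j k) s) \<longlonglongrightarrow> poly (Q k) s"
    and "\<And>z. (\<lambda>j. bipoly n (P j) z) \<longlonglongrightarrow> bipoly n Q z"
proof -
  have infinite_AE: "infinite {x. R x}" if "AE x in lborel. R x" for R :: "real \<Rightarrow> bool"
  proof
    assume "finite {x. R x}"
    then have "AE x in lborel. \<not> R x"
      by (intro AE_I'[OF finite_imp_null_set_lborel]) auto
    with that have "AE x in (lborel :: real measure). False"
      by eventually_elim auto
    then show False by (simp add: AE_iff_null null_sets_def)
  qed
  have "AE z in lborel \<Otimes>\<^sub>M lborel. convergent (\<lambda>j. bipoly n (P j) z)"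
    using conv unfolding lborel_prod .
  then have "AE r in lborel. AE s in lborel. convergent (\<lambda>j. bipoly n (P j) (r, s))"
    by (rule lborel_pair.AE_pair)
  moreover have "{z \<in> space (lborel \<Otimes>\<^sub>M lborel). convergent (\<lambda>j. bipoly n (P j) (fst z, snd z))} \<in> sets (lborel \<Otimes>\<^sub>M lborel)"
  proof -
    have "{z. convergent (\<lambda>j. bipoly n (P j) z)} \<in> sets borel"
      unfolding Cauchy_convergent_iff[symmetric] by measurable
    then show ?thesis unfolding lborel_prod by simp
  qed
  \<comment> \<open>\<open>s\<close> becomes the outer variable, because the coefficients of the
    powers of \<open>r\<close> are polynomials in \<open>s\<close>.\<close>
  ultimately have ae: "AE s in lborel. AE r in lborel. convergent (\<lambda>j. bipoly n (P j) (r, s))"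
    by (subst (asm) lborel_pair.AE_commute)
  have coeffs: "convergent (\<lambda>j. coeff (P j k) m)" if k: "k \<le> n" for k m
  proof (rule convergent_coeffs)
    show "degree (P j k) \<le> n" for j using deg k by simp
    have "{s. AE r in lborel. convergent (\<lambda>j. bipoly n (P j) (r, s))} \<subseteq> {s. convergent (\<lambda>j. poly (P j k) s)}"
    proof safe
      fix s assume s: "AE r in lborel. convergent (\<lambda>j. bipoly n (P j) (r, s))"
      define A where "A = (\<lambda>j. \<Sum>i\<le>n. monom (poly (P j i) s) i)"
      have "convergent (\<lambda>j. coeff (A j) k)"
      proof (rule convergent_coeffs)
        show "degree (A j) \<le> n" for j
          unfolding A_def by (intro degree_sum_le) (auto intro: order_trans[OF degree_monom_le])
        show "infinite {r. convergent (\<lambda>j. poly (A j) r)}"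
          using infinite_AE[OF s] by (simp add: A_def bipoly_def poly_sum poly_monom)
      qed
      then show "convergent (\<lambda>j. poly (P j k) s)"
        using k by (simp add: A_def coeff_sum)
    qed
    then show "infinite {s. convergent (\<lambda>j. poly (P j k) s)}"
      using infinite_AE[OF ae] finite_subset by blast
  qed
  \<comment> \<open>The degree bound \<open>n\<close> makes finitely many coefficient limits
    sufficient.\<close>
  define Q where "Q = (\<lambda>k. \<Sum>m\<le>n. monom (lim (\<lambda>j. coeff (P j k) m)) m)"
  have lim: "(\<lambda>j. poly (P j k) s) \<longlonglongrightarrow> poly (Q k) s" if k: "k \<le> n" for k s
  proof -
    have "poly (P j k) s = (\<Sum>m\<le>n. coeff (P j k) m * s ^ m)" for j
      unfolding poly_altdef using deg[OF k, of j]
      by (intro sum.mono_neutral_left) (auto simp: coeff_eq_0)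
    moreover have "(\<lambda>j. \<Sum>m\<le>n. coeff (P j k) m * s ^ m) \<longlonglongrightarrow> (\<Sum>m\<le>n. lim (\<lambda>j. coeff (P j k) m) * s ^ m)"
      using coeffs[OF k] by (intro tendsto_intros) (simp add: convergent_LIMSEQ_iff)
    ultimately show ?thesis by (simp add: Q_def poly_sum poly_monom)
  qed
  show ?thesis
  proof (rule that[of Q])
    show "(\<lambda>j. bipoly n (P j) z) \<longlonglongrightarrow> bipoly n Q z" for z
      unfolding bipoly_def by (intro tendsto_intros lim) auto
  qed (use lim in auto)
qed

text \<open>The law of \<open>(x, y / x)\<close> for independent standard normal variables \<open>x\<close> and \<open>y\<close>.\<close>

definition slope_density :: "real \<times> real \<Rightarrow> real" where
  "slope_density z = std_normal_density (fst z) * (\<bar>fst z\<bar> * std_normal_density (fst z * snd z))"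

definition slope_measure :: "(real \<times> real) measure" where
  "slope_measure = density (lborel \<Otimes>\<^sub>M lborel) (\<lambda>z. ennreal (slope_density z))"

lemma bipoly_measurable_pair [measurable]: "bipoly n p \<in> borel_measurable (borel \<Otimes>\<^sub>M borel)"
  unfolding borel_prod by (rule bipoly_measurable)

lemma slope_density_measurable [measurable]: "slope_density \<in> borel_measurable (borel \<Otimes>\<^sub>M borel)"
  unfolding slope_density_def by measurable

lemma slope_density_nonneg: "slope_density z \<ge> 0"
  by (simp add: slope_density_def normal_density_nonneg)

lemma sets_slope_measure [simp, measurable_cong]: "sets slope_measure = sets (borel \<Otimes>\<^sub>M borel)"
  unfolding slope_measure_def sets_density by (rule sets_pair_measure_cong) auto

lemma AE_neq_0: "AE r in (lborel :: real measure). r \<noteq> 0"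
  by (intro AE_I'[of "{0}"]) auto

text \<open>For fixed nonzero \<open>r\<close> the substitution \<open>y = r s\<close> absorbs the
  factor \<open>\<bar>r\<bar>\<close>. The summand 0 inside gives the integrand the shape of the
  affine substitution rule.\<close>

lemma nn_integral_slope_density: "(\<integral>\<^sup>+z. ennreal (slope_density z) \<partial>(lborel \<Otimes>\<^sub>M lborel)) = 1"
proof -
  have normal: "(\<integral>\<^sup>+x. ennreal (std_normal_density x) \<partial>lborel) = 1"
    by (simp add: nn_integral_eq_integral normal_density_nonneg)
  have "(\<integral>\<^sup>+z. ennreal (slope_density z) \<partial>(lborel \<Otimes>\<^sub>M lborel)) = (\<integral>\<^sup>+r. \<integral>\<^sup>+s. ennreal (slope_density (r, s)) \<partial>lborel \<partial>lborel)"
    by (rule lborel.nn_integral_fst[symmetric]) measurable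
  also have "\<dots> = (\<integral>\<^sup>+r. ennreal (std_normal_density r) \<partial>lborel)"
  proof (rule nn_integral_cong_AE, use AE_neq_0 in eventually_elim)
    case (elim r)
    have "(\<integral>\<^sup>+s. ennreal (slope_density (r, s)) \<partial>lborel) = (\<integral>\<^sup>+s. ennreal (std_normal_density r) * (ennreal \<bar>r\<bar> * ennreal (std_normal_density (0 + r * s))) \<partial>lborel)"
      by (simp add: slope_density_def ennreal_mult normal_density_nonneg)
    also have "\<dots> = ennreal (std_normal_density r) * (ennreal \<bar>r\<bar> * (\<integral>\<^sup>+s. ennreal (std_normal_density (0 + r * s)) \<partial>lborel))"
      by (simp add: nn_integral_cmult)
    also have "ennreal \<bar>r\<bar> * (\<integral>\<^sup>+s. ennreal (std_normal_density (0 + r * s)) \<partial>lborel) = (\<integral>\<^sup>+s. ennreal (std_normal_density s) \<partial>lborel)"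
      using elim by (intro nn_integral_real_affine[symmetric]) auto
    finally show ?case by (simp add: normal)
  qed
  finally show ?thesis by (simp add: normal)
qed

lemma prob_space_slope_measure: "prob_space slope_measure"
proof (rule prob_spaceI)
  have [measurable]: "(\<lambda>z. ennreal (slope_density z)) \<in> borel_measurable (lborel \<Otimes>\<^sub>M lborel)"
    by measurable
  have "emeasure slope_measure (space slope_measure)
      = (\<integral>\<^sup>+z. ennreal (slope_density z) * indicator (space (lborel \<Otimes>\<^sub>M lborel)) z \<partial>(lborel \<Otimes>\<^sub>M lborel))"
    unfolding slope_measure_def space_density by (rule emeasure_density[OF _ sets.top]) measurable
  also have "\<dots> = (\<integral>\<^sup>+z. ennreal (slope_density z) \<partial>(lborel \<Otimes>\<^sub>M lborel))"
    by (intro nn_integral_cong) simp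
  finally show "emeasure slope_measure (space slope_measure) = 1"
    by (simp only: nn_integral_slope_density)
qed

text \<open>The density vanishes only on the null set \<open>r = 0\<close>. So almost everywhere
  convergence passes to Lebesgue measure, where the polynomial arguments live, and null preimages
  pass back.\<close>

lemma AE_slope_measure_iff:
  "(AE z in slope_measure. P z) \<longleftrightarrow> (AE z in lborel. P z)"
proof -
  have "AE z in (lborel \<Otimes>\<^sub>M lborel :: (real \<times> real) measure). fst z \<noteq> 0"
  proof (rule lborel_pair.AE_pair_measure)
    show "AE x in lborel. AE y in lborel. fst (x, y :: real) \<noteq> (0 :: real)"
      using AE_neq_0 by eventually_elim simp
  qed measurable
  then have "AE z in lborel \<Otimes>\<^sub>M lborel. 0 < slope_density z"
    by eventually_elim (simp add: slope_density_def normal_density_pos)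
  then have "(AE z in slope_measure. P z) \<longleftrightarrow> (AE z in lborel \<Otimes>\<^sub>M lborel. P z)"
    unfolding slope_measure_def by (subst AE_density) (auto elim: eventually_elim2)
  then show ?thesis unfolding lborel_prod .
qed

text \<open>The exponent is \<open>a x + b y\<close> with \<open>x = r\<close> and
  \<open>y = r s\<close>: the characteristic function of a standard Gaussian pair.\<close>

lemma slope_measure_cis:
  "(\<integral>z. cis (fst z * (a + b * snd z)) \<partial>slope_measure) = of_real (exp (- (a\<^sup>2 + b\<^sup>2) / 2))"
proof -
  interpret prob_space slope_measure by (rule prob_space_slope_measure)
  define f where "f = (\<lambda>z. slope_density z *\<^sub>R cis (fst z * (a + b * snd z)))"
  have [measurable]: "f \<in> borel_measurable (borel \<Otimes>\<^sub>M borel)" unfolding f_def by measurable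
  have char: "(\<integral>x. std_normal_density x *\<^sub>R cis (t * x) \<partial>lborel) = of_real (exp (- t\<^sup>2 / 2))" for t
    using std_normal_cis[of t] by (subst (asm) integral_density) (auto simp: normal_density_nonneg)
  have "integrable slope_measure (\<lambda>z. cis (fst z * (a + b * snd z)))"
    using integrable_mult_cis[OF prob_space_axioms, of "\<lambda>_. 1" "\<lambda>z. fst z * (a + b * snd z)" 1] by simp
  then have int: "integrable (lborel \<Otimes>\<^sub>M lborel) f"
    unfolding slope_measure_def
    by (subst (asm) integrable_density) (auto simp: slope_density_nonneg f_def)
  have "(\<integral>z. cis (fst z * (a + b * snd z)) \<partial>slope_measure) = (\<integral>z. f z \<partial>(lborel \<Otimes>\<^sub>M lborel))"
    unfolding slope_measure_def
    by (subst integral_density) (auto simp: slope_density_nonneg f_def)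
  also have "\<dots> = (\<integral>r. \<integral>s. f (r, s) \<partial>lborel \<partial>lborel)"
    by (rule lborel_pair.integral_fst'[OF int, symmetric])
  also have "\<dots> = (\<integral>r. (std_normal_density r *\<^sub>R cis (a * r)) * of_real (exp (- b\<^sup>2 / 2)) \<partial>lborel)"
  proof (rule integral_cong_AE)
    show "AE r in lborel. (\<integral>s. f (r, s) \<partial>lborel) = (std_normal_density r *\<^sub>R cis (a * r)) * of_real (exp (- b\<^sup>2 / 2))"
      using AE_neq_0
    proof eventually_elim
      case (elim r)
      have "(\<integral>s. f (r, s) \<partial>lborel) = (\<integral>s. (std_normal_density r *\<^sub>R cis (a * r)) * (\<bar>r\<bar> *\<^sub>R (std_normal_density (0 + r * s) *\<^sub>R cis (b * (0 + r * s)))) \<partial>lborel)"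
        by (intro Bochner_Integration.integral_cong refl) (simp add: f_def slope_density_def scaleR_conv_of_real cis_mult[symmetric] distrib_left mult_ac)
      also have "\<dots> = (std_normal_density r *\<^sub>R cis (a * r)) * (\<bar>r\<bar> *\<^sub>R (\<integral>s. std_normal_density (0 + r * s) *\<^sub>R cis (b * (0 + r * s)) \<partial>lborel))"
        by (simp only: integral_mult_right_zero integral_scaleR_right)
      also have "\<bar>r\<bar> *\<^sub>R (\<integral>s. std_normal_density (0 + r * s) *\<^sub>R cis (b * (0 + r * s)) \<partial>lborel) = (\<integral>s. std_normal_density s *\<^sub>R cis (b * s) \<partial>lborel)"
        using elim by (rule lborel_integral_real_affine[symmetric])
      finally show ?case unfolding char .
    qed
    have "(\<lambda>r. \<integral>s. f (r, s) \<partial>lborel) \<in> borel_measurable lborel"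
      by (rule lborel.borel_measurable_lebesgue_integral) measurable
    then show "(\<lambda>r. \<integral>s. f (r, s) \<partial>lborel) \<in> borel_measurable lborel" .
  qed measurable
  also have "\<dots> = of_real (exp (- a\<^sup>2 / 2)) * of_real (exp (- b\<^sup>2 / 2))"
    by (subst integral_mult_left_zero) (simp only: char)
  also have "\<dots> = of_real (exp (- (a\<^sup>2 + b\<^sup>2) / 2))"
    by (simp add: exp_add[symmetric] add_divide_distrib flip: of_real_mult)
  finally show ?thesis .
qed

text \<open>Here \<open>'a\<close> is the sample space and \<open>'b\<close> the Hilbert
  space.\<close>

locale slope_resampling = gaussian_field +
  fixes e1 e2 :: 'b
  assumes e: "norm e1 = 1" "norm e2 = 1" "e1 \<bullet> e2 = 0"
begin

abbreviation rest :: "'b \<Rightarrow> 'b" where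
  "rest h \<equiv> h - (h \<bullet> e1) *\<^sub>R e1 - (h \<bullet> e2) *\<^sub>R e2"

text \<open>Every \<open>h\<close> is decomposed explicitly, since \<open>W\<close> is linear only
  up to null sets that depend on the vectors.\<close>

definition W' :: "'b \<Rightarrow> 'a \<times> (real \<times> real) \<Rightarrow> real" where
  "W' h p = fst (snd p) * (h \<bullet> e1 + h \<bullet> e2 * snd (snd p)) + W (rest h) (fst p)"

text \<open>By Fubini the characteristic function is a product of one factor for the plane of
  \<open>e1\<close>, \<open>e2\<close> and one for its complement; Pythagoras adds the
  exponents.\<close>

lemma W'_gaussian_field: "gaussian_field (M \<Otimes>\<^sub>M slope_measure) W'"
proof -
  interpret S: prob_space slope_measure by (rule prob_space_slope_measure)
  interpret P: pair_prob_space M slope_measure ..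
  show ?thesis
  proof
    show meas: "W' h \<in> borel_measurable (M \<Otimes>\<^sub>M slope_measure)" for h
      unfolding W'_def by measurable
    fix J :: "'b set" and c :: "'b \<Rightarrow> real" assume J: "finite J"
    define v where "v = (\<Sum>h\<in>J. c h *\<^sub>R h)"
    define a b where "a = v \<bullet> e1" and "b = v \<bullet> e2"
    have sum_W': "(\<Sum>h\<in>J. c h * W' h (\<omega>, z)) = fst z * (a + b * snd z) + (\<Sum>h\<in>J. c h * W (rest h) \<omega>)" for \<omega> z
    proof -
      have "(\<Sum>h\<in>J. c h * W' h (\<omega>, z)) = (\<Sum>h\<in>J. fst z * (c h * (h \<bullet> e1)) + fst z * snd z * (c h * (h \<bullet> e2)) + c h * W (rest h) \<omega>)"
        by (intro sum.cong refl) (simp add: W'_def algebra_simps)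
      also have "\<dots> = fst z * (a + b * snd z) + (\<Sum>h\<in>J. c h * W (rest h) \<omega>)"
        by (simp add: sum.distrib sum_distrib_left[symmetric] a_def b_def v_def inner_sum_left algebra_simps)
      finally show ?thesis .
    qed
    have sum_rest: "(\<Sum>h\<in>J. c h *\<^sub>R rest h) = v - a *\<^sub>R e1 - b *\<^sub>R e2"
      by (simp add: v_def a_def b_def scaleR_diff_right sum_subtractf inner_sum_left scaleR_sum_left)
    have "e1 \<bullet> e1 = 1" "e2 \<bullet> e2 = 1" using e by (simp_all add: dot_square_norm)
    then have pyth: "(norm v)\<^sup>2 = a\<^sup>2 + b\<^sup>2 + (norm (v - a *\<^sub>R e1 - b *\<^sub>R e2))\<^sup>2"
      unfolding power2_norm_eq_inner
      by (simp add: inner_diff_left inner_diff_right inner_commute[of e1 v] inner_commute[of e2 v] inner_commute[of e2 e1] e a_def[symmetric] b_def[symmetric] power2_eq_square)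
    have "integrable (M \<Otimes>\<^sub>M slope_measure) (\<lambda>p. cis (\<Sum>h\<in>J. c h * W' h p))"
      using integrable_mult_cis[OF P.prob_space_axioms, of "\<lambda>_. 1" "\<lambda>p. \<Sum>h\<in>J. c h * W' h p" 1] meas by simp
    then have "(\<integral>p. cis (\<Sum>h\<in>J. c h * W' h p) \<partial>(M \<Otimes>\<^sub>M slope_measure)) = (\<integral>\<omega>. \<integral>z. cis (\<Sum>h\<in>J. c h * W' h (\<omega>, z)) \<partial>slope_measure \<partial>M)"
      by (rule P.integral_fst'[symmetric])
    also have "\<dots> = (\<integral>\<omega>. (\<integral>z. cis (fst z * (a + b * snd z)) \<partial>slope_measure) * cis (\<Sum>h\<in>J. c h * W (rest h) \<omega>) \<partial>M)"
      unfolding sum_W' cis_mult[symmetric] by simp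
    also have "\<dots> = of_real (exp (- (a\<^sup>2 + b\<^sup>2) / 2)) * of_real (exp (- (norm (v - a *\<^sub>R e1 - b *\<^sub>R e2))\<^sup>2 / 2))"
      unfolding slope_measure_cis integral_mult_right_zero W_char_family[OF J] sum_rest ..
    also have "\<dots> = of_real (exp (- (norm v)\<^sup>2 / 2))"
      unfolding pyth by (simp add: exp_add[symmetric] add_divide_distrib diff_divide_distrib flip: of_real_mult)
    finally show "(\<integral>p. cis (\<Sum>h\<in>J. c h * W' h p) \<partial>(M \<Otimes>\<^sub>M slope_measure)) = of_real (exp (- (norm (\<Sum>h\<in>J. c h *\<^sub>R h))\<^sup>2 / 2))"
      by (simp add: v_def)
  qed
qed

end

lemma gaussian_field_law_eq:
  assumes "gaussian_field M W" "gaussian_field N V"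
  shows "distr M (Pi\<^sub>M UNIV (\<lambda>_. borel)) (\<lambda>\<omega> h. W h \<omega>) = distr N (Pi\<^sub>M UNIV (\<lambda>_. borel)) (\<lambda>\<omega> h. V h \<omega>)"
proof -
  interpret W: gaussian_field M W by fact
  interpret V: gaussian_field N V by fact
  show ?thesis
    by (rule law_eqI) (auto simp: W.W_char V.W_char W.prob_space_axioms V.prob_space_axioms)
qed

section \<open>Hermite sums as polynomials in the resampled coordinates\<close>

lemma degree_hermite_poly: "degree (hermite_poly n) = n"
  using hermite_poly_monic[of n] le_degree[of "hermite_poly n" n] by auto

lemma hermite_shift:
  "hermite n (x + w) = (\<Sum>k\<le>n. coeff (hermite_poly n \<circ>\<^sub>p [:w, 1:]) k * x ^ k)"
proof -
  have "hermite n (x + w) = poly (hermite_poly n \<circ>\<^sub>p [:w, 1:]) x"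
    by (simp add: poly_pcompose poly_hermite_poly add.commute)
  then show ?thesis
    by (simp add: poly_altdef degree_pcompose degree_hermite_poly)
qed

text \<open>The source of the deterministic top coefficients: a shift of a monic polynomial changes
  only the lower ones.\<close>

lemma coeff_hermite_shift: "coeff (hermite_poly n \<circ>\<^sub>p [:w, 1:]) n = 1"
  using lead_coeff_comp[of "[:w, 1:]" "hermite_poly n"] hermite_poly_monic[of n]
  by (simp add: degree_pcompose degree_hermite_poly)

definition slope_poly :: "('a::real_inner \<Rightarrow> real) \<Rightarrow> 'a \<Rightarrow> 'a \<Rightarrow> nat \<Rightarrow> 'a set \<Rightarrow> ('a \<Rightarrow> real) \<Rightarrow> nat \<Rightarrow> real poly" where
  "slope_poly w e1 e2 n A c k =
     (\<Sum>h\<in>A. smult (c h * coeff (hermite_poly n \<circ>\<^sub>p [:w h, 1:]) k) ([:h \<bullet> e1, h \<bullet> e2:] ^ k))"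

lemma degree_slope_poly: "degree (slope_poly w e1 e2 n A c k) \<le> k"
proof (cases "finite A")
  case True
  have "degree ([:h \<bullet> e1, h \<bullet> e2:] ^ k) \<le> k" for h
    using degree_power_le[of "[:h \<bullet> e1, h \<bullet> e2:]" k] by (auto split: if_splits)
  then show ?thesis
    unfolding slope_poly_def
    by (intro degree_sum_le True order_trans[OF degree_smult_le])
qed (simp add: slope_poly_def)

lemma bipoly_slope_poly:
  "bipoly n (slope_poly w e1 e2 n A c) z
    = (\<Sum>h\<in>A. c h * hermite n (fst z * (h \<bullet> e1 + h \<bullet> e2 * snd z) + w h))"
proof -
  have "bipoly n (slope_poly w e1 e2 n A c) z
      = (\<Sum>k\<le>n. \<Sum>h\<in>A. c h * (coeff (hermite_poly n \<circ>\<^sub>p [:w h, 1:]) k * (fst z * (h \<bullet> e1 + h \<bullet> e2 * snd z)) ^ k))"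
    unfolding bipoly_def slope_poly_def
    by (intro sum.cong refl) (simp add: poly_sum sum_distrib_left sum_distrib_right power_mult_distrib mult_ac)
  also have "\<dots> = (\<Sum>h\<in>A. c h * hermite n (fst z * (h \<bullet> e1 + h \<bullet> e2 * snd z) + w h))"
    unfolding hermite_shift by (subst sum.swap) (simp add: sum_distrib_left)
  finally show ?thesis .
qed

context chaos
begin

text \<open>The right side is free of \<open>w\<close> and continuous in the tensor, so it survives
  the passage to the limit.\<close>

lemma poly_slope_poly_top:
  "poly (slope_poly w e1 e2 n A c n) s = power_sum A c \<bullet> tensor (replicate n (e1 + s *\<^sub>R e2))"
  by (simp add: slope_poly_def coeff_hermite_shift poly_sum power_sum_inner inner_add_right mult.commute)

lemma represents_AE:
  assumes "represents f X"
  obtains A c where "\<And>j::nat. \<forall>h\<in>A j. norm h = 1"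
    "(\<lambda>j. power_sum (A j) (c j)) \<longlonglongrightarrow> f"
    "AE \<omega> in M. (\<lambda>j. hermite_sum n (A j) (c j) \<omega>) \<longlonglongrightarrow> X \<omega>"
proof -
  have [measurable]: "X \<in> borel_measurable M" using assms by (simp add: represents_iff)
  obtain A c where A: "\<And>j::nat. finite (A j)" "\<And>j. \<forall>h\<in>A j. norm h = 1"
    and p: "(\<lambda>j. power_sum (A j) (c j)) \<longlonglongrightarrow> f"
    and i: "\<And>j. integrable M (\<lambda>\<omega>. (X \<omega> - hermite_sum n (A j) (c j) \<omega>)\<^sup>2)"
    and l: "(\<lambda>j. expectation (\<lambda>\<omega>. (X \<omega> - hermite_sum n (A j) (c j) \<omega>)\<^sup>2)) \<longlonglongrightarrow> 0"
    using representsE[OF assms] by blast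
  have "\<exists>r. strict_mono r \<and> (AE \<omega> in M. (\<lambda>j. (X \<omega> - hermite_sum n (A (r j)) (c (r j)) \<omega>)\<^sup>2) \<longlonglongrightarrow> 0)"
    using tendsto_L1_AE_subseq[of M "\<lambda>j \<omega>. (X \<omega> - hermite_sum n (A j) (c j) \<omega>)\<^sup>2"] i l by simp
  then obtain r where r: "strict_mono r" "AE \<omega> in M. (\<lambda>j. (X \<omega> - hermite_sum n (A (r j)) (c (r j)) \<omega>)\<^sup>2) \<longlonglongrightarrow> 0"
    by auto
  show ?thesis
  proof (rule that[of "\<lambda>j. A (r j)" "\<lambda>j. c (r j)"])
    show "(\<lambda>j. power_sum (A (r j)) (c (r j))) \<longlonglongrightarrow> f"
      using LIMSEQ_subseq_LIMSEQ[OF p r(1)] by (simp add: o_def)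
    show "AE \<omega> in M. (\<lambda>j. hermite_sum n (A (r j)) (c (r j)) \<omega>) \<longlonglongrightarrow> X \<omega>"
      using r(2)
    proof eventually_elim
      case (elim \<omega>)
      then have "(\<lambda>j. X \<omega> - hermite_sum n (A (r j)) (c (r j)) \<omega>) \<longlonglongrightarrow> 0"
        using tendsto_real_sqrt[OF elim] by (simp add: tendsto_rabs_zero_iff)
      from tendsto_diff[OF tendsto_const[of "X \<omega>"] this] show ?case by simp
    qed
  qed (use A in auto)
qed

text \<open>\<open>F\<close> and \<open>G\<close> are replaced by limits of Hermite sums, which are
  functions of the path \<open>h \<mapsto> W h\<close>. Only events of this kind can be transported
  to \<open>W'\<close>, which lives on a larger probability space.\<close>

lemma AE_not_in_null_set:
  assumes F: "represents f F" and G: "represents g G"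
    and e: "norm e1 = 1" "norm e2 = 1" "e1 \<bullet> e2 = 0"
    and indep: "(f \<bullet> tensor (replicate n (e1 + s *\<^sub>R e2))) * (g \<bullet> tensor (replicate n (e1 + t *\<^sub>R e2)))
      \<noteq> (f \<bullet> tensor (replicate n (e1 + t *\<^sub>R e2))) * (g \<bullet> tensor (replicate n (e1 + s *\<^sub>R e2)))"
    and N: "N \<in> null_sets (lborel :: (real \<times> real) measure)"
  shows "AE \<omega> in M. (F \<omega>, G \<omega>) \<notin> N"
proof -
  interpret R: slope_resampling M W e1 e2 by unfold_locales (fact e)+
  interpret S: prob_space slope_measure by (rule prob_space_slope_measure)
  interpret P: pair_prob_space M slope_measure ..
  interpret W': gaussian_field "M \<Otimes>\<^sub>M slope_measure" R.W' by (rule R.W'_gaussian_field)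
  have [measurable]: "F \<in> borel_measurable M" "G \<in> borel_measurable M"
    using F G by (auto simp: represents_iff)
  have [measurable]: "N \<in> sets (borel \<Otimes>\<^sub>M borel)" using N unfolding borel_prod by auto
  obtain A c where A: "\<And>j::nat. \<forall>h\<in>A j. norm h = 1"
    and pA: "(\<lambda>j. power_sum (A j) (c j)) \<longlonglongrightarrow> f"
    and lA: "AE \<omega> in M. (\<lambda>j. hermite_sum n (A j) (c j) \<omega>) \<longlonglongrightarrow> F \<omega>"
    using represents_AE[OF F] by blast
  obtain B d where B: "\<And>j::nat. \<forall>h\<in>B j. norm h = 1"
    and pB: "(\<lambda>j. power_sum (B j) (d j)) \<longlonglongrightarrow> g"
    and lB: "AE \<omega> in M. (\<lambda>j. hermite_sum n (B j) (d j) \<omega>) \<longlonglongrightarrow> G \<omega>"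
    using represents_AE[OF G] by blast
  let ?\<Xi> = "Pi\<^sub>M UNIV (\<lambda>_. borel) :: ('a \<Rightarrow> real) measure"
  define hs :: "'a set \<Rightarrow> ('a \<Rightarrow> real) \<Rightarrow> ('a \<Rightarrow> real) \<Rightarrow> real" where
    "hs = (\<lambda>A c w. \<Sum>h\<in>A. c h * hermite n (w h))"
  have [measurable]: "hs A c \<in> borel_measurable ?\<Xi>" for A c
    unfolding hs_def by measurable
  \<comment> \<open>\<open>lim\<close> has no meaning where the sequences diverge; convergence is
    therefore transported to \<open>W'\<close> as an event of its own.\<close>
  define good where "good = (\<lambda>w. Cauchy (\<lambda>j. hs (A j) (c j) w) \<and> Cauchy (\<lambda>j. hs (B j) (d j) w))"
  define bad where "bad = (\<lambda>w. (lim (\<lambda>j. hs (A j) (c j) w), lim (\<lambda>j. hs (B j) (d j) w)) \<in> N)"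
  have Cauchy_meas: "Measurable.pred ?\<Xi> (\<lambda>w. Cauchy (\<lambda>j. hs (A j) (c j) w))" for A c
    unfolding pred_def by (rule sets_Collect_Cauchy) measurable
  have [measurable]: "Measurable.pred ?\<Xi> good"
    unfolding good_def by (intro pred_intros_logic Cauchy_meas)
  have [measurable]: "Measurable.pred ?\<Xi> bad"
    unfolding bad_def pred_def
  proof (rule measurable_sets_Collect[where P = "\<lambda>z. z \<in> N" and N = "borel \<Otimes>\<^sub>M borel"])
    show "(\<lambda>w. (lim (\<lambda>j. hs (A j) (c j) w), lim (\<lambda>j. hs (B j) (d j) w))) \<in> ?\<Xi> \<rightarrow>\<^sub>M borel \<Otimes>\<^sub>M borel"
      by (intro measurable_Pair borel_measurable_lim_metric) measurable
  qed measurable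
  have [measurable]: "(\<lambda>\<omega> h. W h \<omega>) \<in> M \<rightarrow>\<^sub>M ?\<Xi>"
    by (intro measurable_PiM_single') auto
  have [measurable]: "(\<lambda>p h. R.W' h p) \<in> M \<Otimes>\<^sub>M slope_measure \<rightarrow>\<^sub>M ?\<Xi>"
    using W'.W_measurable by (intro measurable_PiM_single') auto
  have law: "(AE \<omega> in M. Q (\<lambda>h. W h \<omega>)) \<longleftrightarrow> (AE p in M \<Otimes>\<^sub>M slope_measure. Q (\<lambda>h. R.W' h p))"
    if [measurable]: "Measurable.pred ?\<Xi> Q" for Q
  proof -
    have "(AE \<omega> in M. Q (\<lambda>h. W h \<omega>)) \<longleftrightarrow> (AE w in distr M ?\<Xi> (\<lambda>\<omega> h. W h \<omega>). Q w)"
      by (subst AE_distr_iff) auto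
    also have "\<dots> \<longleftrightarrow> (AE w in distr (M \<Otimes>\<^sub>M slope_measure) ?\<Xi> (\<lambda>p h. R.W' h p). Q w)"
      by (subst gaussian_field_law_eq[OF gaussian_field_axioms R.W'_gaussian_field]) (rule refl)
    also have "\<dots> \<longleftrightarrow> (AE p in M \<Otimes>\<^sub>M slope_measure. Q (\<lambda>h. R.W' h p))"
      by (subst AE_distr_iff) auto
    finally show ?thesis .
  qed
  have "AE \<omega> in M. good (\<lambda>h. W h \<omega>)"
    using lA lB
    by eventually_elim (auto simp: good_def hs_def hermite_sum_def[symmetric] intro: LIMSEQ_imp_Cauchy)
  then have "AE p in M \<Otimes>\<^sub>M slope_measure. good (\<lambda>h. R.W' h p)"
    by (simp add: law)
  then have good: "AE \<omega> in M. AE z in slope_measure. good (\<lambda>h. R.W' h (\<omega>, z))"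
    by (rule P.AE_pair)
  have "AE \<omega> in M. AE z in slope_measure. \<not> bad (\<lambda>h. R.W' h (\<omega>, z))"
    using good
  proof eventually_elim
    case (elim \<omega>)
    let ?p = "\<lambda>j. slope_poly (\<lambda>h. W (R.rest h) \<omega>) e1 e2 n (A j) (c j)"
    let ?q = "\<lambda>j. slope_poly (\<lambda>h. W (R.rest h) \<omega>) e1 e2 n (B j) (d j)"
    have hs: "hs A c (\<lambda>h. R.W' h (\<omega>, z)) = bipoly n (slope_poly (\<lambda>h. W (R.rest h) \<omega>) e1 e2 n A c) z" for A c z
      by (simp add: bipoly_slope_poly hs_def R.W'_def)
    have conv: "AE z in lborel. convergent (\<lambda>j. bipoly n (?p j) z)" "AE z in lborel. convergent (\<lambda>j. bipoly n (?q j) z)"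
      using elim unfolding AE_slope_measure_iff good_def hs Cauchy_convergent_iff by auto
    have deg: "degree (slope_poly w e1 e2 n A c k) \<le> n" if "k \<le> n" for w A c k
      using degree_slope_poly that by (rule order_trans)
    obtain p where p: "\<And>k s. k \<le> n \<Longrightarrow> (\<lambda>j. poly (?p j k) s) \<longlonglongrightarrow> poly (p k) s"
      "\<And>z. (\<lambda>j. bipoly n (?p j) z) \<longlonglongrightarrow> bipoly n p z"
      using bipoly_convergent[OF deg conv(1)] by blast
    obtain q where q: "\<And>k s. k \<le> n \<Longrightarrow> (\<lambda>j. poly (?q j k) s) \<longlonglongrightarrow> poly (q k) s"
      "\<And>z. (\<lambda>j. bipoly n (?q j) z) \<longlonglongrightarrow> bipoly n q z"
      using bipoly_convergent[OF deg conv(2)] by blast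
    \<comment> \<open>The top coefficients of the approximants are inner products of power sums with
      a fixed tensor, hence the limit does not depend on \<omega>.\<close>
    have pn: "poly (p n) s = f \<bullet> tensor (replicate n (e1 + s *\<^sub>R e2))" for s
    proof (rule LIMSEQ_unique)
      show "(\<lambda>j. poly (?p j n) s) \<longlonglongrightarrow> poly (p n) s" using p(1) by simp
      show "(\<lambda>j. poly (?p j n) s) \<longlonglongrightarrow> f \<bullet> tensor (replicate n (e1 + s *\<^sub>R e2))"
        unfolding poly_slope_poly_top by (intro tendsto_intros pA)
    qed
    have qn: "poly (q n) s = g \<bullet> tensor (replicate n (e1 + s *\<^sub>R e2))" for s
    proof (rule LIMSEQ_unique)
      show "(\<lambda>j. poly (?q j n) s) \<longlonglongrightarrow> poly (q n) s" using q(1) by simp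
      show "(\<lambda>j. poly (?q j n) s) \<longlonglongrightarrow> g \<bullet> tensor (replicate n (e1 + s *\<^sub>R e2))"
        unfolding poly_slope_poly_top by (intro tendsto_intros pB)
    qed
    have "p n * pderiv (q n) \<noteq> pderiv (p n) * q n"
    proof
      assume "p n * pderiv (q n) = pderiv (p n) * q n"
      then obtain a b where ab: "(a, b) \<noteq> (0, 0)" "smult a (p n) + smult b (q n) = 0"
        using wronskian_eq_0_imp_dependent by blast
      have dep: "a * poly (p n) x + b * poly (q n) x = 0" for x
        using arg_cong[OF ab(2), of "\<lambda>r. poly r x"] by simp
      \<comment> \<open>A linear relation between \<open>p n\<close> and \<open>q n\<close> would
        annihilate the determinant of their values at \<open>s\<close> and \<open>t\<close>, which
        \<open>indep\<close> excludes.\<close>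
      have "a * (poly (p n) s * poly (q n) t - poly (p n) t * poly (q n) s)
          = poly (q n) t * (a * poly (p n) s + b * poly (q n) s) - poly (q n) s * (a * poly (p n) t + b * poly (q n) t)"
        "b * (poly (p n) s * poly (q n) t - poly (p n) t * poly (q n) s)
          = poly (p n) s * (a * poly (p n) t + b * poly (q n) t) - poly (p n) t * (a * poly (p n) s + b * poly (q n) s)"
        by (simp_all add: algebra_simps)
      then show False using indep ab(1) unfolding dep by (auto simp: pn qn)
    qed
    then have "{z. (bipoly n p z, bipoly n q z) \<in> N} \<in> null_sets lborel"
      using bipoly_null_vimage[OF n _ N] by blast
    then have "AE z in lborel. (bipoly n p z, bipoly n q z) \<notin> N"
      by (rule AE_I') auto
    then show ?case
      unfolding AE_slope_measure_iff bad_def hs by (simp add: limI[OF p(2)] limI[OF q(2)])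
  qed
  then have "AE p in M \<Otimes>\<^sub>M slope_measure. \<not> bad (\<lambda>h. R.W' h p)"
    by (intro P.AE_pair_measure) measurable
  then have "AE \<omega> in M. \<not> bad (\<lambda>h. W h \<omega>)"
    by (subst law) auto
  then show ?thesis
    using lA lB
    by eventually_elim (auto simp: bad_def hs_def hermite_sum_def[symmetric] dest!: limI)
qed

text \<open>A represented tensor is a limit of combinations of powers of unit vectors.\<close>

lemma represents_orthogonal:
  assumes "represents f X" and z: "\<And>h. norm h = 1 \<Longrightarrow> z \<bullet> tensor (replicate n h) = 0"
  shows "z \<bullet> f = 0"
proof -
  obtain A c where A: "\<And>j::nat. \<forall>h\<in>A j. norm h = 1" and p: "(\<lambda>j. power_sum (A j) (c j)) \<longlonglongrightarrow> f"
    and "AE \<omega> in M. (\<lambda>j. hermite_sum n (A j) (c j) \<omega>) \<longlonglongrightarrow> X \<omega>"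
    using represents_AE[OF assms(1)] by blast
  have "z \<bullet> power_sum (A j) (c j) = 0" for j
    using A[of j] z by (simp add: power_sum_def inner_sum_right)
  then have "(\<lambda>j. z \<bullet> power_sum (A j) (c j)) \<longlonglongrightarrow> 0" by simp
  moreover have "(\<lambda>j. z \<bullet> power_sum (A j) (c j)) \<longlonglongrightarrow> z \<bullet> f" by (intro tendsto_intros p)
  ultimately show ?thesis using LIMSEQ_unique by blast
qed

text \<open>Powers of unit vectors separate \<open>f\<close> and \<open>g\<close>, which yields unit
  vectors \<open>u\<close>, \<open>v\<close> with a nonzero determinant of values. It remains to
  place multiples of both on one line \<open>e1 + s e2\<close>.\<close>

lemma independent_directions:
  assumes F: "represents f F" and G: "represents g G"
    and indep: "\<And>a b. a *\<^sub>R f + b *\<^sub>R g = 0 \<Longrightarrow> (a, b) = (0, 0)"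
  shows "\<exists>e1 e2 s t. norm e1 = 1 \<and> norm e2 = 1 \<and> e1 \<bullet> e2 = 0 \<and>
    (f \<bullet> tensor (replicate n (e1 + s *\<^sub>R e2))) * (g \<bullet> tensor (replicate n (e1 + t *\<^sub>R e2)))
      \<noteq> (f \<bullet> tensor (replicate n (e1 + t *\<^sub>R e2))) * (g \<bullet> tensor (replicate n (e1 + s *\<^sub>R e2)))"
proof -
  let ?T = "\<lambda>h. tensor (replicate n h)"
  obtain u where u: "norm u = 1" "f \<bullet> ?T u \<noteq> 0"
  proof (rule ccontr)
    assume "\<not> thesis"
    then have "f \<bullet> f = 0" using that by (intro represents_orthogonal[OF F]) blast
    then show False using indep[of 1 0] by simp
  qed
  have "\<exists>v. norm v = 1 \<and> (f \<bullet> ?T u) * (g \<bullet> ?T v) \<noteq> (f \<bullet> ?T v) * (g \<bullet> ?T u)"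
  proof (rule ccontr)
    assume *: "\<not> ?thesis"
    \<comment> \<open>If all determinants with \<open>u\<close> vanish, this combination is
      orthogonal to every power of a unit vector, hence to \<open>f\<close>, \<open>g\<close> and
      itself.\<close>
    define z where "z = (- (g \<bullet> ?T u)) *\<^sub>R f + (f \<bullet> ?T u) *\<^sub>R g"
    have z: "z \<bullet> ?T h = 0" if "norm h = 1" for h
    proof -
      have "(f \<bullet> ?T u) * (g \<bullet> ?T h) = (f \<bullet> ?T h) * (g \<bullet> ?T u)" using * that by blast
      then show ?thesis by (simp add: z_def inner_diff_left mult.commute)
    qed
    have "z \<bullet> z = 0"
      using represents_orthogonal[OF F z] represents_orthogonal[OF G z]
      by (subst (2) z_def) (simp add: inner_diff_right)
    then show False using indep[of "- (g \<bullet> ?T u)" "f \<bullet> ?T u"] u(2) by (simp add: z_def)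
  qed
  then obtain v where v: "norm v = 1" "(f \<bullet> ?T u) * (g \<bullet> ?T v) \<noteq> (f \<bullet> ?T v) * (g \<bullet> ?T u)"
    by blast
  define p q where "p = u + v" and "q = u - v"
  have "u \<noteq> v" using v by (auto simp: mult.commute)
  then have "q \<noteq> 0" by (simp add: q_def)
  have "p \<noteq> 0"
  proof
    assume "p = 0"
    then have "v = (-1) *\<^sub>R u" by (simp add: p_def add_eq_0_iff)
    then have "?T v = (-1) ^ n *\<^sub>R ?T u" by (simp only: tensor_scale)
    then show False using v(2) by simp
  qed
  have pq: "p \<bullet> q = 0"
    using u(1) v(1) by (simp add: p_def q_def inner_add_left inner_diff_right inner_commute[of v u] dot_square_norm)
  \<comment> \<open>With this slope the points at \<open>s\<close> and \<open>- s\<close> are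
    \<open>(2 / norm p) u\<close> and \<open>(2 / norm p) v\<close>; by homogeneity the determinant
    only changes by a nonzero factor.\<close>
  define s where "s = norm q / norm p"
  let ?e1 = "p /\<^sub>R norm p" and ?e2 = "q /\<^sub>R norm q"
  have se2: "s *\<^sub>R ?e2 = q /\<^sub>R norm p"
    using \<open>q \<noteq> 0\<close> by (simp add: s_def divide_inverse)
  have "p + q = 2 *\<^sub>R u" "p - q = 2 *\<^sub>R v"
    by (simp_all add: p_def q_def scaleR_2)
  moreover have "?e1 + s *\<^sub>R ?e2 = (p + q) /\<^sub>R norm p" "?e1 + (- s) *\<^sub>R ?e2 = (p - q) /\<^sub>R norm p"
    unfolding scaleR_minus_left se2 by (simp_all only: scaleR_add_right scaleR_diff_right add_uminus_conv_diff)
  ultimately have uv: "?e1 + s *\<^sub>R ?e2 = (2 / norm p) *\<^sub>R u" "?e1 + (- s) *\<^sub>R ?e2 = (2 / norm p) *\<^sub>R v"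
    by (simp_all only: scaleR_scaleR divide_inverse mult.commute)
  show ?thesis
  proof (intro exI conjI)
    show "norm ?e1 = 1" "norm ?e2 = 1" using \<open>p \<noteq> 0\<close> \<open>q \<noteq> 0\<close> by simp_all
    show "?e1 \<bullet> ?e2 = 0" using pq by simp
    show "(f \<bullet> ?T (?e1 + s *\<^sub>R ?e2)) * (g \<bullet> ?T (?e1 + (- s) *\<^sub>R ?e2)) \<noteq> (f \<bullet> ?T (?e1 + (- s) *\<^sub>R ?e2)) * (g \<bullet> ?T (?e1 + s *\<^sub>R ?e2))"
      unfolding uv tensor_scale inner_scaleR_right using v(2) \<open>p \<noteq> 0\<close> by (simp add: mult_ac)
  qed
qed

lemma absolutely_continuous_if_independent:
  assumes F: "represents f F" and G: "represents g G"
    and indep: "\<And>a b. (AE \<omega> in M. a * F \<omega> + b * G \<omega> = 0) \<Longrightarrow> (a, b) = (0, 0)"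
  shows "admits_density M (\<lambda>\<omega>. (F \<omega>, G \<omega>))"
proof -
  have [measurable]: "F \<in> borel_measurable M" "G \<in> borel_measurable M"
    using F G by (auto simp: represents_iff)
  have meas: "(\<lambda>\<omega>. (F \<omega>, G \<omega>)) \<in> M \<rightarrow>\<^sub>M borel"
    unfolding borel_prod[symmetric] by measurable
  obtain e1 e2 s t where e: "norm e1 = 1" "norm e2 = 1" "e1 \<bullet> e2 = 0"
    "(f \<bullet> tensor (replicate n (e1 + s *\<^sub>R e2))) * (g \<bullet> tensor (replicate n (e1 + t *\<^sub>R e2)))
      \<noteq> (f \<bullet> tensor (replicate n (e1 + t *\<^sub>R e2))) * (g \<bullet> tensor (replicate n (e1 + s *\<^sub>R e2)))"
    using independent_directions[OF F G] represents_dependent[OF F G] indep by blast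
  show ?thesis
    unfolding admits_density_def absolutely_continuous_def
  proof
    fix N assume N: "N \<in> null_sets (lborel :: (real \<times> real) measure)"
    then have "N \<in> sets borel" by auto
    moreover have "AE x in distr M borel (\<lambda>\<omega>. (F \<omega>, G \<omega>)). x \<notin> N"
      using AE_not_in_null_set[OF F G e N] \<open>N \<in> sets borel\<close>
      by (subst AE_distr_iff[OF meas]) auto
    ultimately show "N \<in> null_sets (distr M borel (\<lambda>\<omega>. (F \<omega>, G \<omega>)))"
      by (simp add: AE_iff_null_sets)
  qed
qed

end

section \<open>The degenerate case and the covariance criterion\<close>

lemma (in prob_space) not_admits_density_if_dependent:
  assumes [measurable]: "F \<in> borel_measurable M" "G \<in> borel_measurable M"
    and ab: "(a, b) \<noteq> (0, 0)" and dep: "AE \<omega> in M. a * F \<omega> + b * G \<omega> = 0"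
  shows "\<not> admits_density M (\<lambda>\<omega>. (F \<omega>, G \<omega>))"
proof
  assume ac: "admits_density M (\<lambda>\<omega>. (F \<omega>, G \<omega>))"
  have meas: "(\<lambda>\<omega>. (F \<omega>, G \<omega>)) \<in> M \<rightarrow>\<^sub>M borel"
    unfolding borel_prod[symmetric] by measurable
  \<comment> \<open>The relation puts the whole law on this line, a Lebesgue null set.\<close>
  define L where "L = {z :: real \<times> real. (a, b) \<bullet> z = 0}"
  have "negligible L" unfolding L_def using ab by (intro negligible_hyperplane) (auto simp: zero_prod_def)
  moreover have "L \<in> sets borel" unfolding L_def by (intro borel_closed closed_hyperplane)
  ultimately have "L \<in> null_sets lborel"
    by (simp add: negligible_iff_null_sets null_sets_completion_iff)
  then have "L \<in> null_sets (distr M borel (\<lambda>\<omega>. (F \<omega>, G \<omega>)))"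
    using ac by (auto simp: admits_density_def absolutely_continuous_def)
  then have "AE x in distr M borel (\<lambda>\<omega>. (F \<omega>, G \<omega>)). x \<notin> L"
    by (rule AE_not_in)
  then have "AE \<omega> in M. (F \<omega>, G \<omega>) \<notin> L"
    using \<open>L \<in> sets borel\<close> by (subst (asm) AE_distr_iff[OF meas]) auto
  then have "AE \<omega> in M. False"
    using dep by eventually_elim (simp add: L_def inner_prod_def)
  then show False by simp
qed

text \<open>The quadratic form of the covariance matrix is the second moment of
  \<open>a F + b G\<close>; a nonzero vector at which it vanishes is an almost sure linear
  relation.\<close>

lemma (in prob_space) det_covariance_eq_0_iff:
  assumes [measurable]: "F \<in> borel_measurable M" "G \<in> borel_measurable M"
    and sq: "integrable M (\<lambda>\<omega>. (F \<omega>)\<^sup>2)" "integrable M (\<lambda>\<omega>. (G \<omega>)\<^sup>2)"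
    and centered: "expectation F = 0" "expectation G = 0"
  shows "det (covariance_matrix M F G) = 0 \<longleftrightarrow>
    (\<exists>a b. (a, b) \<noteq> (0, 0) \<and> (AE \<omega> in M. a * F \<omega> + b * G \<omega> = 0))"
proof -
  define x y z where "x = expectation (\<lambda>\<omega>. (F \<omega>)\<^sup>2)" and "y = expectation (\<lambda>\<omega>. F \<omega> * G \<omega>)"
    and "z = expectation (\<lambda>\<omega>. (G \<omega>)\<^sup>2)"
  have FG: "integrable M (\<lambda>\<omega>. F \<omega> * G \<omega>)" by (rule integrable_mult_of_squares) (use sq in auto)
  have det: "det (covariance_matrix M F G) = x * z - y * y"
    by (simp add: covariance_matrix_def det_2 covariance_def centered x_def y_def z_def power2_eq_square mult.commute)
  have quad: "expectation (\<lambda>\<omega>. (a * F \<omega> + b * G \<omega>)\<^sup>2) = a\<^sup>2 * x + 2 * a * b * y + b\<^sup>2 * z"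
    and int: "integrable M (\<lambda>\<omega>. (a * F \<omega> + b * G \<omega>)\<^sup>2)" for a b
  proof -
    have *: "(a * F \<omega> + b * G \<omega>)\<^sup>2 = a\<^sup>2 * (F \<omega>)\<^sup>2 + 2 * a * b * (F \<omega> * G \<omega>) + b\<^sup>2 * (G \<omega>)\<^sup>2" for \<omega>
      by (simp add: power2_eq_square algebra_simps)
    show "expectation (\<lambda>\<omega>. (a * F \<omega> + b * G \<omega>)\<^sup>2) = a\<^sup>2 * x + 2 * a * b * y + b\<^sup>2 * z"
      unfolding * using sq FG by (simp add: x_def y_def z_def)
    show "integrable M (\<lambda>\<omega>. (a * F \<omega> + b * G \<omega>)\<^sup>2)"
      unfolding * using sq FG by auto
  qed
  have AE_iff: "(AE \<omega> in M. a * F \<omega> + b * G \<omega> = 0) \<longleftrightarrow> a\<^sup>2 * x + 2 * a * b * y + b\<^sup>2 * z = 0" for a b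
    using integral_nonneg_eq_0_iff_AE[OF int[of a b]] by (simp add: quad)
  show ?thesis
  proof
    assume 0: "det (covariance_matrix M F G) = 0"
    show "\<exists>a b. (a, b) \<noteq> (0, 0) \<and> (AE \<omega> in M. a * F \<omega> + b * G \<omega> = 0)"
    proof (cases "z = 0")
      case True
      then have "AE \<omega> in M. 0 * F \<omega> + 1 * G \<omega> = 0" unfolding AE_iff by simp
      moreover have "(0 :: real, 1 :: real) \<noteq> (0, 0)" by simp
      ultimately show ?thesis by blast
    next
      case False
      \<comment> \<open>\<open>(z, - y)\<close> annihilates the second row of the matrix, and the
        form takes the value \<open>z\<close> times the determinant there. If \<open>z = 0\<close>,
        then \<open>G\<close> itself vanishes almost surely.\<close>
      have "z\<^sup>2 * x + 2 * z * (- y) * y + (- y)\<^sup>2 * z = z * (x * z - y * y)"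
        by (simp add: power2_eq_square algebra_simps)
      then have "AE \<omega> in M. z * F \<omega> + (- y) * G \<omega> = 0"
        unfolding AE_iff using 0 det by simp
      moreover have "(z, - y) \<noteq> (0, 0)" using False by simp
      ultimately show ?thesis by blast
    qed
  next
    assume "\<exists>a b. (a, b) \<noteq> (0, 0) \<and> (AE \<omega> in M. a * F \<omega> + b * G \<omega> = 0)"
    then obtain a b where ab: "(a, b) \<noteq> (0, 0)" "AE \<omega> in M. a * F \<omega> + b * G \<omega> = 0" by auto
    \<comment> \<open>Multiplying the relation by \<open>F\<close> and by \<open>G\<close> shows
      that \<open>(a, b)\<close> lies in the kernel of the matrix.\<close>
    have "expectation (\<lambda>\<omega>. F \<omega> * (a * F \<omega> + b * G \<omega>)) = 0" "expectation (\<lambda>\<omega>. G \<omega> * (a * F \<omega> + b * G \<omega>)) = 0"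
      using ab(2) by (auto intro!: integral_eq_zero_AE elim!: eventually_mono)
    moreover have "F \<omega> * (a * F \<omega> + b * G \<omega>) = a * (F \<omega>)\<^sup>2 + b * (F \<omega> * G \<omega>)"
      "G \<omega> * (a * F \<omega> + b * G \<omega>) = a * (F \<omega> * G \<omega>) + b * (G \<omega>)\<^sup>2" for \<omega>
      by (simp_all add: power2_eq_square algebra_simps)
    ultimately have e: "a * x + b * y = 0" "a * y + b * z = 0"
      using sq FG by (simp_all add: x_def y_def z_def)
    have "a * (x * z - y * y) = z * (a * x + b * y) - y * (a * y + b * z)"
      "b * (x * z - y * y) = x * (a * y + b * z) - y * (a * x + b * y)"
      by (simp_all add: algebra_simps)
    then show "det (covariance_matrix M F G) = 0" using ab(1) by (auto simp: e det)
  qed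
qed

theorem theorem3:
  fixes M :: "'w measure"
    and W :: "'a::{real_inner, polish_space} \<Rightarrow> 'w \<Rightarrow> real"
    and tensor :: "'a list \<Rightarrow> 'b::{real_inner, complete_space}"
    and n :: nat and f g :: 'b and F G :: "'w \<Rightarrow> real"
  assumes "isonormal_process M W"
    and "hilbert_tensor_power n tensor"
    and "n \<ge> 1"
    and "f \<in> symmetric_tensors n tensor" and "g \<in> symmetric_tensors n tensor"
    and "F \<in> borel_measurable M" and "AE \<omega> in M. F \<omega> = multiple_integral M W n tensor f \<omega>"
    and "G \<in> borel_measurable M" and "AE \<omega> in M. G \<omega> = multiple_integral M W n tensor g \<omega>"
  shows "(\<not> admits_density M (\<lambda>\<omega>. (F \<omega>, G \<omega>)) \<longleftrightarrow> det (covariance_matrix M F G) = 0) \<and>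
    (\<not> admits_density M (\<lambda>\<omega>. (F \<omega>, G \<omega>)) \<longleftrightarrow>
      (\<exists>a b :: real. (a, b) \<noteq> (0, 0) \<and> (AE \<omega> in M. a * F \<omega> + b * G \<omega> = 0)))"
proof -
  interpret gaussian_field M W
    using assms(1) by (rule isonormal_process.gaussian_field)
  interpret hilbert_tensor_power n tensor by fact
  interpret chaos M W n tensor by unfold_locales fact
  have F: "represents f F" and G: "represents g G"
    using assms by (auto intro: represents_multiple_integral)
  have "det (covariance_matrix M F G) = 0 \<longleftrightarrow>
    (\<exists>a b. (a, b) \<noteq> (0, 0) \<and> (AE \<omega> in M. a * F \<omega> + b * G \<omega> = 0))"
    using F G represents_expectation[OF F] represents_expectation[OF G]
    by (intro det_covariance_eq_0_iff) (auto simp: represents_iff)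
  moreover have "\<not> admits_density M (\<lambda>\<omega>. (F \<omega>, G \<omega>)) \<longleftrightarrow>
      (\<exists>a b :: real. (a, b) \<noteq> (0, 0) \<and> (AE \<omega> in M. a * F \<omega> + b * G \<omega> = 0))"
    using absolutely_continuous_if_independent[OF F G] not_admits_density_if_dependent[OF assms(6,8)] by blast
  ultimately show ?thesis by blast
qed

end
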